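(* Let $d\ge 1$ and let $(\eta_t)_{t\ge 0}$ be an averaging process on $\mathbb{Z}^d$ started from a probability distribution $\eta$ on $\mathbb{Z}^d$. For any continuous, bounded function $f:\mathbb{R}^d\to\mathbb{R}$, $$\sum_{x\in\mathbb{Z}^d} f\!\left(\frac{x}{\sqrt{t/2}}\right)\eta_t^x \;\longrightarrow\; \int_{\mathbb{R}^d} f\,d\nu \quad\text{in probability as } t\to\infty,$$ where $\nu$ is the $d$-dimensional standard Gaussian measure.
   Context: $\mathbb{Z}^d$ is regarded as a graph with edges $\{x,y\}$ given by pairs $x,y\in\mathbb{Z}^d$ with $|x-y|=\sum_{j=1}^d|x_j-y_j|=1$. The averaging process $(\eta_t)_{t\ge0}$ on $\mathbb{Z}^d$ started from a probability distribution $\eta$ on $\mathbb{Z}^d$ is defined as follows. To each edge $e$ is attached a Poisson process (clock) of rate $1/(2d)$, independent over edges. Set $\eta_0=\eta$, and write $\eta_t^x$ for the $x$-coordinate of $\eta_t$. Whenever the clock on edge $\{x,y\}$ rings at time $t$, set $\eta_t^x=\eta_t^y=(\eta_{t^-}^x+\eta_{t^-}^y)/2$; a coordinate $\eta^w$ changes only at ring times of edges containing $w$. Almost surely this determines a unique process, and $\eta_t$ is a probability distribution on $\mathbb{Z}^d$ for all $t$. The $d$-dimensional standard Gaussian measure is the Gaussian measure on $\mathbb{R}^d$ with mean $0$ and identity covariance matrix.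
   Formalization: The scaling x/√(t/2) is replaced by x/√(t/(2d)): with edge rate 1/(2d) the mass spreads with covariance (t/(2d))·I, so the stated limit with identity covariance is false for d ≥ 2; for d = 1 the two statements coincide. *)

theory Defs
  imports "HOL-Probability.Probability"
begin

definition lattice_edges :: "(int ^ 'd::finite) set set" where
  "lattice_edges = {{x, y} | x y. (\<Sum>j\<in>UNIV. \<bar>x $ j - y $ j\<bar>) = 1}"

text \<open>Values at negative times are junk and never constrained. Since the paths are almost surely
  nondecreasing, the truncated subtraction on \<^typ>\<open>nat\<close> is the true increment.\<close>

locale poisson_process = prob_space M for M :: "'w measure" +
  fixes rate :: real and N :: "real \<Rightarrow> 'w \<Rightarrow> nat"
  assumes rate_pos: "0 < rate"
    and random_variable_count: "0 \<le> t \<Longrightarrow> random_variable (count_space UNIV) (N t)"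
    and paths: "AE \<omega> in M. N 0 \<omega> = 0 \<and> mono_on {0..} (\<lambda>t. N t \<omega>) \<and>
      (\<forall>t\<ge>0. continuous (at_right t) (\<lambda>s. N s \<omega>))"
    and increments_poisson: "0 \<le> s \<Longrightarrow> s < t \<Longrightarrow>
      distr M (count_space UNIV) (\<lambda>\<omega>. N t \<omega> - N s \<omega>) = measure_pmf (poisson_pmf (rate * (t - s)))"
    and increments_indep: "\<And>\<tau> :: nat \<Rightarrow> real. 0 \<le> \<tau> 0 \<Longrightarrow> strict_mono \<tau> \<Longrightarrow>
      indep_vars (\<lambda>_. count_space UNIV) (\<lambda>i \<omega>. N (\<tau> (Suc i)) \<omega> - N (\<tau> i) \<omega>) {..<n}"

text \<open>The clock with (nondecreasing) counting path \<open>c\<close> rings at the jump times of \<open>c\<close>.\<close>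

definition rings_at :: "(real \<Rightarrow> nat) \<Rightarrow> real \<Rightarrow> bool" where
  "rings_at c t \<longleftrightarrow> 0 < t \<and> (\<forall>s\<in>{0..<t}. c s < c t)"

text \<open>\<open>N e\<close> is the clock of the edge \<open>e\<close>, \<open>\<mu>\<close> the initial distribution, and \<open>\<eta> t \<omega> x\<close> the
  \<open>x\<close>-coordinate of the process at time \<open>t\<close>. Independence over edges is independence of the clocks
  as random elements of the path space. That \<open>\<eta> t\<close> stays a probability distribution is an almost
  sure consequence of the dynamics and is not assumed.\<close>

locale averaging_process = prob_space M for M :: "'w measure" +
  fixes N :: "(int ^ 'd::finite) set \<Rightarrow> real \<Rightarrow> 'w \<Rightarrow> nat"
    and \<mu> :: "(int ^ 'd) pmf"
    and \<eta> :: "real \<Rightarrow> 'w \<Rightarrow> int ^ 'd \<Rightarrow> real"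
  assumes clocks_poisson:
      "e \<in> lattice_edges \<Longrightarrow> poisson_process M (1 / (2 * real CARD('d))) (N e)"
    and clocks_indep: "indep_vars (\<lambda>_. Pi\<^sub>M {0..} (\<lambda>_. count_space UNIV))
      (\<lambda>e \<omega>. \<lambda>t\<in>{0..}. N e t \<omega>) lattice_edges"
    and random_variable_coordinate: "0 \<le> t \<Longrightarrow> random_variable borel (\<lambda>\<omega>. \<eta> t \<omega> x)"
    and initial: "AE \<omega> in M. \<forall>x. \<eta> 0 \<omega> x = pmf \<mu> x"
    and averaging: "AE \<omega> in M. \<forall>x y t. {x, y} \<in> lattice_edges \<longrightarrow> rings_at (\<lambda>s. N {x, y} s \<omega>) t \<longrightarrow>
      \<eta> t \<omega> x = (Lim (at_left t) (\<lambda>s. \<eta> s \<omega> x) + Lim (at_left t) (\<lambda>s. \<eta> s \<omega> y)) / 2 \<and>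
      \<eta> t \<omega> y = (Lim (at_left t) (\<lambda>s. \<eta> s \<omega> x) + Lim (at_left t) (\<lambda>s. \<eta> s \<omega> y)) / 2"
    and constant_between_rings: "AE \<omega> in M. \<forall>w s t. 0 \<le> s \<longrightarrow> s < t \<longrightarrow>
      (\<forall>e\<in>lattice_edges. w \<in> e \<longrightarrow> (\<forall>u\<in>{s<..t}. \<not> rings_at (\<lambda>r. N e r \<omega>) u)) \<longrightarrow>
      \<eta> t \<omega> w = \<eta> s \<omega> w"

definition std_gaussian :: "(real ^ 'd::finite) measure" where
  "std_gaussian = density lborel (\<lambda>x. ennreal (\<Prod>i\<in>UNIV. std_normal_density (x $ i)))"

text \<open>Measurability is part of the notion: \<^const>\<open>measure\<close> is \<open>0\<close> on nonmeasurable sets.\<close>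

definition tendsto_in_probability ::
    "'w measure \<Rightarrow> ('i \<Rightarrow> 'w \<Rightarrow> real) \<Rightarrow> real \<Rightarrow> 'i filter \<Rightarrow> bool" where
  "tendsto_in_probability M X c F \<longleftrightarrow>
    (\<forall>\<^sub>F t in F. X t \<in> borel_measurable M) \<and>
    (\<forall>\<epsilon>>0. ((\<lambda>t. measure M {\<omega> \<in> space M. \<bar>X t \<omega> - c\<bar> > \<epsilon>}) \<longlongrightarrow> 0) F)"

text \<open>Under these dynamics the expected mass performs a simple random walk of total jump rate
  \<open>1/2\<close>: each coordinate has variance \<open>t / (2 * d)\<close>, and the expected squared Euclidean norm grows
  by \<open>t / 2\<close> in total. The diffusive scale for which the limit has identity covariance is
  therefore \<open>sqrt (t / (2 * d))\<close>, which is \<open>sqrt (t / 2)\<close> for \<open>d = 1\<close>; with \<open>sqrt (t / 2)\<close>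
  the limit would have covariance \<open>1 / d\<close> times the identity.\<close>

definition rescale :: "real \<Rightarrow> int ^ 'd::finite \<Rightarrow> real ^ 'd" where
  "rescale t x = (\<chi> j. real_of_int (x $ j) / sqrt (t / (2 * real CARD('d))))"

end

theory Submission
  imports Defs "HOL-Real_Asymp.Real_Asymp"
begin

text \<open>
  In expectation the mass of the averaging process performs a simple random walk of jump rate
  \<open>1 / 2\<close>, so the central limit theorem makes the expected profile Gaussian on the scale
  \<open>sqrt (t / (2 * d))\<close>. The point is that the random profile is close to its expectation, and the
  reason is an exchange between fluctuation and energy. When the edge \<open>{x, y}\<close> rings, the average
  \<open>\<Sum> g \<eta>\<close> of a test function changes by \<open>(g x - g y) (\<eta> y - \<eta> x) / 2\<close>, while \<open>\<Sum> \<eta>\<^sup>2\<close> loses exactly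
  \<open>(\<eta> x - \<eta> y)\<^sup>2 / 2\<close>. If \<open>g\<close> varies by at most \<open>L\<close> along edges, every squared change is therefore
  bounded by \<open>L\<^sup>2\<close> times the loss of \<open>\<Sum> \<eta>\<^sup>2\<close>. Changes at different times are uncorrelated once the
  heat flow of \<open>g\<close> is followed backwards in time (which preserves \<open>L\<close>), and \<open>\<Sum> \<eta>\<^sup>2 \<le> 1\<close> at the start,
  so the variance of \<open>\<Sum> g \<eta>\<close> is at most \<open>L\<^sup>2\<close> at all times. For a test function seen on the diffusive
  scale \<open>L\<close> tends to \<open>0\<close>.

  This is carried out in discrete time. The interval \<open>[0, t]\<close> is cut into \<open>m\<close> pieces, and only the number
  of rings of each edge in each piece is kept; these numbers are independent Poisson variables
  (\<open>increments_law\<close>). Within one piece all edges that rang act at once, by a linear update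
  that agrees with the averaging dynamics if these edges ring once and do not touch each other. For
  this linear evolution on a finite graph the fluctuation bound is \<open>averaging_variance_bound\<close>. To
  compare it with the process, the set of sites that influence a finite set \<open>F\<close> is traced backwards
  in time; a clash is a second ring next to this set within one piece. The expected size of the set
  grows at most by the factor \<open>exp t\<close>, so a clash has probability of order \<open>1 / m\<close> (\<open>prob_clashes\<close>),
  and if there is none the process follows the linear evolution on \<open>F\<close> (\<open>run_follows_dynamics\<close>). The same
  comparison yields that the process is almost surely nonnegative with total mass at most \<open>1\<close>. The
  result is \<open>concentration\<close>.

  The expected profile is the \<open>m\<close>-th power of the discrete heat operator. On products of functions of one
  coordinate this operator is, up to an error of order \<open>1 / m\<^sup>2\<close> per step, the product of one-dimensional
  lazy walk operators (\<open>heat_step_product_approx\<close>), for which the characteristic functions are explicit and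
  the continuity theorem of Levy gives the Gaussian limit. Hence the theorem for products of compactly
  supported functions of one coordinate (\<open>product_mean_converges\<close>). By the Stone-Weierstrass theorem the
  sums of products are dense on boxes, and no mass is lost at infinity since the vague limit is a
  probability measure; this gives all bounded continuous functions.
\<close>

section \<open>Independent Bernoulli and Poisson fields\<close>

lemma expectation_bind_pmf_finite:
  fixes f :: "'b \<Rightarrow> real"
  assumes "finite (set_pmf p)" "\<And>x. x \<in> set_pmf p \<Longrightarrow> finite (set_pmf (q x))"
  shows "measure_pmf.expectation (bind_pmf p q) f
    = measure_pmf.expectation p (\<lambda>x. measure_pmf.expectation (q x) f)"
  using pmf_expectation_bind[where h=f, OF assms(1) assms(2) subset_refl]
  by (simp add: integral_measure_pmf[OF assms(1)])

lemma expectation_mono_finite: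
  fixes f g :: "'b \<Rightarrow> real"
  assumes "finite (set_pmf p)" "\<And>x. x \<in> set_pmf p \<Longrightarrow> f x \<le> g x"
  shows "measure_pmf.expectation p f \<le> measure_pmf.expectation p g"
  by (intro integral_mono_AE integrable_measure_pmf_finite assms(1)) (use assms(2) in \<open>auto simp: AE_measure_pmf_iff\<close>)

abbreviation bernoulli_field :: "'e set \<Rightarrow> real \<Rightarrow> ('e \<Rightarrow> bool) pmf" where
  "bernoulli_field E p \<equiv> Pi_pmf E False (\<lambda>_. bernoulli_pmf p)"

lemma finite_set_Pi_pmf [simp]:
  fixes q :: "'e \<Rightarrow> 'b pmf"
  assumes "finite E" "\<And>e. e \<in> E \<Longrightarrow> finite (set_pmf (q e))"
  shows "finite (set_pmf (Pi_pmf E d q))"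
  using assms by (simp add: set_Pi_pmf finite_PiE_dflt)

lemma finite_set_bernoulli [simp]: "finite (set_pmf (bernoulli_pmf p))"
  by (rule finite_subset[of _ UNIV]) auto

lemma finite_set_replicate_pmf [simp]:
  assumes "finite (set_pmf p)"
  shows "finite (set_pmf (replicate_pmf n p))"
  using assms by (induction n) auto

text \<open>Both fluctuation and energy are controlled by this identity: the shift \<open>a\<close> makes it
  a formula for the second moment around any centre, and it is what makes the induction over \<open>E\<close> work.\<close>

lemma bernoulli_field_second_moment:
  fixes a :: real and c :: "'e \<Rightarrow> real"
  assumes "finite E" "0 \<le> p" "p \<le> 1"
  shows "measure_pmf.expectation (bernoulli_field E p) (\<lambda>R. (a + (\<Sum>e\<in>E. of_bool (R e) * c e))\<^sup>2)
    = (a + p * (\<Sum>e\<in>E. c e))\<^sup>2 + p * (1 - p) * (\<Sum>e\<in>E. (c e)\<^sup>2)"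
  using assms(1)
proof (induction E arbitrary: a)
  case empty
  then show ?case by simp
next
  case (insert x F)
  let ?I = "\<lambda>b. measure_pmf.expectation (bernoulli_field F p)
      (\<lambda>R. ((a + of_bool b * c x) + (\<Sum>e\<in>F. of_bool (R e) * c e))\<^sup>2)"
  have eq: "(a + (\<Sum>e\<in>insert x F. of_bool ((R(x := b)) e) * c e))
     = (a + of_bool b * c x) + (\<Sum>e\<in>F. of_bool (R e) * c e)" for R b
  proof -
    have "(\<Sum>e\<in>F. of_bool ((R(x := b)) e) * c e) = (\<Sum>e\<in>F. of_bool (R e) * c e)"
      using insert.hyps by (intro sum.cong arg_cong2[where f="(*)"]) auto
    moreover have "(\<Sum>e\<in>insert x F. of_bool ((R(x := b)) e) * c e)
        = of_bool ((R(x := b)) x) * c x + (\<Sum>e\<in>F. of_bool ((R(x := b)) e) * c e)"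
      using insert.hyps by (rule sum.insert)
    ultimately show ?thesis by (simp only: fun_upd_same add.assoc)
  qed
  have "measure_pmf.expectation (bernoulli_field (insert x F) p)
      (\<lambda>R. (a + (\<Sum>e\<in>insert x F. of_bool (R e) * c e))\<^sup>2)
     = measure_pmf.expectation (bernoulli_pmf p) ?I"
    using insert.hyps
    by (subst Pi_pmf_insert', simp, simp)
       (subst expectation_bind_pmf_finite, simp, simp,
        subst expectation_bind_pmf_finite, simp, simp, simp add: eq del: sum_of_bool_mult_eq fun_upd_apply sum.insert)
  also have "\<dots> = p * ?I True + (1 - p) * ?I False"
    using assms by (simp)
  also have "\<dots> = p * ((a + c x + p * sum c F)\<^sup>2 + p * (1 - p) * (\<Sum>e\<in>F. (c e)\<^sup>2))
     + (1 - p) * ((a + p * sum c F)\<^sup>2 + p * (1 - p) * (\<Sum>e\<in>F. (c e)\<^sup>2))"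
    using insert.IH[of "a + c x"] insert.IH[of a] by simp
  also have "\<dots> = (a + p * sum c (insert x F))\<^sup>2 + p * (1 - p) * (\<Sum>e\<in>insert x F. (c e)\<^sup>2)"
    using insert.hyps by (simp add: power2_eq_square algebra_simps)
  finally show ?case .
qed

abbreviation poisson_field :: "'e set \<Rightarrow> real \<Rightarrow> ('e \<Rightarrow> nat) pmf" where
  "poisson_field E r \<equiv> Pi_pmf E 0 (\<lambda>_. poisson_pmf r)"

lemma poisson_ge_1:
  assumes "0 < r"
  shows "measure_pmf.prob (poisson_pmf r) {0<..} = 1 - exp (- r)"
proof -
  have "{0<..} = UNIV - {0::nat}" by auto
  then have "measure_pmf.prob (poisson_pmf r) {0<..} = 1 - measure_pmf.prob (poisson_pmf r) {0}"
    using measure_pmf.prob_compl[of "{0}" "poisson_pmf r"] by simp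
  then show ?thesis using assms by (simp add: measure_pmf_single)
qed

lemma one_minus_exp_le: "1 - exp (- r) \<le> (r::real)"
  using exp_ge_add_one_self[of "-r"] by simp

text \<open>Since \<open>1 - (1 + r) exp (- r) \<le> 1 - (1 + r) (1 - r)\<close>.\<close>

lemma poisson_ge_2:
  assumes "0 < r"
  shows "measure_pmf.prob (poisson_pmf r) {2..} \<le> r\<^sup>2"
proof -
  have "{2..} = UNIV - {0, 1::nat}" by auto
  then have "measure_pmf.prob (poisson_pmf r) {2..} = 1 - measure_pmf.prob (poisson_pmf r) {0, 1}"
    using measure_pmf.prob_compl[of "{0, 1}" "poisson_pmf r"] by simp
  also have "measure_pmf.prob (poisson_pmf r) {0, 1} = (1 + r) * exp (- r)"
    using assms by (subst measure_measure_pmf_finite) (simp_all add: algebra_simps)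
  also have "1 - (1 + r) * exp (- r) \<le> 1 - (1 + r) * (1 - r)"
    using exp_ge_add_one_self[of "-r"] assms by (intro diff_left_mono mult_left_mono) auto
  also have "\<dots> = r\<^sup>2" by (simp add: power2_eq_square algebra_simps)
  finally show ?thesis .
qed

lemma poisson_field_ge_1:
  assumes "finite E" "0 < r" "e \<in> E"
  shows "measure_pmf.prob (poisson_field E r) {D. 0 < D e} \<le> r"
proof -
  have "measure_pmf.prob (poisson_field E r) {D. 0 < D e}
    = measure_pmf.prob (map_pmf (\<lambda>D. D e) (poisson_field E r)) {0<..}"
    by (simp add: measure_map_pmf vimage_def)
  also have "\<dots> = 1 - exp (- r)"
    using assms by (simp add: Pi_pmf_component poisson_ge_1)
  finally show ?thesis using one_minus_exp_le[of r] by simp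
qed

lemma poisson_field_ge_2:
  assumes "finite E" "0 < r" "e \<in> E"
  shows "measure_pmf.prob (poisson_field E r) {D. 2 \<le> D e} \<le> r\<^sup>2"
proof -
  have "measure_pmf.prob (poisson_field E r) {D. 2 \<le> D e}
    = measure_pmf.prob (map_pmf (\<lambda>D. D e) (poisson_field E r)) {2..}"
    by (simp add: measure_map_pmf vimage_def)
  then show ?thesis
    using assms by (simp add: Pi_pmf_component poisson_ge_2)
qed

lemma poisson_field_two:
  assumes "finite E" "0 < r" "e \<in> E" "f \<in> E" "f \<noteq> e"
  shows "measure_pmf.prob (poisson_field E r) {D. 0 < D e \<and> 0 < D f} \<le> r\<^sup>2"
proof -
  let ?B = "\<lambda>x. if x \<in> {e, f} then {0<..} else UNIV :: nat set"
  have "measure_pmf.prob (poisson_field E r) {D. 0 < D e \<and> 0 < D f}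
    = measure_pmf.prob (poisson_field E r) (Pi E ?B)"
    using assms by (intro arg_cong[where f="measure_pmf.prob _"]) (auto simp: Pi_def)
  also have "\<dots> = (\<Prod>x\<in>E. measure_pmf.prob (poisson_pmf r) (?B x))"
    by (rule measure_Pi_pmf_Pi) (use assms in auto)
  also have "\<dots> = (\<Prod>x\<in>E. if x \<in> {e, f} then 1 - exp (- r) else 1)"
    using poisson_ge_1[OF assms(2)] by (intro prod.cong refl) auto
  also have "\<dots> = (\<Prod>x\<in>{e, f}. 1 - exp (- r))"
    by (rule prod.mono_neutral_cong_right) (use assms in auto)
  also have "\<dots> = (1 - exp (- r))\<^sup>2" using assms by (simp add: power2_eq_square)
  also have "\<dots> \<le> r\<^sup>2"
    using one_minus_exp_le[of r] assms by (intro power_mono) auto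
  finally show ?thesis .
qed

lemma replicate_pmf_map: "replicate_pmf n (map_pmf f p) = map_pmf (map f) (replicate_pmf n p)"
  by (induction n) (simp_all add: map_pmf_def bind_assoc_pmf bind_return_pmf)

lemma poisson_positive:
  assumes "0 < r"
  shows "map_pmf (\<lambda>n. 0 < n) (poisson_pmf r) = bernoulli_pmf (1 - exp (- r))"
proof (rule pmf_eqI)
  fix b
  have p: "0 \<le> 1 - exp (- r)" "1 - exp (- r) \<le> 1" using assms by auto
  have *: "(\<lambda>n::nat. 0 < n) -` {True} = {0<..}" "(\<lambda>n::nat. 0 < n) -` {False} = {0}" by auto
  show "pmf (map_pmf (\<lambda>n. 0 < n) (poisson_pmf r)) b = pmf (bernoulli_pmf (1 - exp (- r))) b"
    using p poisson_ge_1[OF assms] assms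
    by (cases b) (simp_all add: pmf_map * measure_pmf_single)
qed

lemma poisson_field_positive:
  assumes "finite E" "0 < r"
  shows "map_pmf (\<lambda>D e. 0 < D e) (poisson_field E r) = bernoulli_field E (1 - exp (- r))"
  using Pi_pmf_map[OF assms(1), of "\<lambda>n. 0 < n" 0 False "\<lambda>_. poisson_pmf r"]
  by (simp add: poisson_positive[OF assms(2)] comp_def)

lemma prob_Chebyshev_finite:
  fixes Z :: "'b \<Rightarrow> real"
  assumes "finite (set_pmf p)" "0 < \<epsilon>"
  shows "measure_pmf.prob p {x. \<epsilon> < \<bar>Z x - c\<bar>} \<le> measure_pmf.expectation p (\<lambda>x. (Z x - c)\<^sup>2) / \<epsilon>\<^sup>2"
proof -
  have "\<epsilon>\<^sup>2 * measure_pmf.prob p {x. \<epsilon> < \<bar>Z x - c\<bar>}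
    = measure_pmf.expectation p (\<lambda>x. \<epsilon>\<^sup>2 * indicator {x. \<epsilon> < \<bar>Z x - c\<bar>} x)" by simp
  also have "\<dots> \<le> measure_pmf.expectation p (\<lambda>x. (Z x - c)\<^sup>2)"
  proof (rule expectation_mono_finite[OF assms(1)])
    fix x
    have "\<epsilon>\<^sup>2 \<le> (Z x - c)\<^sup>2" if "\<epsilon> < \<bar>Z x - c\<bar>"
      using that assms(2) power_mono[of \<epsilon> "\<bar>Z x - c\<bar>" 2] by simp
    then show "\<epsilon>\<^sup>2 * indicator {x. \<epsilon> < \<bar>Z x - c\<bar>} x \<le> (Z x - c)\<^sup>2"
      by (simp add: indicator_def)
  qed
  finally show ?thesis using assms(2) by (simp add: field_simps)
qed

lemma pmf_replicate_pmf:
  "pmf (replicate_pmf n p) xs = (if length xs = n then (\<Prod>x\<leftarrow>xs. pmf p x) else 0)"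
proof (induction n arbitrary: xs)
  case 0
  then show ?case by (auto simp: indicator_def)
next
  case (Suc n)
  have eq: "replicate_pmf (Suc n) p = map_pmf (\<lambda>(x, xs). x # xs) (pair_pmf p (replicate_pmf n p))"
    by (simp add: pair_pmf_def map_bind_pmf map_pmf_def bind_assoc_pmf bind_return_pmf)
  have inj: "inj (\<lambda>(x, xs). x # xs)" by (auto intro: injI)
  show ?case
  proof (cases xs)
    case Nil
    have "xs \<notin> (\<lambda>(x, xs). x # xs) ` set_pmf (pair_pmf p (replicate_pmf n p))" using Nil by auto
    then show ?thesis using Nil unfolding eq by (subst pmf_map_outside) auto
  next
    case (Cons y ys)
    then show ?thesis
      using pmf_map_inj'[OF inj, of "pair_pmf p (replicate_pmf n p)" "(y, ys)"] Suc.IH[of ys]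
      unfolding eq by (simp add: pmf_pair)
  qed
qed

section \<open>Averaging on a finite graph: energy and fluctuations\<close>

locale finite_graph =
  fixes V :: "'v set" and E :: "'e set" and src tgt :: "'e \<Rightarrow> 'v" and deg :: nat
  assumes finite_V: "finite V" and finite_E: "finite E"
    and src_V: "e \<in> E \<Longrightarrow> src e \<in> V" and tgt_V: "e \<in> E \<Longrightarrow> tgt e \<in> V"
    and no_loop: "e \<in> E \<Longrightarrow> src e \<noteq> tgt e"
    and degree: "card {e\<in>E. src e = x \<or> tgt e = x} \<le> deg"
begin

text \<open>All edges act at once with weights \<open>c\<close>. For \<open>c\<close> the indicator of a set of disjoint edges
  this is averaging along these edges. Being linear in \<open>c\<close>, it has as expectation over independent weights the
  same operator with constant weight; a sequential composition of averagings would not.\<close>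

definition exchange :: "('e \<Rightarrow> real) \<Rightarrow> ('v \<Rightarrow> real) \<Rightarrow> 'v \<Rightarrow> real" where
  "exchange c f x = f x + (\<Sum>e\<in>E. c e * ((f (tgt e) - f (src e)) / 2
      * (of_bool (x = src e) - of_bool (x = tgt e))))"

abbreviation update :: "('e \<Rightarrow> bool) \<Rightarrow> ('v \<Rightarrow> real) \<Rightarrow> 'v \<Rightarrow> real" where
  "update R \<equiv> exchange (\<lambda>e. of_bool (R e))"

definition pairing :: "('v \<Rightarrow> real) \<Rightarrow> ('v \<Rightarrow> real) \<Rightarrow> real" where
  "pairing f g = (\<Sum>x\<in>V. f x * g x)"

abbreviation energy :: "('v \<Rightarrow> real) \<Rightarrow> real" where
  "energy f \<equiv> (\<Sum>e\<in>E. (f (tgt e) - f (src e))\<^sup>2)"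

text \<open>The head of the list is the latest update.\<close>

fun run :: "('e \<Rightarrow> bool) list \<Rightarrow> ('v \<Rightarrow> real) \<Rightarrow> 'v \<Rightarrow> real" where
  "run [] f = f"
| "run (R # Rs) f = update R (run Rs f)"

lemma sum_V_edge:
  fixes g :: "'v \<Rightarrow> real"
  assumes "e \<in> E"
  shows "(\<Sum>x\<in>V. g x * (of_bool (x = src e) - of_bool (x = tgt e))) = g (src e) - g (tgt e)"
proof -
  have "(\<Sum>x\<in>V. g x * (of_bool (x = src e) - of_bool (x = tgt e)))
     = (\<Sum>x\<in>V. (if x = src e then g x else 0)) - (\<Sum>x\<in>V. (if x = tgt e then g x else (0::real)))"
    by (subst sum_subtractf[symmetric], rule sum.cong) auto
  then show ?thesis using src_V[OF assms] tgt_V[OF assms] finite_V by simp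
qed

lemma pairing_exchange:
  "pairing g (exchange c f)
    = pairing g f + (\<Sum>e\<in>E. c e * ((f (tgt e) - f (src e)) / 2 * (g (src e) - g (tgt e))))"
proof -
  have "pairing g (exchange c f) = pairing g f + (\<Sum>x\<in>V. \<Sum>e\<in>E. c e * ((f (tgt e) - f (src e)) / 2
      * (g x * (of_bool (x = src e) - of_bool (x = tgt e)))))"
    unfolding pairing_def exchange_def
    by (simp only: distrib_left sum.distrib sum_distrib_left mult_ac)
  also have "(\<Sum>x\<in>V. \<Sum>e\<in>E. c e * ((f (tgt e) - f (src e)) / 2
      * (g x * (of_bool (x = src e) - of_bool (x = tgt e)))))
    = (\<Sum>e\<in>E. c e * ((f (tgt e) - f (src e)) / 2
      * (\<Sum>x\<in>V. g x * (of_bool (x = src e) - of_bool (x = tgt e)))))"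
    by (subst sum.swap) (simp add: sum_distrib_left)
  also have "\<dots> = (\<Sum>e\<in>E. c e * ((f (tgt e) - f (src e)) / 2 * (g (src e) - g (tgt e))))"
    by (intro sum.cong refl) (simp add: sum_V_edge)
  finally show ?thesis .
qed

text \<open>Symmetry moves the heat flow from the evolving profile to the test function.\<close>

lemma exchange_pairing_commute: "pairing (exchange c g) f = pairing g (exchange c f)"
proof -
  have "pairing (exchange c g) f = pairing f (exchange c g)" by (simp add: pairing_def mult.commute)
  also have "\<dots> = pairing g (exchange c f)"
    unfolding pairing_exchange
    by (intro arg_cong2[where f="(+)"] sum.cong) (simp_all add: pairing_def algebra_simps)
  finally show ?thesis .
qed

lemma expectation_pairing_exchange:
  fixes p :: real
  assumes "0 \<le> p" "p \<le> 1"
  shows "measure_pmf.expectation (bernoulli_field E p)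
      (\<lambda>R. (pairing g (update R f) - c)\<^sup>2)
    = (pairing (exchange (\<lambda>_. p) g) f - c)\<^sup>2
      + p * (1 - p) * (\<Sum>e\<in>E. ((f (tgt e) - f (src e)) / 2 * (g (src e) - g (tgt e)))\<^sup>2)"
proof -
  let ?a = "\<lambda>e. (f (tgt e) - f (src e)) / 2 * (g (src e) - g (tgt e))"
  have "measure_pmf.expectation (bernoulli_field E p)
      (\<lambda>R. (pairing g (update R f) - c)\<^sup>2)
    = measure_pmf.expectation (bernoulli_field E p)
      (\<lambda>R. ((pairing g f - c) + (\<Sum>e\<in>E. of_bool (R e) * ?a e))\<^sup>2)"
    unfolding pairing_exchange by (simp add: algebra_simps)
  also have "\<dots> = (pairing g f - c + p * (\<Sum>e\<in>E. ?a e))\<^sup>2 + p * (1 - p) * (\<Sum>e\<in>E. (?a e)\<^sup>2)"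
    by (rule bernoulli_field_second_moment[OF finite_E assms])
  also have "pairing g f - c + p * (\<Sum>e\<in>E. ?a e) = pairing (exchange (\<lambda>_. p) g) f - c"
    unfolding exchange_pairing_commute pairing_exchange by (simp add: sum_distrib_left)
  finally show ?thesis .
qed

lemma sum_incident:
  fixes a :: "'e \<Rightarrow> real"
  shows "(\<Sum>x\<in>V. \<Sum>e\<in>E. (a e * (of_bool (x = src e) - of_bool (x = tgt e)))\<^sup>2) = 2 * (\<Sum>e\<in>E. (a e)\<^sup>2)"
proof -
  have "(\<Sum>x\<in>V. (a e * (of_bool (x = src e) - of_bool (x = tgt e)))\<^sup>2) = 2 * (a e)\<^sup>2" if "e \<in> E" for e
  proof -
    have "(\<Sum>x\<in>V. (a e * (of_bool (x = src e) - of_bool (x = tgt e)))\<^sup>2)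
      = (\<Sum>x\<in>V. (if x = src e then (a e)\<^sup>2 else 0)) + (\<Sum>x\<in>V. (if x = tgt e then (a e)\<^sup>2 else 0))"
      using no_loop[OF that] by (subst sum.distrib[symmetric], intro sum.cong) auto
    then show ?thesis using src_V[OF that] tgt_V[OF that] finite_V by simp
  qed
  then show ?thesis by (subst sum.swap) (simp add: sum_distrib_left)
qed

text \<open>If the edges were disjoint, the squared norm would drop by half the energy of the ringing
  edges. The terms where edges at a common vertex both ring are of order \<open>p\<^sup>2\<close>; the bound on \<open>p * deg\<close>
  lets them eat up at most half of the gain.\<close>

lemma expectation_norm_exchange:
  fixes p :: real
  assumes "0 \<le> p" "p * deg \<le> 1 / 2" "p \<le> 1"
  shows "measure_pmf.expectation (bernoulli_field E p)
      (\<lambda>R. pairing (update R f) (update R f))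
    \<le> pairing f f - p / 4 * energy f"
proof -
  define a where "a e = (f (tgt e) - f (src e)) / 2" for e
  define k where "k x e = a e * (of_bool (x = src e) - of_bool (x = tgt e))" for x e
  have collect: "N + 2 * p * - (D / 2) + (p + p\<^sup>2 * deg) * (D / 2) = N - p / 2 * (1 - p * deg) * D" for N D
    by (simp add: field_simps power2_eq_square)
  have ptw: "(f x + p * (\<Sum>e\<in>E. k x e))\<^sup>2 + p * (1 - p) * (\<Sum>e\<in>E. (k x e)\<^sup>2)
     \<le> (f x)\<^sup>2 + 2 * p * f x * (\<Sum>e\<in>E. k x e) + (p + p\<^sup>2 * deg) * (\<Sum>e\<in>E. (k x e)\<^sup>2)" for x
  proof -
    let ?I = "{e\<in>E. src e = x \<or> tgt e = x}"
    have s1: "(\<Sum>e\<in>E. k x e) = (\<Sum>e\<in>?I. k x e)"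
      by (rule sum.mono_neutral_right) (auto simp: finite_E k_def)
    have s2: "(\<Sum>e\<in>E. (k x e)\<^sup>2) = (\<Sum>e\<in>?I. (k x e)\<^sup>2)"
      by (rule sum.mono_neutral_right) (auto simp: finite_E k_def)
    have "(\<Sum>e\<in>?I. k x e)\<^sup>2 \<le> (\<Sum>e\<in>?I. (k x e)\<^sup>2) * card ?I"
      using sum_squared_le_sum_of_squares[of "\<lambda>e. k x e" ?I] finite_E by simp
    also have "\<dots> \<le> (\<Sum>e\<in>?I. (k x e)\<^sup>2) * deg"
      by (intro mult_left_mono sum_nonneg) (use degree[of x] in auto)
    finally have "p\<^sup>2 * (\<Sum>e\<in>E. k x e)\<^sup>2 \<le> p\<^sup>2 * ((\<Sum>e\<in>E. (k x e)\<^sup>2) * deg)"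
      unfolding s1 s2 by (rule mult_left_mono) simp
    moreover have "p * (1 - p) * (\<Sum>e\<in>E. (k x e)\<^sup>2) \<le> p * (\<Sum>e\<in>E. (k x e)\<^sup>2)"
      using assms by (intro mult_right_mono sum_nonneg) (auto simp: mult_left_le)
    ultimately show ?thesis by (simp add: power2_eq_square algebra_simps)
  qed
  have "measure_pmf.expectation (bernoulli_field E p)
      (\<lambda>R. pairing (update R f) (update R f))
    = (\<Sum>x\<in>V. measure_pmf.expectation (bernoulli_field E p) (\<lambda>R. (f x + (\<Sum>e\<in>E. of_bool (R e) * k x e))\<^sup>2))"
    unfolding pairing_def exchange_def k_def a_def power2_eq_square
    by (rule Bochner_Integration.integral_sum)
       (intro integrable_measure_pmf_finite finite_set_Pi_pmf finite_E finite_set_bernoulli)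
  also have "\<dots> = (\<Sum>x\<in>V. (f x + p * (\<Sum>e\<in>E. k x e))\<^sup>2 + p * (1 - p) * (\<Sum>e\<in>E. (k x e)\<^sup>2))"
    by (simp add: bernoulli_field_second_moment[OF finite_E assms(1,3)])
  also have "\<dots> \<le> (\<Sum>x\<in>V. (f x)\<^sup>2 + 2 * p * f x * (\<Sum>e\<in>E. k x e) + (p + p\<^sup>2 * deg) * (\<Sum>e\<in>E. (k x e)\<^sup>2))"
    by (rule sum_mono) (rule ptw)
  also have "\<dots> = pairing f f + 2 * p * (\<Sum>x\<in>V. \<Sum>e\<in>E. f x * k x e)
      + (p + p\<^sup>2 * deg) * (\<Sum>x\<in>V. \<Sum>e\<in>E. (k x e)\<^sup>2)"
    by (simp add: sum.distrib sum_distrib_left pairing_def power2_eq_square mult.assoc)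
  also have "(\<Sum>x\<in>V. \<Sum>e\<in>E. f x * k x e) = (\<Sum>e\<in>E. a e * (f (src e) - f (tgt e)))"
    by (subst sum.swap) (simp add: k_def mult.left_commute[of _ "a _"] sum_distrib_left[symmetric] sum_V_edge)
  also have "\<dots> = - (energy f / 2)"
    by (simp add: a_def sum_divide_distrib sum_negf[symmetric] power2_eq_square algebra_simps diff_divide_distrib add_divide_distrib)
  also have "(\<Sum>x\<in>V. \<Sum>e\<in>E. (k x e)\<^sup>2) = energy f / 2"
    unfolding k_def sum_incident by (simp add: a_def power_divide sum_divide_distrib[symmetric])
  also have "pairing f f + 2 * p * - (energy f / 2) + (p + p\<^sup>2 * deg) * (energy f / 2)
      = pairing f f - p / 2 * (1 - p * deg) * energy f"
    by (rule collect)
  finally have "measure_pmf.expectation (bernoulli_field E p)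
      (\<lambda>R. pairing (update R f) (update R f))
     \<le> pairing f f - p / 2 * (1 - p * deg) * energy f" .
  moreover have "p / 4 * energy f \<le> p / 2 * (1 - p * deg) * energy f"
  proof (intro mult_right_mono sum_nonneg)
    have "p / 2 * (1 / 2) \<le> p / 2 * (1 - p * deg)" using assms by (intro mult_left_mono) auto
    then show "p / 4 \<le> p / 2 * (1 - p * deg)" by simp
  qed auto
  ultimately show ?thesis by linarith
qed

text \<open>The sequence \<open>g\<close> is the heat flow of \<open>g 0\<close>, so that \<open>pairing (g k)\<close> of the profile
  \<open>k\<close> steps before the end is a martingale in the time of the run. Its increment has variance at most
  \<open>p * L\<^sup>2 / 4 * energy\<close>, and \<open>L\<^sup>2\<close> times the squared norm loses at least as much in expectation. The sum
  of the squared deviation and of \<open>L\<^sup>2\<close> times the squared norm therefore does not grow in mean. The bound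
  is uniform in \<open>m\<close> and in the size of the graph.\<close>

theorem averaging_variance_bound:
  fixes p L :: real
  assumes "0 \<le> p" "p \<le> 1" "p * deg \<le> 1 / 2"
    and g: "\<And>k x. k < m \<Longrightarrow> x \<in> V \<Longrightarrow> g (Suc k) x = exchange (\<lambda>_. p) (g k) x"
    and lip: "\<And>k e. k < m \<Longrightarrow> e \<in> E \<Longrightarrow> \<bar>g k (src e) - g k (tgt e)\<bar> \<le> L"
  shows "measure_pmf.expectation (replicate_pmf m (bernoulli_field E p))
      (\<lambda>Rs. (pairing (g 0) (run Rs f) - pairing (g m) f)\<^sup>2 + L\<^sup>2 * pairing (run Rs f) (run Rs f))
    \<le> L\<^sup>2 * pairing f f"
  using g lip
proof (induction m arbitrary: g)
  case 0
  then show ?case by simp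
next
  case (Suc m)
  \<comment> \<open>The latest update is averaged first, conditionally on the earlier ones. It turns \<open>g 0\<close> into \<open>g 1\<close>
    around the fixed centre \<open>?c\<close>.\<close>
  let ?B = "bernoulli_field E p" and ?c = "pairing (g (Suc m)) f"
  have fin: "finite (set_pmf ?B)" by (simp add: finite_E)
  have rep: "replicate_pmf (Suc m) ?B = bind_pmf (replicate_pmf m ?B) (\<lambda>Rs. map_pmf (\<lambda>R. R # Rs) ?B)"
    by (simp add: map_pmf_def) (subst bind_commute_pmf, rule refl)
  have lip2: "(\<Sum>e\<in>E. ((f (tgt e) - f (src e)) / 2 * (g 0 (src e) - g 0 (tgt e)))\<^sup>2) \<le> L\<^sup>2 / 4 * energy f" for f
  proof -
    have "((f (tgt e) - f (src e)) / 2 * (g 0 (src e) - g 0 (tgt e)))\<^sup>2 \<le> L\<^sup>2 / 4 * (f (tgt e) - f (src e))\<^sup>2"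
      if "e \<in> E" for e
    proof -
      have "(g 0 (src e) - g 0 (tgt e))\<^sup>2 \<le> L\<^sup>2"
        using Suc.prems(2)[of 0 e] that by (simp add: abs_le_square_iff[symmetric])
      then have "(f (tgt e) - f (src e))\<^sup>2 * (g 0 (src e) - g 0 (tgt e))\<^sup>2 \<le> (f (tgt e) - f (src e))\<^sup>2 * L\<^sup>2"
        by (rule mult_left_mono) simp
      then show ?thesis by (simp add: power_mult_distrib power_divide mult.commute)
    qed
    then show ?thesis by (simp add: sum_distrib_left sum_mono)
  qed
  have one: "measure_pmf.expectation ?B (\<lambda>R. (pairing (g 0) (update R h) - ?c)\<^sup>2
      + L\<^sup>2 * pairing (update R h) (update R h))
    \<le> (pairing (g 1) h - ?c)\<^sup>2 + L\<^sup>2 * pairing h h" for h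
  proof -
    have g1: "pairing (exchange (\<lambda>_. p) (g 0)) h = pairing (g 1) h"
      unfolding pairing_def using Suc.prems(1)[of 0] by (intro sum.cong) auto
    have "measure_pmf.expectation ?B (\<lambda>R. (pairing (g 0) (update R h) - ?c)\<^sup>2
      + L\<^sup>2 * pairing (update R h) (update R h))
     = measure_pmf.expectation ?B (\<lambda>R. (pairing (g 0) (update R h) - ?c)\<^sup>2)
      + L\<^sup>2 * measure_pmf.expectation ?B (\<lambda>R. pairing (update R h) (update R h))"
      by (subst Bochner_Integration.integral_add) (simp_all add: integrable_measure_pmf_finite[OF fin])
    also have "\<dots> \<le> ((pairing (g 1) h - ?c)\<^sup>2 + p * (1 - p) * (L\<^sup>2 / 4 * energy h))
       + L\<^sup>2 * (pairing h h - p / 4 * energy h)"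
      unfolding expectation_pairing_exchange[OF assms(1,2)] g1
      by (intro add_mono mult_left_mono order_refl lip2 expectation_norm_exchange)
         (use assms in auto)
    also have "\<dots> \<le> (pairing (g 1) h - ?c)\<^sup>2 + L\<^sup>2 * pairing h h"
    proof -
      have "p * (1 - p) * (L\<^sup>2 / 4 * energy h) \<le> p * (L\<^sup>2 / 4 * energy h)"
        using assms by (intro mult_right_mono mult_nonneg_nonneg sum_nonneg) (auto simp: mult_left_le)
      then show ?thesis by (simp add: algebra_simps)
    qed
    finally show ?thesis .
  qed
  have "measure_pmf.expectation (replicate_pmf (Suc m) ?B)
      (\<lambda>Rs. (pairing (g 0) (run Rs f) - ?c)\<^sup>2 + L\<^sup>2 * pairing (run Rs f) (run Rs f))
    = measure_pmf.expectation (replicate_pmf m ?B) (\<lambda>Rs. measure_pmf.expectation ?B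
       (\<lambda>R. (pairing (g 0) (update R (run Rs f)) - ?c)\<^sup>2
      + L\<^sup>2 * pairing (update R (run Rs f)) (update R (run Rs f))))"
    unfolding rep by (subst expectation_bind_pmf_finite) (use fin in auto)
  also have "\<dots> \<le> measure_pmf.expectation (replicate_pmf m ?B)
      (\<lambda>Rs. (pairing (g 1) (run Rs f) - ?c)\<^sup>2 + L\<^sup>2 * pairing (run Rs f) (run Rs f))"
    by (rule expectation_mono_finite) (use fin one in auto)
  also have "\<dots> \<le> L\<^sup>2 * pairing f f"
    using Suc.IH[of "\<lambda>k. g (Suc k)"] Suc.prems by simp
  finally show ?case .
qed

end

section \<open>Clashing rings\<close>

context finite_graph
begin

text \<open>The vertices whose value before the time step can influence the values on \<open>B\<close> after it, if no
  clash occurs.\<close>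

definition spread :: "('e \<Rightarrow> nat) \<Rightarrow> 'v set \<Rightarrow> 'v set" where
  "spread D B = B \<union> {x. \<exists>e\<in>E. 0 < D e \<and> (src e \<in> B \<and> x = tgt e \<or> tgt e \<in> B \<and> x = src e)}"

text \<open>The update by the ring counts \<open>D\<close> may fail to be determined on \<open>B\<close>: an edge at \<open>B\<close> rings twice, or
  it rings together with an adjacent edge. The adjacent edge may lie at the far end of \<open>e\<close>, away
  from \<open>B\<close>, where the order of the two rings matters just as well.\<close>

definition clash :: "('e \<Rightarrow> nat) \<Rightarrow> 'v set \<Rightarrow> bool" where
  "clash D B \<longleftrightarrow> (\<exists>e\<in>E. (src e \<in> B \<or> tgt e \<in> B) \<and> 0 < D e \<and>
     (2 \<le> D e \<or> (\<exists>f\<in>E. f \<noteq> e \<and> {src e, tgt e} \<inter> {src f, tgt f} \<noteq> {} \<and> 0 < D f)))"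

text \<open>As for \<open>run\<close>, the head of the list is the latest time step; the set of relevant vertices is
  followed backwards in time.\<close>

fun clashes :: "('e \<Rightarrow> nat) list \<Rightarrow> 'v set \<Rightarrow> bool" where
  "clashes [] B \<longleftrightarrow> False"
| "clashes (D # Ds) B \<longleftrightarrow> clash D B \<or> clashes Ds (spread D B)"

lemma card_touching:
  assumes "finite B"
  shows "card {e\<in>E. src e \<in> B \<or> tgt e \<in> B} \<le> card B * deg"
proof -
  have union: "{e\<in>E. src e \<in> B \<or> tgt e \<in> B} = (\<Union>x\<in>B. {e\<in>E. src e = x \<or> tgt e = x})" by auto
  have "card {e\<in>E. src e \<in> B \<or> tgt e \<in> B} \<le> (\<Sum>x\<in>B. card {e\<in>E. src e = x \<or> tgt e = x})"
    unfolding union by (rule card_UN_le[OF assms])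
  also have "\<dots> \<le> card B * deg" using sum_bounded_above[of B _ deg] degree by simp
  finally show ?thesis .
qed

lemma prob_clash:
  fixes r :: real
  assumes "finite B" "0 < r"
  shows "measure_pmf.prob (poisson_field E r) {D. clash D B} \<le> card B * (deg * (1 + 2 * real deg) * r\<^sup>2)"
proof -
  let ?P = "measure_pmf.prob (poisson_field E r)"
  let ?T = "{e\<in>E. src e \<in> B \<or> tgt e \<in> B}"
  let ?N = "\<lambda>e. {f\<in>E. src f \<in> {src e, tgt e} \<or> tgt f \<in> {src e, tgt e}} - {e}"
  have fT: "finite ?T" using finite_E by simp
  have fN: "finite (?N e)" for e using finite_E by simp
  have "{D. clash D B} \<subseteq> (\<Union>e\<in>?T. {D. 2 \<le> D e} \<union> (\<Union>f\<in>?N e. {D. 0 < D e \<and> 0 < D f}))"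
  proof
    fix D assume "D \<in> {D. clash D B}"
    then obtain e where e: "e \<in> ?T" "0 < D e"
      and or: "2 \<le> D e \<or> (\<exists>f\<in>E. f \<noteq> e \<and> {src e, tgt e} \<inter> {src f, tgt f} \<noteq> {} \<and> 0 < D f)"
      unfolding clash_def by auto
    from or show "D \<in> (\<Union>e\<in>?T. {D. 2 \<le> D e} \<union> (\<Union>f\<in>?N e. {D. 0 < D e \<and> 0 < D f}))"
    proof
      assume "2 \<le> D e"
      then show ?thesis by (intro UN_I[OF e(1)]) simp
    next
      assume "\<exists>f\<in>E. f \<noteq> e \<and> {src e, tgt e} \<inter> {src f, tgt f} \<noteq> {} \<and> 0 < D f"
      then obtain f where f: "f \<in> E" "f \<noteq> e" "{src e, tgt e} \<inter> {src f, tgt f} \<noteq> {}" "0 < D f" by auto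
      then have "f \<in> ?N e" by auto
      then show ?thesis using f(4) e(2) by (intro UN_I[OF e(1)] UnI2 UN_I[of f]) simp_all
    qed
  qed
  then have "?P {D. clash D B} \<le> ?P (\<Union>e\<in>?T. {D. 2 \<le> D e} \<union> (\<Union>f\<in>?N e. {D. 0 < D e \<and> 0 < D f}))"
    by (intro measure_pmf.finite_measure_mono) auto
  also have "\<dots> \<le> (\<Sum>e\<in>?T. ?P ({D. 2 \<le> D e} \<union> (\<Union>f\<in>?N e. {D. 0 < D e \<and> 0 < D f})))"
    by (intro measure_pmf.finite_measure_subadditive_finite fT) auto
  also have "\<dots> \<le> (\<Sum>e\<in>?T. (1 + 2 * real deg) * r\<^sup>2)"
  proof (rule sum_mono)
    fix e assume e: "e \<in> ?T"
    have "?P ({D. 2 \<le> D e} \<union> (\<Union>f\<in>?N e. {D. 0 < D e \<and> 0 < D f}))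
      \<le> ?P {D. 2 \<le> D e} + ?P (\<Union>f\<in>?N e. {D. 0 < D e \<and> 0 < D f})"
      by (rule measure_Un_le) auto
    also have "?P (\<Union>f\<in>?N e. {D. 0 < D e \<and> 0 < D f}) \<le> (\<Sum>f\<in>?N e. ?P {D. 0 < D e \<and> 0 < D f})"
      by (intro measure_pmf.finite_measure_subadditive_finite fN) auto
    also have "\<dots> \<le> (\<Sum>f\<in>?N e. r\<^sup>2)"
      by (intro sum_mono poisson_field_two) (use e finite_E assms in auto)
    also have "\<dots> \<le> 2 * deg * r\<^sup>2"
    proof -
      have "card (?N e) \<le> card {f\<in>E. src f \<in> {src e, tgt e} \<or> tgt f \<in> {src e, tgt e}}"
        by (intro card_mono) (use finite_E in auto)
      also have "\<dots> \<le> card {src e, tgt e} * deg" by (rule card_touching) simp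
      also have "\<dots> \<le> 2 * deg" by (simp add: card_insert_if)
      finally have "real (card (?N e)) \<le> real (2 * deg)" by (simp only: of_nat_le_iff)
      then show ?thesis by (simp add: mult_right_mono)
    qed
    also have "?P {D. 2 \<le> D e} \<le> r\<^sup>2"
      by (intro poisson_field_ge_2) (use e finite_E assms in auto)
    finally show "?P ({D. 2 \<le> D e} \<union> (\<Union>f\<in>?N e. {D. 0 < D e \<and> 0 < D f})) \<le> (1 + 2 * real deg) * r\<^sup>2"
      by (simp add: algebra_simps)
  qed
  finally have "?P {D. clash D B} \<le> (\<Sum>e\<in>?T. (1 + 2 * real deg) * r\<^sup>2)" .
  then have "?P {D. clash D B} \<le> real (card ?T) * ((1 + 2 * real deg) * r\<^sup>2)"
    by (simp only: sum_constant)
  moreover have "real (card ?T) * ((1 + 2 * real deg) * r\<^sup>2) \<le> (real (card B) * real deg) * ((1 + 2 * real deg) * r\<^sup>2)"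
  proof (rule mult_right_mono)
    show "real (card ?T) \<le> real (card B) * real deg"
      using card_touching[OF assms(1)] by (metis of_nat_le_iff of_nat_mult)
  qed simp
  ultimately have "?P {D. clash D B} \<le> (real (card B) * real deg) * ((1 + 2 * real deg) * r\<^sup>2)"
    by (rule order_trans)
  then show ?thesis by (simp only: mult.assoc)
qed

lemma finite_spread: "finite B \<Longrightarrow> finite (spread D B)"
proof -
  assume "finite B"
  moreover have "spread D B \<subseteq> B \<union> src ` E \<union> tgt ` E" unfolding spread_def by auto
  ultimately show ?thesis using finite_E by (meson finite_UnI finite_imageI finite_subset)
qed

text \<open>Each of the at most \<open>card B * deg\<close> edges at \<open>B\<close> adds at most one vertex, and does so only
  if it rings.\<close>

lemma expected_card_spread:
  fixes r :: real
  assumes "finite B" "0 < r"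
  shows "(\<integral>\<^sup>+ D. of_nat (card (spread D B)) \<partial>measure_pmf (poisson_field E r)) \<le> ennreal (card B * (1 + deg * r))"
proof -
  let ?T = "{e\<in>E. src e \<in> B \<or> tgt e \<in> B}"
  have fT: "finite ?T" using finite_E by simp
  have "card (spread D B) \<le> card B + (\<Sum>e\<in>?T. of_bool (0 < D e))" for D
  proof -
    have "spread D B \<subseteq> B \<union> (\<lambda>e. if src e \<in> B then tgt e else src e) ` {e\<in>?T. 0 < D e}"
    proof
      fix x assume "x \<in> spread D B"
      then consider "x \<in> B" | e where "e \<in> E" "0 < D e" "src e \<in> B" "x = tgt e"
        | e where "e \<in> E" "0 < D e" "tgt e \<in> B" "x = src e"
        unfolding spread_def by auto
      then show "x \<in> B \<union> (\<lambda>e. if src e \<in> B then tgt e else src e) ` {e\<in>?T. 0 < D e}"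
      proof cases
        case 1
        then show ?thesis by simp
      next
        case (2 e)
        then show ?thesis by (intro UnI2 image_eqI[of _ _ e]) simp_all
      next
        case (3 e)
        then show ?thesis by (cases "src e \<in> B") (simp, intro UnI2 image_eqI[of _ _ e], simp_all)
      qed
    qed
    then have "card (spread D B) \<le> card (B \<union> (\<lambda>e. if src e \<in> B then tgt e else src e) ` {e\<in>?T. 0 < D e})"
      by (rule card_mono[rotated]) (use assms finite_E in simp)
    also have "\<dots> \<le> card B + card {e\<in>?T. 0 < D e}"
      by (rule order_trans[OF card_Un_le add_left_mono[OF card_image_le]]) (use finite_E in auto)
    also have "card {e\<in>?T. 0 < D e} = (\<Sum>e\<in>?T. of_bool (0 < D e))"
      using sum.inter_filter[OF fT, of "\<lambda>_. 1::nat" "\<lambda>e. 0 < D e"] by (simp only: of_bool_def card_eq_sum)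
    finally show ?thesis .
  qed
  then have "(\<integral>\<^sup>+ D. of_nat (card (spread D B)) \<partial>measure_pmf (poisson_field E r))
    \<le> (\<integral>\<^sup>+ D. of_nat (card B + (\<Sum>e\<in>?T. of_bool (0 < D e))) \<partial>measure_pmf (poisson_field E r))"
    by (intro nn_integral_mono) (simp only: of_nat_le_iff)
  also have "\<dots> = (\<integral>\<^sup>+ D. of_nat (card B) + (\<Sum>e\<in>?T. indicator {D. 0 < D e} D) \<partial>measure_pmf (poisson_field E r))"
  proof (rule nn_integral_cong)
    fix D
    have "(of_nat (of_bool (0 < D e)) :: ennreal) = indicator {D. 0 < D e} D" for e :: 'e
      by simp
    then show "(of_nat (card B + (\<Sum>e\<in>?T. of_bool (0 < D e))) :: ennreal)
      = of_nat (card B) + (\<Sum>e\<in>?T. indicator {D. 0 < D e} D)"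
      by (simp only: of_nat_add of_nat_sum)
  qed
  also have "\<dots> = of_nat (card B) + (\<Sum>e\<in>?T. emeasure (measure_pmf (poisson_field E r)) {D. 0 < D e})"
    by (simp add: nn_integral_add nn_integral_sum)
  also have "\<dots> \<le> of_nat (card B) + (\<Sum>e\<in>?T. ennreal r)"
    using poisson_field_ge_1[OF finite_E assms(2)]
    by (intro add_left_mono sum_mono) (simp add: measure_pmf.emeasure_eq_measure ennreal_leI)
  also have "\<dots> = ennreal (card B + card ?T * r)"
  proof -
    have "(\<Sum>e\<in>?T. ennreal r) = ennreal (card ?T * r)" using assms by (subst sum_ennreal) auto
    moreover have "0 \<le> card ?T * r" using assms by simp
    ultimately show ?thesis by (simp only: ennreal_of_nat_eq_real_of_nat ennreal_plus of_nat_0_le_iff)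
  qed
  also have "\<dots> \<le> ennreal (card B * (1 + deg * r))"
  proof (rule ennreal_leI)
    have "real (card ?T) \<le> real (card B) * real deg"
      using card_touching[OF assms(1)] by (metis of_nat_le_iff of_nat_mult)
    then have "real (card ?T) * r \<le> real (card B) * real deg * r"
      using assms by (intro mult_right_mono) auto
    then show "real (card B) + real (card ?T) * r \<le> real (card B) * (1 + real deg * r)"
      by (simp add: algebra_simps)
  qed
  finally show ?thesis .
qed

text \<open>Conditionally on the later steps, a step sees a set of some size \<open>n\<close>: it clashes with
  probability of order \<open>n * r\<^sup>2\<close>, and it multiplies the expected size by at most \<open>1 + deg * r\<close>.\<close>

lemma prob_clashes_aux:
  fixes r :: real
  assumes "finite B" "0 < r"
  shows "emeasure (measure_pmf (replicate_pmf m (poisson_field E r))) {Ds. clashes Ds B}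
    \<le> ennreal (card B * (deg * (1 + 2 * real deg) * r\<^sup>2 * (\<Sum>k<m. (1 + deg * r) ^ k)))"
  using assms(1)
proof (induction m arbitrary: B)
  case 0
  then show ?case by simp
next
  case (Suc m)
  let ?P = "poisson_field E r" and ?C = "deg * (1 + 2 * real deg) * r\<^sup>2" and ?S = "\<Sum>k<m. (1 + deg * r) ^ k"
  have S0: "0 \<le> ?S" using assms by (intro sum_nonneg) simp
  have C0: "0 \<le> ?C" by simp
  have "emeasure (measure_pmf (replicate_pmf (Suc m) ?P)) {Ds. clashes Ds B}
    = (\<integral>\<^sup>+ D. emeasure (measure_pmf (map_pmf (\<lambda>Ds. D # Ds) (replicate_pmf m ?P))) {Ds. clashes Ds B} \<partial>measure_pmf ?P)"
    by (simp add: map_pmf_def[symmetric])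
  also have "\<dots> \<le> (\<integral>\<^sup>+ D. indicator {D. clash D B} D + ennreal (?C * ?S) * of_nat (card (spread D B)) \<partial>measure_pmf ?P)"
  proof (rule nn_integral_mono)
    fix D
    have "emeasure (measure_pmf (map_pmf (\<lambda>Ds. D # Ds) (replicate_pmf m ?P))) {Ds. clashes Ds B}
      = emeasure (measure_pmf (replicate_pmf m ?P)) {Ds. clash D B \<or> clashes Ds (spread D B)}"
      by (simp add: vimage_def)
    also have "\<dots> \<le> indicator {D. clash D B} D + ennreal (?C * ?S) * of_nat (card (spread D B))"
    proof (cases "clash D B")
      case True
      then show ?thesis
        by (intro order_trans[OF measure_pmf.subprob_emeasure_le_1]) simp
    next
      case False
      have "ennreal (card (spread D B) * (?C * ?S)) = ennreal (?C * ?S) * of_nat (card (spread D B))"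
        using S0 C0 by (simp add: ennreal_mult[symmetric] ennreal_of_nat_eq_real_of_nat mult_ac)
      with Suc.IH[OF finite_spread[OF Suc.prems], of D] False show ?thesis by simp
    qed
    finally show "emeasure (measure_pmf (map_pmf (\<lambda>Ds. D # Ds) (replicate_pmf m ?P))) {Ds. clashes Ds B}
      \<le> indicator {D. clash D B} D + ennreal (?C * ?S) * of_nat (card (spread D B))" .
  qed
  also have "\<dots> = emeasure (measure_pmf ?P) {D. clash D B} + ennreal (?C * ?S) * (\<integral>\<^sup>+ D. of_nat (card (spread D B)) \<partial>measure_pmf ?P)"
    by (simp add: nn_integral_add nn_integral_cmult)
  also have "\<dots> \<le> ennreal (card B * ?C) + ennreal (?C * ?S) * ennreal (card B * (1 + deg * r))"
    using prob_clash[OF Suc.prems assms(2)]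
    by (intro add_mono mult_left_mono expected_card_spread Suc.prems assms)
       (simp_all add: measure_pmf.emeasure_eq_measure ennreal_leI)
  also have "\<dots> = ennreal (card B * ?C + ?C * ?S * (card B * (1 + deg * r)))"
  proof -
    have "0 \<le> card B * ?C" "0 \<le> ?C * ?S" "0 \<le> card B * (1 + deg * r)"
      using S0 C0 assms by (auto simp del: of_nat_mult intro: mult_nonneg_nonneg)
    then show ?thesis by (metis ennreal_mult ennreal_plus mult_nonneg_nonneg)
  qed
  also have "card B * ?C + ?C * ?S * (card B * (1 + deg * r)) = card B * (?C * (1 + (1 + deg * r) * ?S))"
    by (simp add: algebra_simps)
  also have "1 + (1 + deg * r) * ?S = (\<Sum>k<Suc m. (1 + deg * r) ^ k)"
    by (subst sum.lessThan_Suc_shift) (simp add: sum_distrib_left)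
  finally show ?case .
qed

text \<open>With \<open>r * m\<close> fixed the bound is of order \<open>1 / m\<close>.\<close>

theorem prob_clashes:
  fixes r :: real
  assumes "finite B" "0 < r"
  shows "measure_pmf.prob (replicate_pmf m (poisson_field E r)) {Ds. clashes Ds B}
    \<le> card B * (deg * (1 + 2 * real deg) * r\<^sup>2 * m * exp (deg * r * m))"
proof -
  have "(\<Sum>k<m. (1 + deg * r) ^ k) \<le> (\<Sum>k<m. exp (deg * r * m))"
  proof (rule sum_mono)
    fix k assume "k \<in> {..<m}"
    have "(1 + deg * r) ^ k \<le> exp (deg * r) ^ k"
      using assms by (intro power_mono exp_ge_add_one_self) auto
    also have "\<dots> = exp (deg * r * k)" by (simp add: exp_of_nat_mult[symmetric] mult.commute)
    also have "\<dots> \<le> exp (deg * r * m)" using \<open>k \<in> _\<close> assms by (simp add: mult_left_mono)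
    finally show "(1 + deg * r) ^ k \<le> exp (deg * r * m)" .
  qed
  then have S: "(\<Sum>k<m. (1 + deg * r) ^ k) \<le> m * exp (deg * r * m)" by simp
  have "measure_pmf.prob (replicate_pmf m (poisson_field E r)) {Ds. clashes Ds B}
    \<le> card B * (deg * (1 + 2 * real deg) * r\<^sup>2 * (\<Sum>k<m. (1 + deg * r) ^ k))"
    using prob_clashes_aux[OF assms, of m] assms
    by (subst (asm) measure_pmf.emeasure_eq_measure, subst (asm) ennreal_le_iff)
       (auto intro!: mult_nonneg_nonneg sum_nonneg)
  also have "\<dots> \<le> card B * (deg * (1 + 2 * real deg) * r\<^sup>2 * (m * exp (deg * r * m)))"
    by (intro mult_left_mono S) auto
  finally show ?thesis by (simp add: mult_ac)
qed

end

section \<open>Without clashes the linear updates are the averaging dynamics\<close>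

context finite_graph
begin

abbreviation incident :: "'e \<Rightarrow> 'v \<Rightarrow> bool" where
  "incident e x \<equiv> src e = x \<or> tgt e = x"

abbreviation ringing :: "('e \<Rightarrow> nat) \<Rightarrow> 'e \<Rightarrow> bool" where
  "ringing D \<equiv> (\<lambda>e. 0 < D e)"

lemma clash_free_edge:
  assumes "\<not> clash D B" "e \<in> E" "src e \<in> B \<or> tgt e \<in> B" "0 < D e"
  shows "D e = 1" and "\<And>f. f \<in> E \<Longrightarrow> f \<noteq> e \<Longrightarrow> {src e, tgt e} \<inter> {src f, tgt f} \<noteq> {} \<Longrightarrow> D f = 0"
  using assms unfolding clash_def by (force, auto)

text \<open>Among the edges at a vertex of \<open>spread D B\<close> at most one rings: at a vertex outside \<open>B\<close>
  they are all adjacent to the ringing edge through which it was reached from \<open>B\<close>.\<close>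

lemma clash_free_unique:
  assumes "\<not> clash D B" "x \<in> spread D B"
    and "e \<in> E" "incident e x" "0 < D e" and "f \<in> E" "incident f x" "0 < D f"
  shows "f = e"
proof (cases "x \<in> B")
  case True
  then have touch: "src e \<in> B \<or> tgt e \<in> B" using assms(4) by auto
  have "{src e, tgt e} \<inter> {src f, tgt f} \<noteq> {}" using assms(4,7) by auto
  then show ?thesis using clash_free_edge(2)[OF assms(1,3) touch assms(5,6)] assms(8) by auto
next
  case False
  then obtain e0 where e0: "e0 \<in> E" "0 < D e0" "src e0 \<in> B \<or> tgt e0 \<in> B" "incident e0 x"
    using assms(2) unfolding spread_def by auto
  have "g = e0" if "g \<in> E" "incident g x" "0 < D g" for g
  proof (rule ccontr)
    assume "g \<noteq> e0"
    moreover have "{src e0, tgt e0} \<inter> {src g, tgt g} \<noteq> {}" using that e0 by auto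
    ultimately show False using clash_free_edge(2)[OF assms(1) e0(1,3,2) that(1)] that(3) by auto
  qed
  then show ?thesis using assms by metis
qed

lemma update_single:
  assumes "e \<in> E" "incident e x" "R e" "\<And>f. f \<in> E \<Longrightarrow> incident f x \<Longrightarrow> R f \<Longrightarrow> f = e"
  shows "update R g x = (g (src e) + g (tgt e)) / 2"
proof -
  define a where "a f = of_bool (R f) * ((g (tgt f) - g (src f)) / 2 * (of_bool (x = src f) - of_bool (x = tgt f)))" for f
  have "sum a E = sum a {e}"
  proof (rule sum.mono_neutral_right)
    have "\<not> R f \<or> x \<noteq> src f \<and> x \<noteq> tgt f" if "f \<in> E - {e}" for f
      using assms(4)[of f] that by blast
    then show "\<forall>f\<in>E - {e}. a f = 0" unfolding a_def by fastforce
  qed (use assms(1) finite_E in auto)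
  then have eq: "update R g x = g x + a e" unfolding exchange_def a_def by simp
  show ?thesis
  proof (cases "x = src e")
    case True
    then have "x \<noteq> tgt e" using no_loop[OF assms(1)] by simp
    then show ?thesis unfolding eq a_def using True assms(3) by (simp add: field_simps)
  next
    case False
    then have "x = tgt e" using assms(2) by simp
    then show ?thesis unfolding eq a_def using False assms(3) by (simp add: field_simps)
  qed
qed

lemma update_none:
  assumes "\<And>f. f \<in> E \<Longrightarrow> incident f x \<Longrightarrow> \<not> R f"
  shows "update R g x = g x"
proof -
  have "\<not> R f \<or> x \<noteq> src f \<and> x \<noteq> tgt f" if "f \<in> E" for f using assms[of f] that by blast
  then show ?thesis unfolding exchange_def by (subst sum.neutral) fastforce+
qed

lemma update_cases:
  assumes "\<not> clash D B" "x \<in> spread D B"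
  obtains (none) "\<And>e. e \<in> E \<Longrightarrow> incident e x \<Longrightarrow> D e = 0"
      "\<And>g. update (\<lambda>e. 0 < D e) g x = g x"
  | (one) e where "e \<in> E" "incident e x" "0 < D e"
      "\<And>g. update (\<lambda>e. 0 < D e) g x = (g (src e) + g (tgt e)) / 2"
proof (cases "\<exists>e\<in>E. incident e x \<and> 0 < D e")
  case True
  then obtain e where e: "e \<in> E" "incident e x" "0 < D e" by blast
  then have "update (\<lambda>e. 0 < D e) g x = (g (src e) + g (tgt e)) / 2" for g
    by (intro update_single) (use clash_free_unique[OF assms] in blast)+
  with e show ?thesis by (rule that(2))
next
  case False
  then show ?thesis by (intro that(1) update_none) auto
qed

lemma subset_spread: "B \<subseteq> spread D B"
  unfolding spread_def by blast

text \<open>Without clash the set \<open>spread D B\<close> is a union of vertices without ringing edge and of pairs joined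
  by their ringing edge. The update conserves the mass of such a set.\<close>

lemma update_mass:
  assumes "\<not> clash D B" "B \<subseteq> V" "\<And>x. x \<in> spread D B \<Longrightarrow> 0 \<le> g x"
  shows "(\<Sum>x\<in>B. update (\<lambda>e. 0 < D e) g x) \<le> (\<Sum>x\<in>spread D B. g x)"
proof -
  let ?S = "spread D B" and ?X = "update (\<lambda>e. 0 < D e) g"
  have SV: "?S \<subseteq> V" using assms(2) src_V tgt_V unfolding spread_def by auto
  then have fS: "finite ?S" using finite_V finite_subset by blast
  have closed: "src e \<in> ?S \<longleftrightarrow> tgt e \<in> ?S" if "e \<in> E" "0 < D e" for e
  proof -
    have "src e \<in> ?S \<and> tgt e \<in> ?S" if x: "x \<in> ?S" "incident e x" for x
    proof (cases "x \<in> B")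
      case True
      then show ?thesis using \<open>e \<in> E\<close> \<open>0 < D e\<close> x unfolding spread_def by auto
    next
      case False
      then obtain e0 where e0: "e0 \<in> E" "0 < D e0" "src e0 \<in> B \<or> tgt e0 \<in> B" "incident e0 x"
        using x(1) unfolding spread_def by auto
      have "e = e0"
        by (rule clash_free_unique[OF assms(1) x(1) e0(1,4,2) \<open>e \<in> E\<close> x(2) \<open>0 < D e\<close>])
      then show ?thesis using e0(1-3) unfolding spread_def by auto
    qed
    then show ?thesis by blast
  qed
  have nonneg: "0 \<le> ?X x" if "x \<in> ?S" for x
  proof (rule update_cases[OF assms(1) that])
    assume "\<And>g. update (\<lambda>e. 0 < D e) g x = g x"
    with assms(3)[OF that] show ?thesis by simp
  next
    fix e assume e: "e \<in> E" "incident e x" "0 < D e"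
      "\<And>g. update (\<lambda>e. 0 < D e) g x = (g (src e) + g (tgt e)) / 2"
    then have "src e \<in> ?S" "tgt e \<in> ?S" using closed[OF e(1,3)] that by auto
    then show ?thesis unfolding e(4) by (intro divide_nonneg_nonneg add_nonneg_nonneg assms(3)) simp_all
  qed
  have "(\<Sum>x\<in>B. ?X x) \<le> (\<Sum>x\<in>?S. ?X x)"
    by (intro sum_mono2 fS subset_spread nonneg) auto
  also have "\<dots> = pairing (indicator ?S) ?X"
    unfolding pairing_def by (rule sum.mono_neutral_cong_left) (use SV finite_V in \<open>auto simp: indicator_def\<close>)
  also have "\<dots> = pairing (indicator ?S) g"
  proof -
    have "(\<Sum>e\<in>E. of_bool (0 < D e) * ((g (tgt e) - g (src e)) / 2 * (indicator ?S (src e) - indicator ?S (tgt e)))) = 0"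
      by (rule sum.neutral) (use closed in \<open>auto simp: indicator_def of_bool_def\<close>)
    then show ?thesis unfolding pairing_exchange by simp
  qed
  also have "\<dots> = (\<Sum>x\<in>?S. g x)"
    unfolding pairing_def by (rule sum.mono_neutral_cong_right) (use SV finite_V in \<open>auto simp: indicator_def\<close>)
  finally show ?thesis .
qed

text \<open>The sequence \<open>\<zeta>\<close> is only assumed to be averaged along an edge that is the sole one to ring
  nearby, and to stay put at a vertex whose edges are silent. The regions \<open>A k\<close> shrink with \<open>k\<close>, so that
  everything that can influence \<open>A (Suc k)\<close> in one step lies in \<open>A k\<close>. Nonnegativity and the mass bound have
  to be part of the induction, since \<open>\<zeta>\<close> is not assumed to be a subprobability.\<close>

theorem run_follows_dynamics:
  fixes D :: "nat \<Rightarrow> 'e \<Rightarrow> nat" and \<zeta> :: "nat \<Rightarrow> 'v \<Rightarrow> real"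
  assumes region: "\<And>k. k \<le> m \<Longrightarrow> A k \<subseteq> V"
      "\<And>k e x. k < m \<Longrightarrow> e \<in> E \<Longrightarrow> x \<in> A (Suc k) \<Longrightarrow> incident e x \<Longrightarrow> src e \<in> A k \<and> tgt e \<in> A k"
      "\<And>k. k < m \<Longrightarrow> A (Suc k) \<subseteq> A k"
    and stay: "\<And>k x. k < m \<Longrightarrow> x \<in> A (Suc k) \<Longrightarrow> (\<And>e. e \<in> E \<Longrightarrow> incident e x \<Longrightarrow> D k e = 0)
      \<Longrightarrow> \<zeta> (Suc k) x = \<zeta> k x"
    and average: "\<And>k x e. k < m \<Longrightarrow> x \<in> A (Suc k) \<Longrightarrow> e \<in> E \<Longrightarrow> incident e x \<Longrightarrow> D k e = 1
      \<Longrightarrow> (\<And>f. f \<in> E \<Longrightarrow> f \<noteq> e \<Longrightarrow> {src e, tgt e} \<inter> {src f, tgt f} \<noteq> {} \<Longrightarrow> D k f = 0)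
      \<Longrightarrow> \<zeta> (Suc k) x = (\<zeta> k (src e) + \<zeta> k (tgt e)) / 2"
    and init: "\<And>x. x \<in> A 0 \<Longrightarrow> \<zeta> 0 x = f x" "\<And>x. 0 \<le> f x" "\<And>B. finite B \<Longrightarrow> (\<Sum>x\<in>B. f x) \<le> 1"
    and "k \<le> m" "B \<subseteq> A k" "\<not> clashes (map D (rev [0..<k])) B"
  shows "(\<forall>x\<in>B. \<zeta> k x = run (map (\<lambda>k e. 0 < D k e) (rev [0..<k])) f x \<and> 0 \<le> \<zeta> k x)
    \<and> (\<Sum>x\<in>B. \<zeta> k x) \<le> 1"
  using assms(9-)
proof (induction k arbitrary: B)
  case 0
  then have eq: "\<zeta> 0 x = f x" if "x \<in> B" for x using init(1) that by auto
  have "B \<subseteq> V" using 0(2) region(1)[of 0] by simp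
  then have "finite B" using finite_V by (rule finite_subset)
  then have "(\<Sum>x\<in>B. \<zeta> 0 x) \<le> 1" using init(3) eq by simp
  with eq init(2) show ?case by simp
next
  case (Suc k)
  let ?S = "spread (D k) B" and ?R = "\<lambda>e. 0 < D k e"
  let ?h = "run (map (\<lambda>k e. 0 < D k e) (rev [0..<k])) f"
  have k: "k < m" using Suc.prems by simp
  have nc: "\<not> clash (D k) B" and ncs: "\<not> clashes (map D (rev [0..<k])) ?S"
    using Suc.prems(3) by auto
  have BA: "B \<subseteq> A (Suc k)" by fact
  have SA: "?S \<subseteq> A k"
    using region(2)[OF k] region(3)[OF k] BA unfolding spread_def by blast
  have IH: "\<And>x. x \<in> ?S \<Longrightarrow> \<zeta> k x = ?h x" "\<And>x. x \<in> ?S \<Longrightarrow> 0 \<le> \<zeta> k x" "(\<Sum>x\<in>?S. \<zeta> k x) \<le> 1"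
    using Suc.IH[OF _ SA ncs] k by auto
  have step: "\<zeta> (Suc k) x = update ?R (\<zeta> k) x
      \<and> update ?R (\<zeta> k) x = update ?R ?h x
      \<and> 0 \<le> \<zeta> (Suc k) x" if x: "x \<in> B" for x
  proof -
    have xS: "x \<in> ?S" using x subset_spread by blast
    have xA: "x \<in> A (Suc k)" using x BA by blast
    show ?thesis
    proof (rule update_cases[OF nc xS])
      assume none: "\<And>e. e \<in> E \<Longrightarrow> incident e x \<Longrightarrow> D k e = 0"
        "\<And>g. update (\<lambda>e. 0 < D k e) g x = g x"
      show ?thesis using stay[OF k xA none(1)] none(2) IH(1,2)[OF xS] by simp
    next
      fix e assume e: "e \<in> E" "incident e x" "0 < D k e"
        "\<And>g. update (\<lambda>e. 0 < D k e) g x = (g (src e) + g (tgt e)) / 2"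
      have touch: "src e \<in> B \<or> tgt e \<in> B" using e(2) x by auto
      have ends: "src e \<in> ?S" "tgt e \<in> ?S" using e x unfolding spread_def by auto
      have "\<zeta> (Suc k) x = (\<zeta> k (src e) + \<zeta> k (tgt e)) / 2"
        by (rule average[OF k xA e(1,2) clash_free_edge(1)[OF nc e(1) touch e(3)]])
           (rule clash_free_edge(2)[OF nc e(1) touch e(3)])
      then show ?thesis unfolding e(4) using IH(1,2)[OF ends(1)] IH(1,2)[OF ends(2)] by simp
    qed
  qed
  have "(\<Sum>x\<in>B. \<zeta> (Suc k) x) = (\<Sum>x\<in>B. update ?R (\<zeta> k) x)"
    using step by (intro sum.cong) auto
  also have "\<dots> \<le> (\<Sum>x\<in>?S. \<zeta> k x)"
    using BA region(1)[OF Suc.prems(1)] by (intro update_mass nc IH(2)) auto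
  also note IH(3)
  finally have "(\<Sum>x\<in>B. \<zeta> (Suc k) x) \<le> 1" .
  moreover have "\<zeta> (Suc k) x = run (map (\<lambda>k e. 0 < D k e) (rev [0..<Suc k])) f x \<and> 0 \<le> \<zeta> (Suc k) x"
    if "x \<in> B" for x
  proof -
    have "run (map (\<lambda>k e. 0 < D k e) (rev [0..<Suc k])) f x = update ?R ?h x"
      by simp
    with step[OF that] show ?thesis by metis
  qed
  ultimately show ?case by blast
qed

end

section \<open>Rings of a counting path\<close>

lemma not_rings_at_constant:
  assumes "mono_on {0..} c" "0 \<le> a" "c a = c b" "u \<in> {a<..b}"
  shows "\<not> rings_at c u"
proof
  assume "rings_at c u"
  then have "c a < c u" using assms(2,4) unfolding rings_at_def by simp
  moreover have "c u \<le> c b" using assms by (intro mono_onD[OF assms(1)]) auto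
  ultimately show False using assms by simp
qed

text \<open>The ring is at the first time at which \<open>c\<close> has its final value; right-continuity
  makes this value attained there.\<close>

lemma rings_at_unit_increment:
  assumes mono: "mono_on {0..} c" and cont: "\<And>t. 0 \<le> t \<Longrightarrow> continuous (at_right t) c"
    and ab: "0 \<le> a" "a < b" and inc: "c b = c a + 1"
  obtains u where "u \<in> {a<..b}" "rings_at c u" "\<And>v. v \<in> {a<..b} \<Longrightarrow> rings_at c v \<Longrightarrow> v = u"
proof -
  have le: "c s \<le> c t" if "0 \<le> s" "s \<le> t" for s t
    using that by (intro mono_onD[OF mono]) auto
  define S where "S = {s\<in>{a..b}. c s = c b}"
  define u where "u = Inf S"
  have bS: "b \<in> S" using ab by (simp add: S_def)
  have bdd: "bdd_below S" unfolding S_def by (rule bdd_belowI[of _ a]) auto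
  have au: "a \<le> u" unfolding u_def using bS by (intro cInf_greatest) (auto simp: S_def)
  have ub: "u \<le> b" unfolding u_def by (rule cInf_lower[OF bS bdd])
  have cu: "c u = c b"
  proof (rule ccontr)
    assume ne: "c u \<noteq> c b"
    have "(c \<longlongrightarrow> c u) (at_right u)"
      using cont[of u] au ab by (simp add: continuous_within)
    then have "eventually (\<lambda>s. c s = c u) (at_right u)" by (simp add: tendsto_discrete)
    then obtain v where v: "v > u" "\<And>s. u < s \<Longrightarrow> s < v \<Longrightarrow> c s = c u"
      unfolding eventually_at_right_field by blast
    have "v \<le> s" if "s \<in> S" for s
    proof (rule ccontr)
      assume "\<not> v \<le> s"
      moreover have "u \<le> s" unfolding u_def by (rule cInf_lower[OF that bdd])
      moreover have "s \<noteq> u" "c s = c b" using that ne by (auto simp: S_def)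
      ultimately show False using v(2)[of s] ne by auto
    qed
    then have "v \<le> u" unfolding u_def using bS by (intro cInf_greatest) auto
    with v(1) show False by simp
  qed
  have "u \<noteq> a" using cu inc by auto
  with au have au': "a < u" by simp
  have below: "c s = c a" if "a \<le> s" "s < u" for s
  proof -
    have "s \<notin> S"
    proof
      assume "s \<in> S"
      then have "u \<le> s" unfolding u_def by (rule cInf_lower[OF _ bdd])
      with that show False by simp
    qed
    then have "c s \<noteq> c b" using that ub by (simp add: S_def)
    moreover have "c a \<le> c s" "c s \<le> c b" using that ab ub by (auto intro!: le)
    ultimately show ?thesis using inc by simp
  qed
  have "c s < c u" if "s \<in> {0..<u}" for s
  proof (cases "a \<le> s")
    case True
    then show ?thesis using below[of s] that cu inc by simp
  next
    case False
    then have "c s \<le> c a" using that by (intro le) auto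
    then show ?thesis using cu inc by simp
  qed
  then have rings: "rings_at c u" using au' ab unfolding rings_at_def by auto
  have unique: "v = u" if v: "v \<in> {a<..b}" "rings_at c v" for v
  proof (rule ccontr)
    assume "v \<noteq> u"
    then consider "v < u" | "u < v" by linarith
    then show False
    proof cases
      case 1
      have "c a < c v" using v ab unfolding rings_at_def by simp
      then show False using below[of v] 1 v by auto
    next
      case 2
      have "c u < c v" using v 2 au' ab unfolding rings_at_def by simp
      moreover have "c v \<le> c b" using v ab by (intro le) auto
      ultimately show False using cu by simp
    qed
  qed
  show ?thesis by (rule that[OF _ rings unique]) (use au' ub in simp_all)
qed

text \<open>The almost sure properties of one realization of clocks and process.\<close>

locale averaging_path =
  fixes c :: "(int ^ 'd::finite) set \<Rightarrow> real \<Rightarrow> nat" and \<eta> :: "real \<Rightarrow> int ^ 'd \<Rightarrow> real"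
  assumes mono: "e \<in> lattice_edges \<Longrightarrow> mono_on {0..} (c e)"
    and right_cont: "e \<in> lattice_edges \<Longrightarrow> 0 \<le> t \<Longrightarrow> continuous (at_right t) (c e)"
    and average: "{x, y} \<in> lattice_edges \<Longrightarrow> rings_at (c {x, y}) t \<Longrightarrow>
      \<eta> t x = (Lim (at_left t) (\<lambda>s. \<eta> s x) + Lim (at_left t) (\<lambda>s. \<eta> s y)) / 2"
    and constancy: "0 \<le> s \<Longrightarrow> s < t \<Longrightarrow> (\<And>e u. e \<in> lattice_edges \<Longrightarrow> x \<in> e \<Longrightarrow> u \<in> {s<..t} \<Longrightarrow>
      \<not> rings_at (c e) u) \<Longrightarrow> \<eta> t x = \<eta> s x"
begin

lemma stay:
  assumes "0 \<le> a" "a < b" "\<And>e. e \<in> lattice_edges \<Longrightarrow> x \<in> e \<Longrightarrow> c e b = c e a"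
  shows "\<eta> b x = \<eta> a x"
proof (rule constancy[OF assms(1,2)])
  fix e u assume e: "e \<in> lattice_edges" "x \<in> e" "u \<in> {a<..b}"
  show "\<not> rings_at (c e) u"
    by (rule not_rings_at_constant[OF mono[OF e(1)] assms(1) assms(3)[OF e(1,2), symmetric] e(3)])
qed

lemma average_once:
  assumes ab: "0 \<le> a" "a < b" and e: "{x, y} \<in> lattice_edges" and inc: "c {x, y} b = c {x, y} a + 1"
    and others: "\<And>e. e \<in> lattice_edges \<Longrightarrow> e \<noteq> {x, y} \<Longrightarrow> e \<inter> {x, y} \<noteq> {} \<Longrightarrow> c e b = c e a"
  shows "\<eta> b x = (\<eta> a x + \<eta> a y) / 2"
proof -
  obtain u where u: "u \<in> {a<..b}" "rings_at (c {x, y}) u"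
    "\<And>v. v \<in> {a<..b} \<Longrightarrow> rings_at (c {x, y}) v \<Longrightarrow> v = u"
    using rings_at_unit_increment[OF mono[OF e] right_cont[OF e] ab inc] by blast
  have quiet: "\<not> rings_at (c e) v"
    if "e \<in> lattice_edges" "z \<in> e" "z \<in> {x, y}" "v \<in> {a<..b}" "v \<noteq> u" for e z v
  proof (cases "e = {x, y}")
    case True
    then show ?thesis using u(3)[of v] that by auto
  next
    case False
    then have eq: "c e b = c e a" using that by (intro others) auto
    show ?thesis
      by (rule not_rings_at_constant[OF mono[OF that(1)] ab(1) eq[symmetric] that(4)])
  qed
  have before: "\<eta> s z = \<eta> a z" if "z \<in> {x, y}" "s \<in> {a<..<u}" for s z
    by (rule constancy) (use that ab u(1) quiet in auto)
  have lim: "Lim (at_left u) (\<lambda>s. \<eta> s z) = \<eta> a z" if "z \<in> {x, y}" for z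
  proof (rule tendsto_Lim)
    have "eventually (\<lambda>s. s \<in> {a<..<u}) (at_left u)"
      by (rule eventually_at_leftI[of a]) (use u(1) in auto)
    then have "eventually (\<lambda>s. \<eta> s z = \<eta> a z) (at_left u)"
      by eventually_elim (use before that in auto)
    then show "((\<lambda>s. \<eta> s z) \<longlongrightarrow> \<eta> a z) (at_left u)" by (rule tendsto_eventually)
  qed simp
  have at_u: "\<eta> u x = (\<eta> a x + \<eta> a y) / 2"
    using average[OF e u(2)] lim[of x] lim[of y] by simp
  have "\<eta> b x = \<eta> u x"
  proof (cases "u = b")
    case False
    then show ?thesis using u(1) ab quiet by (intro constancy) auto
  qed simp
  with at_u show ?thesis by simp
qed

end

section \<open>The lattice and its heat operator\<close>

text \<open>A pair \<open>(x, j)\<close> stands for the edge from \<open>x\<close> in direction \<open>j\<close>; this names every lattice edge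
  once.\<close>

definition edge_end :: "(int ^ 'd::finite) \<times> 'd \<Rightarrow> int ^ 'd" where
  "edge_end p = fst p + axis (snd p) 1"

definition lattice_edge :: "(int ^ 'd::finite) \<times> 'd \<Rightarrow> (int ^ 'd) set" where
  "lattice_edge p = {fst p, edge_end p}"

lemma edge_end_neq: "fst p \<noteq> edge_end p"
  by (auto simp: edge_end_def axis_def vec_eq_iff)

lemma axis_sum_nonzero: "axis i (1::int) + axis j 1 \<noteq> 0"
proof
  assume "axis i (1::int) + axis j 1 = 0"
  then have "(axis i (1::int) + axis j 1) $ i = 0" by simp
  then show False by (auto simp: axis_def split: if_splits)
qed

lemma inj_lattice_edge: "inj lattice_edge"
proof (rule injI)
  fix p q :: "(int ^ 'd) \<times> 'd"
  assume "lattice_edge p = lattice_edge q"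
  then consider "fst p = fst q" "edge_end p = edge_end q" | "fst p = edge_end q" "edge_end p = fst q"
    unfolding lattice_edge_def doubleton_eq_iff by blast
  then show "p = q"
  proof cases
    case 1
    then have "axis (snd p) (1::int) = axis (snd q) 1" by (simp add: edge_end_def)
    then have "snd p = snd q" by (simp add: axis_eq_axis)
    with 1 show ?thesis by (simp add: prod_eq_iff)
  next
    case 2
    then have "axis (snd q) (1::int) + axis (snd p) 1 = 0" by (simp add: edge_end_def algebra_simps)
    then show ?thesis using axis_sum_nonzero by blast
  qed
qed

lemma lattice_edges_eq: "lattice_edges = range (lattice_edge :: (int ^ 'd::finite) \<times> 'd \<Rightarrow> _)"
proof (intro equalityI subsetI)
  fix e :: "(int ^ 'd) set" assume "e \<in> lattice_edges"
  then obtain x y where e: "e = {x, y}" and one: "(\<Sum>j\<in>UNIV. \<bar>x $ j - y $ j\<bar>) = 1"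
    unfolding lattice_edges_def by blast
  have "\<exists>j. \<bar>x $ j - y $ j\<bar> \<noteq> 0"
  proof (rule ccontr)
    assume "\<nexists>j. \<bar>x $ j - y $ j\<bar> \<noteq> 0"
    then have "(\<Sum>j\<in>UNIV. \<bar>x $ j - y $ j\<bar>) = 0" by (intro sum.neutral) blast
    with one show False by simp
  qed
  then obtain j where j: "\<bar>x $ j - y $ j\<bar> \<noteq> 0" by blast
  have split: "\<bar>x $ j - y $ j\<bar> + (\<Sum>i\<in>UNIV - {j}. \<bar>x $ i - y $ i\<bar>) = 1"
    using one by (subst (asm) sum.remove[of _ j]) auto
  have "0 \<le> (\<Sum>i\<in>UNIV - {j}. \<bar>x $ i - y $ i\<bar>)" by (rule sum_nonneg) simp
  with split j have j1: "\<bar>x $ j - y $ j\<bar> = 1" and "(\<Sum>i\<in>UNIV - {j}. \<bar>x $ i - y $ i\<bar>) = 0"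
    by linarith+
  then have rest: "x $ i = y $ i" if "i \<noteq> j" for i
    using that by (subst (asm) sum_nonneg_eq_0_iff) auto
  from j1 consider "y $ j = x $ j + 1" | "x $ j = y $ j + 1" by linarith
  then show "e \<in> range lattice_edge"
  proof cases
    case 1
    then have "y = x + axis j 1" using rest by (auto simp: vec_eq_iff axis_def)
    then have "e = lattice_edge (x, j)" by (simp add: e lattice_edge_def edge_end_def)
    then show ?thesis by blast
  next
    case 2
    then have "x = y + axis j 1" using rest by (auto simp: vec_eq_iff axis_def)
    then have "e = lattice_edge (y, j)" by (simp add: e lattice_edge_def edge_end_def insert_commute)
    then show ?thesis by blast
  qed
next
  fix e :: "(int ^ 'd) set" assume "e \<in> range lattice_edge"
  then obtain x j where e: "e = {x, x + axis j 1}" by (auto simp: lattice_edge_def edge_end_def)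
  have "(\<Sum>i\<in>UNIV. \<bar>x $ i - (x + axis j 1) $ i\<bar>) = (\<Sum>i\<in>UNIV. if i = j then 1 else 0)"
    by (intro sum.cong) (auto simp: axis_def)
  also have "\<dots> = 1" by simp
  finally show "e \<in> lattice_edges" unfolding lattice_edges_def e by blast
qed

definition nbhd :: "(int ^ 'd::finite) set \<Rightarrow> (int ^ 'd) set" where
  "nbhd A = A \<union> (\<Union>j. (\<lambda>x. x + axis j 1) ` A) \<union> (\<Union>j. (\<lambda>x. x - axis j 1) ` A)"

lemma finite_nbhd: "finite A \<Longrightarrow> finite (nbhd A)"
  unfolding nbhd_def by auto

lemma finite_nbhd_funpow: "finite A \<Longrightarrow> finite ((nbhd ^^ n) A)"
  by (induction n) (auto intro: finite_nbhd)

lemma subset_nbhd: "A \<subseteq> nbhd A"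
  unfolding nbhd_def by auto

lemma nbhd_mono: "A \<subseteq> B \<Longrightarrow> nbhd A \<subseteq> nbhd B"
  unfolding nbhd_def by blast

lemma nbhd_funpow_mono: "m \<le> n \<Longrightarrow> (nbhd ^^ m) A \<subseteq> (nbhd ^^ n) A"
proof (induction n)
  case (Suc n)
  then show ?case using subset_nbhd by (cases "m = Suc n") fastforce+
qed simp

lemma edge_end_nbhd: "fst p \<in> A \<Longrightarrow> edge_end p \<in> nbhd A"
  unfolding nbhd_def edge_end_def by blast

lemma edge_start_nbhd: "edge_end p \<in> A \<Longrightarrow> fst p \<in> nbhd A"
proof -
  assume "edge_end p \<in> A"
  moreover have "fst p = edge_end p - axis (snd p) 1" by (simp add: edge_end_def)
  ultimately show ?thesis unfolding nbhd_def by blast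
qed

text \<open>The one-step expectation of a test function when each edge averages with probability \<open>p\<close>: with
  probability \<open>p / 2\<close> each the walk moves to one of the \<open>2 * d\<close> neighbours.\<close>

definition heat_step :: "real \<Rightarrow> (int ^ 'd::finite \<Rightarrow> real) \<Rightarrow> int ^ 'd \<Rightarrow> real" where
  "heat_step p g x = g x + p / 2 * (\<Sum>j\<in>UNIV. (g (x + axis j 1) - g x) + (g (x - axis j 1) - g x))"

lemma heat_step_eq_0:
  assumes "\<And>x. x \<notin> S \<Longrightarrow> g x = 0" "x \<notin> nbhd S"
  shows "heat_step p g x = 0"
proof -
  have "x \<notin> S" using assms(2) subset_nbhd by blast
  moreover have "x + axis j 1 \<notin> S" for j
  proof
    assume "x + axis j 1 \<in> S"
    then have "(x + axis j 1) - axis j 1 \<in> nbhd S" unfolding nbhd_def by blast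
    with assms(2) show False by simp
  qed
  moreover have "x - axis j 1 \<notin> S" for j
  proof
    assume "x - axis j 1 \<in> S"
    then have "(x - axis j 1) + axis j 1 \<in> nbhd S" unfolding nbhd_def by blast
    with assms(2) show False by simp
  qed
  ultimately show ?thesis unfolding heat_step_def by (simp add: assms(1))
qed

lemma heat_step_funpow_eq_0:
  assumes "\<And>x. x \<notin> S \<Longrightarrow> g x = 0" "x \<notin> (nbhd ^^ k) S"
  shows "(heat_step p ^^ k) g x = 0"
  using assms(2)
proof (induction k arbitrary: x)
  case (Suc k)
  show ?case using Suc by (simp add: heat_step_eq_0[where S="(nbhd ^^ k) S"])
qed (use assms(1) in simp)

text \<open>For \<open>p * d \<le> 1\<close> the operator takes weighted means of values of \<open>h\<close>.\<close>

lemma heat_step_bounded: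
  fixes h :: "int ^ 'd::finite \<Rightarrow> real" and p :: real
  assumes "0 \<le> p" "p * CARD('d) \<le> 1" and h: "\<And>x. \<bar>h x\<bar> \<le> C"
  shows "\<bar>heat_step p h x\<bar> \<le> C"
proof -
  have "heat_step p h x = (1 - p * CARD('d)) * h x + p / 2 * (\<Sum>j\<in>UNIV. h (x + axis j 1) + h (x - axis j 1))"
    by (simp add: heat_step_def sum.distrib sum_subtractf algebra_simps)
  also have "\<bar>\<dots>\<bar> \<le> (1 - p * CARD('d)) * C + p / 2 * (\<Sum>j\<in>(UNIV::'d set). C + C)"
  proof (rule order_trans[OF abs_triangle_ineq add_mono])
    show "\<bar>(1 - p * CARD('d)) * h x\<bar> \<le> (1 - p * CARD('d)) * C"
      unfolding abs_mult using assms by (intro mult_mono) auto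
    have "\<bar>\<Sum>j\<in>UNIV. h (x + axis j 1) + h (x - axis j 1)\<bar> \<le> (\<Sum>j\<in>(UNIV::'d set). C + C)"
      by (rule order_trans[OF sum_abs sum_mono], rule order_trans[OF abs_triangle_ineq add_mono]) (rule h)+
    then show "\<bar>p / 2 * (\<Sum>j\<in>UNIV. h (x + axis j 1) + h (x - axis j 1))\<bar> \<le> p / 2 * (\<Sum>j\<in>(UNIV::'d set). C + C)"
      unfolding abs_mult using assms by (intro mult_mono) auto
  qed
  also have "\<dots> = C" by (simp add: algebra_simps)
  finally show ?thesis .
qed

lemma heat_step_diff: "heat_step p (\<lambda>x. f x - g x) x = heat_step p f x - heat_step p g x"
proof -
  have eq: "(\<Sum>j\<in>UNIV. (f (x + axis j 1) - g (x + axis j 1) - (f x - g x)) + (f (x - axis j 1) - g (x - axis j 1) - (f x - g x)))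
    = (\<Sum>j\<in>UNIV. (f (x + axis j 1) - f x) + (f (x - axis j 1) - f x))
      - (\<Sum>j\<in>UNIV. (g (x + axis j 1) - g x) + (g (x - axis j 1) - g x))"
    unfolding sum_subtractf[symmetric] by (intro sum.cong) auto
  show ?thesis unfolding heat_step_def eq by (simp only: right_diff_distrib add_diff_add)
qed

lemma heat_step_shift:
  fixes x v :: "int ^ 'd::finite"
  shows "heat_step p g (x + v) = heat_step p (\<lambda>y. g (y + v)) x"
proof -
  have comm: "x + v + axis j 1 = x + axis j 1 + v" "x + v - axis j 1 = x - axis j 1 + v" for j :: 'd
    by (simp_all add: algebra_simps)
  show ?thesis unfolding heat_step_def comm ..
qed

text \<open>The operator commutes with translations, so it acts on the differences of \<open>g\<close>. Translation
  invariance is the reason for working on the whole lattice here: on a finite graph the gradient bound could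
  get worse near the boundary.\<close>

lemma heat_step_Lipschitz:
  fixes p :: real and g :: "int ^ 'd::finite \<Rightarrow> real"
  assumes "0 \<le> p" "p * CARD('d) \<le> 1" "\<And>x i. \<bar>g (x + axis i 1) - g x\<bar> \<le> L"
  shows "\<bar>heat_step p g (x + axis i 1) - heat_step p g x\<bar> \<le> L"
  unfolding heat_step_shift heat_step_diff[symmetric]
  by (rule heat_step_bounded[OF assms(1,2)]) (rule assms(3))

lemma heat_step_funpow_Lipschitz:
  fixes p :: real and g :: "int ^ 'd::finite \<Rightarrow> real"
  assumes "0 \<le> p" "p * CARD('d) \<le> 1" "\<And>x i. \<bar>g (x + axis i 1) - g x\<bar> \<le> L"
  shows "\<bar>(heat_step p ^^ k) g (x + axis i 1) - (heat_step p ^^ k) g x\<bar> \<le> L"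
  using assms(3)
proof (induction k arbitrary: x i)
  case (Suc k)
  show ?case
    unfolding funpow.simps comp_apply by (rule heat_step_Lipschitz[OF assms(1,2)]) (rule Suc.IH[OF Suc.prems])
qed simp

abbreviation edges_from :: "(int ^ 'd::finite) set \<Rightarrow> ((int ^ 'd) \<times> 'd) set" where
  "edges_from W \<equiv> W \<times> UNIV"

lemma lattice_finite_graph:
  fixes W :: "(int ^ 'd::finite) set"
  assumes "finite W"
  shows "finite_graph (nbhd W) (edges_from W) fst edge_end (2 * CARD('d))"
proof
  show "finite (nbhd W)" "finite (edges_from W)" using assms by (auto intro: finite_nbhd)
  show "fst e \<in> nbhd W" if "e \<in> edges_from W" for e :: "(int ^ 'd) \<times> 'd"
    using that by (intro subsetD[OF subset_nbhd]) auto
  show "edge_end e \<in> nbhd W" if "e \<in> edges_from W" for e :: "(int ^ 'd) \<times> 'd"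
    using that by (intro edge_end_nbhd) auto
  show "fst e \<noteq> edge_end e" for e :: "(int ^ 'd) \<times> 'd" by (rule edge_end_neq)
  show "card {e\<in>edges_from W. fst e = x \<or> edge_end e = x} \<le> 2 * CARD('d)" for x :: "int ^ 'd"
  proof -
    have "{e\<in>edges_from W. fst e = x \<or> edge_end e = x}
      \<subseteq> (\<lambda>j. (x, j)) ` UNIV \<union> (\<lambda>j. (x - axis j 1, j)) ` UNIV"
      by (auto simp: edge_end_def)
    then have "card {e\<in>edges_from W. fst e = x \<or> edge_end e = x}
      \<le> card ((\<lambda>j. (x, j)) ` (UNIV::'d set) \<union> (\<lambda>j. (x - axis j 1, j)) ` UNIV)"
      by (rule card_mono[rotated]) simp
    also have "\<dots> \<le> card ((\<lambda>j. (x, j)) ` (UNIV::'d set)) + card ((\<lambda>j. (x - axis j 1, j)) ` (UNIV::'d set))"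
      by (rule card_Un_le)
    also have "\<dots> \<le> CARD('d) + CARD('d)" by (intro add_mono card_image_le) auto
    finally show ?thesis by simp
  qed
qed

text \<open>An edge outside \<open>edges_from W\<close> has both ends outside the support of \<open>g\<close>, so it does not
  contribute on the lattice either.\<close>

lemma heat_step_eq_exchange:
  fixes g :: "int ^ 'd::finite \<Rightarrow> real"
  assumes W: "finite W" "nbhd S \<subseteq> W" and g: "\<And>x. x \<notin> S \<Longrightarrow> g x = 0"
  shows "heat_step p g x = finite_graph.exchange (edges_from W) fst edge_end (\<lambda>_. p) g x"
proof -
  interpret G: finite_graph "nbhd W" "edges_from W" fst edge_end "2 * CARD('d)"
    by (rule lattice_finite_graph[OF W(1)])
  define u where "u z j = g (z + axis j 1) - g z" for z j
  have u0: "u z j = 0" if "z \<notin> W" for z j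
  proof -
    have "z \<notin> S" using that W(2) subset_nbhd by blast
    moreover have "z + axis j 1 \<notin> S"
    proof
      assume "z + axis j 1 \<in> S"
      then have "(z + axis j 1) - axis j 1 \<in> nbhd S" unfolding nbhd_def by blast
      with that W(2) show False by auto
    qed
    ultimately show ?thesis by (simp add: u_def g)
  qed
  have fin: "finite (UNIV :: 'd set)" by simp
  have s1: "(\<Sum>z\<in>W. \<Sum>j\<in>UNIV. u z j * of_bool (x = z)) = (\<Sum>j\<in>UNIV. u x j)"
  proof -
    have "(\<Sum>z\<in>W. \<Sum>j\<in>UNIV. u z j * of_bool (x = z)) = (\<Sum>z\<in>W. if x = z then (\<Sum>j\<in>UNIV. u z j) else 0)"
      by (intro sum.cong) auto
    also have "\<dots> = (if x \<in> W then (\<Sum>j\<in>UNIV. u x j) else 0)" using W(1) by simp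
    finally show ?thesis using u0[of x] by simp
  qed
  have s2: "(\<Sum>z\<in>W. \<Sum>j\<in>UNIV. u z j * of_bool (x = z + axis j 1)) = (\<Sum>j\<in>UNIV. u (x - axis j 1) j)"
  proof -
    have "(\<Sum>z\<in>W. \<Sum>j\<in>UNIV. u z j * of_bool (x = z + axis j 1))
      = (\<Sum>j\<in>UNIV. \<Sum>z\<in>W. u z j * of_bool (x = z + axis j 1))" by (rule sum.swap)
    also have "\<dots> = (\<Sum>j\<in>UNIV. \<Sum>z\<in>W. if x - axis j 1 = z then u z j else 0)"
      by (intro sum.cong refl) (auto simp: algebra_simps)
    also have "\<dots> = (\<Sum>j\<in>UNIV. if x - axis j 1 \<in> W then u (x - axis j 1) j else 0)"
      using W(1) by simp
    also have "\<dots> = (\<Sum>j\<in>UNIV. u (x - axis j 1) j)" using u0 by (intro sum.cong) auto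
    finally show ?thesis .
  qed
  have "(\<Sum>e\<in>edges_from W. p * ((g (edge_end e) - g (fst e)) / 2 * (of_bool (x = fst e) - of_bool (x = edge_end e))))
    = (\<Sum>z\<in>W. \<Sum>j\<in>UNIV. p / 2 * (u z j * of_bool (x = z)) - p / 2 * (u z j * of_bool (x = z + axis j 1)))"
    unfolding u_def edge_end_def
    by (subst sum.cartesian_product) (auto intro!: sum.cong simp: algebra_simps diff_divide_distrib)
  also have "\<dots> = p / 2 * (\<Sum>j\<in>UNIV. u x j) - p / 2 * (\<Sum>j\<in>UNIV. u (x - axis j 1) j)"
    unfolding sum_subtractf sum_distrib_left[symmetric] s1 s2 ..
  finally have eq: "(\<Sum>e\<in>edges_from W. p * ((g (edge_end e) - g (fst e)) / 2 * (of_bool (x = fst e) - of_bool (x = edge_end e))))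
    = p / 2 * (\<Sum>j\<in>UNIV. u x j) - p / 2 * (\<Sum>j\<in>UNIV. u (x - axis j 1) j)" .
  show ?thesis
    unfolding heat_step_def G.exchange_def eq u_def
    by (simp add: sum.distrib sum_subtractf algebra_simps)
qed

section \<open>The law of the ring counts\<close>

lemma measurable_nat_diff:
  fixes f g :: "'a \<Rightarrow> nat"
  assumes [measurable]: "f \<in> measurable M (count_space UNIV)" "g \<in> measurable M (count_space UNIV)"
  shows "(\<lambda>x. f x - g x) \<in> measurable M (count_space UNIV)"
  by measurable

lemma (in poisson_process) prob_increment_eq:
  assumes "0 \<le> s" "s < t"
  shows "prob {\<omega>\<in>space M. N t \<omega> - N s \<omega> = v} = pmf (poisson_pmf (rate * (t - s))) v"
proof -
  have [measurable]: "N t \<in> measurable M (count_space UNIV)" "N s \<in> measurable M (count_space UNIV)"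
    using assms by (auto intro!: random_variable_count)
  have "pmf (poisson_pmf (rate * (t - s))) v = measure (measure_pmf (poisson_pmf (rate * (t - s)))) {v}"
    by (simp add: measure_pmf_single)
  also have "\<dots> = measure (distr M (count_space UNIV) (\<lambda>\<omega>. N t \<omega> - N s \<omega>)) {v}"
    using increments_poisson[OF assms] by simp
  also have "\<dots> = prob {\<omega>\<in>space M. N t \<omega> - N s \<omega> = v}"
    by (subst measure_distr) (auto intro!: arg_cong[where f=prob])
  finally show ?thesis by simp
qed

lemma (in poisson_process) prob_increments_eq:
  assumes "0 < h"
  shows "prob {\<omega>\<in>space M. \<forall>k<m. N (real (Suc k) * h) \<omega> - N (real k * h) \<omega> = v k}
    = (\<Prod>k<m. pmf (poisson_pmf (rate * h)) (v k))"
proof (cases "m = 0")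
  case True
  then show ?thesis by (simp add: prob_space)
next
  case False
  let ?\<tau> = "\<lambda>k. real k * h"
  have "indep_vars (\<lambda>_. count_space UNIV) (\<lambda>k \<omega>. N (?\<tau> (Suc k)) \<omega> - N (?\<tau> k) \<omega>) {..<m}"
    by (rule increments_indep) (use assms in \<open>auto simp: strict_mono_def\<close>)
  from indep_varsD[OF this, of "{..<m}" "\<lambda>k. {v k}"] False
  have "prob (\<Inter>k<m. (\<lambda>\<omega>. N (?\<tau> (Suc k)) \<omega> - N (?\<tau> k) \<omega>) -` {v k} \<inter> space M)
    = (\<Prod>k<m. prob ((\<lambda>\<omega>. N (?\<tau> (Suc k)) \<omega> - N (?\<tau> k) \<omega>) -` {v k} \<inter> space M))"
    by (auto simp: lessThan_empty_iff)
  also have "(\<Inter>k<m. (\<lambda>\<omega>. N (?\<tau> (Suc k)) \<omega> - N (?\<tau> k) \<omega>) -` {v k} \<inter> space M)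
    = {\<omega>\<in>space M. \<forall>k<m. N (?\<tau> (Suc k)) \<omega> - N (?\<tau> k) \<omega> = v k}"
    using False by auto
  also have "(\<Prod>k<m. prob ((\<lambda>\<omega>. N (?\<tau> (Suc k)) \<omega> - N (?\<tau> k) \<omega>) -` {v k} \<inter> space M))
    = (\<Prod>k<m. pmf (poisson_pmf (rate * h)) (v k))"
  proof (rule prod.cong[OF refl])
    fix k
    have "(\<lambda>\<omega>. N (?\<tau> (Suc k)) \<omega> - N (?\<tau> k) \<omega>) -` {v k} \<inter> space M
      = {\<omega>\<in>space M. N (?\<tau> (Suc k)) \<omega> - N (?\<tau> k) \<omega> = v k}" by auto
    then show "prob ((\<lambda>\<omega>. N (?\<tau> (Suc k)) \<omega> - N (?\<tau> k) \<omega>) -` {v k} \<inter> space M)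
      = pmf (poisson_pmf (rate * h)) (v k)"
      using prob_increment_eq[of "?\<tau> k" "?\<tau> (Suc k)" "v k"] assms by (simp add: algebra_simps)
  qed
  finally show ?thesis .
qed

context averaging_process
begin

definition increments :: "real \<Rightarrow> ((int ^ 'd) \<times> 'd) set \<Rightarrow> nat \<Rightarrow> 'w \<Rightarrow> (int ^ 'd) \<times> 'd \<Rightarrow> nat" where
  "increments h E k \<omega> p = (if p \<in> E
     then N (lattice_edge p) (real (Suc k) * h) \<omega> - N (lattice_edge p) (real k * h) \<omega> else 0)"

lemma lattice_edge_mem: "lattice_edge p \<in> lattice_edges"
  by (simp add: lattice_edges_eq)

lemma measurable_count: "0 \<le> t \<Longrightarrow> N (lattice_edge p) t \<in> measurable M (count_space UNIV)"
  by (rule poisson_process.random_variable_count[OF clocks_poisson[OF lattice_edge_mem]])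

text \<open>Each event concerns the path of one clock, so independence of the clocks as random elements of
  the path space gives the product over edges, and independent increments give the product over times.\<close>

lemma prob_increments_field:
  assumes "finite E" "0 < h"
  shows "prob {\<omega>\<in>space M. \<forall>p\<in>E. \<forall>k<m. increments h E k \<omega> p = v k p}
    = (\<Prod>p\<in>E. \<Prod>k<m. pmf (poisson_pmf (h / (2 * real CARD('d)))) (v k p))"
proof (cases "E = {}")
  case True
  then show ?thesis by (simp add: prob_space)
next
  case False
  let ?X = "\<lambda>e \<omega>. \<lambda>t\<in>{0..}. N e t \<omega>" and ?P = "Pi\<^sub>M {0::real..} (\<lambda>_. count_space UNIV :: nat measure)"
  let ?q = "the_inv lattice_edge :: (int ^ 'd) set \<Rightarrow> (int ^ 'd) \<times> 'd"
  define A where "A p = {w\<in>space ?P. \<forall>k<m. w (real (Suc k) * h) - w (real k * h) = v k p}" for p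
  have comp: "(\<lambda>w. w (real k * h)) \<in> measurable ?P (count_space UNIV)" for k
    by (rule measurable_component_singleton) (use assms(2) in simp)
  have A: "A p \<in> sets ?P" for p
  proof -
    have [measurable]: "(\<lambda>w. w (real (Suc k) * h) - w (real k * h)) \<in> measurable ?P (count_space UNIV)" for k
      by (rule measurable_nat_diff[OF comp comp])
    show ?thesis unfolding A_def by measurable
  qed
  have q: "?q (lattice_edge p) = p" for p by (rule the_inv_f_f[OF inj_lattice_edge])
  have pre: "?X (lattice_edge p) -` A p \<inter> space M
    = {\<omega>\<in>space M. \<forall>k<m. N (lattice_edge p) (real (Suc k) * h) \<omega> - N (lattice_edge p) (real k * h) \<omega> = v k p}" for p
    unfolding A_def using assms(2) by (auto simp: space_PiM)
  have "{\<omega>\<in>space M. \<forall>p\<in>E. \<forall>k<m. increments h E k \<omega> p = v k p}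
    = (\<Inter>e\<in>lattice_edge ` E. ?X e -` A (?q e) \<inter> space M)"
  proof -
    have "(\<Inter>e\<in>lattice_edge ` E. ?X e -` A (?q e) \<inter> space M)
      = (\<Inter>p\<in>E. {\<omega>\<in>space M. \<forall>k<m. N (lattice_edge p) (real (Suc k) * h) \<omega> - N (lattice_edge p) (real k * h) \<omega> = v k p})"
      by (simp only: image_image q pre)
    also have "\<dots> = {\<omega>\<in>space M. \<forall>p\<in>E. \<forall>k<m. increments h E k \<omega> p = v k p}"
      using False by (auto simp: increments_def)
    finally show ?thesis by simp
  qed
  also have "prob \<dots> = (\<Prod>e\<in>lattice_edge ` E. prob (?X e -` A (?q e) \<inter> space M))"
    by (rule indep_varsD[OF clocks_indep]) (use False assms A lattice_edge_mem in auto)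
  also have "\<dots> = (\<Prod>p\<in>E. prob (?X (lattice_edge p) -` A p \<inter> space M))"
    by (subst prod.reindex) (auto simp: q intro: inj_on_subset[OF inj_lattice_edge])
  also have "\<dots> = (\<Prod>p\<in>E. \<Prod>k<m. pmf (poisson_pmf (h / (2 * real CARD('d)))) (v k p))"
    unfolding pre
    using poisson_process.prob_increments_eq[OF clocks_poisson[OF lattice_edge_mem] assms(2)] by simp
  finally show ?thesis .
qed

text \<open>The list has the latest time step first. It takes countably many values, so it suffices to
  compare the probabilities of single lists.\<close>

theorem increments_law:
  assumes "finite E" "0 < h"
  shows "(\<lambda>\<omega>. map (\<lambda>k. increments h E k \<omega>) (rev [0..<m])) \<in> measurable M (count_space UNIV)" (is "?X \<in> _")
    and "distr M (count_space UNIV) (\<lambda>\<omega>. map (\<lambda>k. increments h E k \<omega>) (rev [0..<m]))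
      = measure_pmf (replicate_pmf m (poisson_field E (h / (2 * real CARD('d)))))"
proof -
  let ?r = "h / (2 * real CARD('d))"
  let ?F = "PiE_dflt E 0 (\<lambda>_. UNIV :: nat set)"
  define \<Omega> where "\<Omega> = {l\<in>lists ?F. length l = m}"
  have "countable ?F"
    by (subst dflt_image_PiE[symmetric]) (intro countable_image countable_PiE assms, simp)
  then have cnt: "countable \<Omega>" unfolding \<Omega>_def by (rule countable_subset[OF _ countable_lists, rotated]) auto
  have range: "?X \<omega> \<in> \<Omega>" for \<omega>
    unfolding \<Omega>_def PiE_dflt_def by (auto simp: increments_def)
  have zero: "x p = 0" if "l \<in> \<Omega>" "x \<in> set l" "p \<notin> E" for l x p
  proof -
    have "x \<in> ?F" using that(1,2) unfolding \<Omega>_def by blast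
    then show ?thesis using that(3) by (cases p) (simp add: PiE_dflt_def)
  qed
  have ev: "?X -` {l} \<inter> space M = {\<omega>\<in>space M. \<forall>p\<in>E. \<forall>k<m. increments h E k \<omega> p = (rev l ! k) p}"
    if l: "l \<in> \<Omega>" for l
  proof -
    have "?X \<omega> = l \<longleftrightarrow> (\<forall>p\<in>E. \<forall>k<m. increments h E k \<omega> p = (rev l ! k) p)" for \<omega>
    proof -
      have out: "(rev l ! k) p = 0" if "k < m" "p \<notin> E" for k p
      proof -
        have "rev l ! k \<in> set (rev l)" using that l by (intro nth_mem) (simp add: \<Omega>_def)
        then show ?thesis using zero[OF l _ that(2)] by simp
      qed
      have "?X \<omega> = l \<longleftrightarrow> rev (?X \<omega>) = rev l" by simp
      also have "\<dots> \<longleftrightarrow> map (\<lambda>k. increments h E k \<omega>) [0..<m] = rev l" by (simp add: rev_map)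
      also have "\<dots> \<longleftrightarrow> (\<forall>k<m. increments h E k \<omega> = rev l ! k)"
        using l by (auto simp: list_eq_iff_nth_eq \<Omega>_def)
      also have "\<dots> \<longleftrightarrow> (\<forall>k<m. \<forall>p. increments h E k \<omega> p = (rev l ! k) p)"
        by (simp add: fun_eq_iff)
      also have "\<dots> \<longleftrightarrow> (\<forall>p\<in>E. \<forall>k<m. increments h E k \<omega> p = (rev l ! k) p)"
        using out by (auto simp: increments_def)
      finally show ?thesis .
    qed
    then show ?thesis by auto
  qed
  have meas1: "{\<omega>\<in>space M. \<forall>p\<in>E. \<forall>k<m. increments h E k \<omega> p = v k p} \<in> sets M" for v
  proof -
    have [measurable]: "(\<lambda>\<omega>. increments h E k \<omega> p) \<in> measurable M (count_space UNIV)" for k p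
      unfolding increments_def
      using measurable_count[of "real k * h" p] measurable_count[of "real (Suc k) * h" p] assms(2)
      by (cases "p \<in> E") simp_all
    show ?thesis using assms(1) by measurable
  qed
  have "?X \<in> measurable M (count_space \<Omega>)"
    unfolding measurable_count_space_eq_countable[OF cnt]
  proof (intro conjI ballI)
    show "?X \<in> space M \<rightarrow> \<Omega>" using range by (rule Pi_I)
    show "?X -` {l} \<inter> space M \<in> sets M" if "l \<in> \<Omega>" for l
      unfolding ev[OF that] by (rule meas1)
  qed
  then have "id \<circ> ?X \<in> measurable M (count_space UNIV)"
    by (rule measurable_comp) simp
  then show meas: "?X \<in> measurable M (count_space UNIV)" by (simp add: comp_def)
  show "distr M (count_space UNIV) ?X = measure_pmf (replicate_pmf m (poisson_field E ?r))"
  proof (rule measure_eqI_countable_AE[where \<Omega>=\<Omega>])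
    show "AE x in distr M (count_space UNIV) ?X. x \<in> \<Omega>"
      using meas range by (subst AE_distr_iff) auto
    show "AE x in measure_pmf (replicate_pmf m (poisson_field E ?r)). x \<in> \<Omega>"
    proof -
      have "set_pmf (poisson_field E ?r) \<subseteq> ?F"
        using set_Pi_pmf_subset[OF assms(1)] by (simp only: PiE_dflt_def UNIV_I simp_thms)
      then show ?thesis by (auto simp: AE_measure_pmf_iff set_replicate_pmf \<Omega>_def)
    qed
    fix l assume l: "l \<in> \<Omega>"
    have "measure (distr M (count_space UNIV) ?X) {l} = prob (?X -` {l} \<inter> space M)"
      using meas by (subst measure_distr) auto
    also have "\<dots> = (\<Prod>p\<in>E. \<Prod>k<m. pmf (poisson_pmf ?r) ((rev l ! k) p))"
      unfolding ev[OF l] by (rule prob_increments_field[OF assms])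
    also have "\<dots> = (\<Prod>k<m. \<Prod>p\<in>E. pmf (poisson_pmf ?r) ((rev l ! k) p))"
      by (rule prod.swap)
    also have "\<dots> = (\<Prod>k<m. pmf (poisson_field E ?r) (rev l ! k))"
    proof (rule prod.cong[OF refl])
      fix k assume "k \<in> {..<m}"
      then have "rev l ! k \<in> set (rev l)" using l by (intro nth_mem) (simp add: \<Omega>_def)
      then have "\<forall>p. p \<notin> E \<longrightarrow> (rev l ! k) p = 0" using zero[OF l] by simp
      then show "(\<Prod>p\<in>E. pmf (poisson_pmf ?r) ((rev l ! k) p)) = pmf (poisson_field E ?r) (rev l ! k)"
        by (subst pmf_Pi'[OF assms(1)]) auto
    qed
    also have "\<dots> = (\<Prod>x\<leftarrow>rev l. pmf (poisson_field E ?r) x)"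
      using l by (simp add: prod.list_conv_set_nth \<Omega>_def atLeast0LessThan)
    also have "\<dots> = (\<Prod>x\<leftarrow>l. pmf (poisson_field E ?r) x)"
      by (simp add: rev_map[symmetric])
    also have "\<dots> = measure (measure_pmf (replicate_pmf m (poisson_field E ?r))) {l}"
      using l by (simp add: measure_pmf_single pmf_replicate_pmf \<Omega>_def)
    finally have eq: "measure (distr M (count_space UNIV) ?X) {l}
      = measure (measure_pmf (replicate_pmf m (poisson_field E ?r))) {l}" .
    interpret X: prob_space "distr M (count_space UNIV) ?X" by (rule prob_space_distr[OF meas])
    show "emeasure (distr M (count_space UNIV) ?X) {l}
      = emeasure (measure_pmf (replicate_pmf m (poisson_field E ?r))) {l}"
      unfolding X.emeasure_eq_measure measure_pmf.emeasure_eq_measure eq ..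
  qed (simp_all add: cnt)
qed

end

section \<open>Concentration of the averaging process\<close>

context averaging_process
begin

lemma AE_averaging_path: "AE \<omega> in M. averaging_path (\<lambda>e s. N e s \<omega>) (\<lambda>t. \<eta> t \<omega>)"
proof -
  have cnt: "countable (lattice_edges :: (int ^ 'd) set set)" unfolding lattice_edges_eq by simp
  have "AE \<omega> in M. \<forall>e\<in>lattice_edges. N e 0 \<omega> = 0 \<and> mono_on {0..} (\<lambda>t. N e t \<omega>) \<and>
      (\<forall>t\<ge>0. continuous (at_right t) (\<lambda>s. N e s \<omega>))"
    by (rule AE_ball_countable'[OF _ cnt]) (rule poisson_process.paths[OF clocks_poisson])
  with averaging constant_between_rings show ?thesis
  proof eventually_elim
    case (elim \<omega>)
    show ?case
    proof
      fix e :: "(int ^ 'd) set" assume "e \<in> lattice_edges"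
      then show "mono_on {0..} (\<lambda>s. N e s \<omega>)" and "\<And>t. 0 \<le> t \<Longrightarrow> continuous (at_right t) (\<lambda>s. N e s \<omega>)"
        using elim(3) by auto
    next
      fix x y t assume "{x, y} \<in> lattice_edges" "rings_at (\<lambda>s. N {x, y} s \<omega>) t"
      then show "\<eta> t \<omega> x = (Lim (at_left t) (\<lambda>s. \<eta> s \<omega> x) + Lim (at_left t) (\<lambda>s. \<eta> s \<omega> y)) / 2"
        using elim(1) by blast
    next
      fix s t x assume "0 \<le> s" "s < t" "\<And>e u. e \<in> lattice_edges \<Longrightarrow> x \<in> e \<Longrightarrow> u \<in> {s<..t} \<Longrightarrow>
        \<not> rings_at (\<lambda>s. N e s \<omega>) u"
      then show "\<eta> t \<omega> x = \<eta> s \<omega> x" using elim(2) by blast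
    qed
  qed
qed

text \<open>The clocks of \<open>edges_from ((nbhd ^^ (m + 2)) F)\<close> are all that can matter: the relevant set lies within
  distance \<open>m\<close> of \<open>F\<close>, its edges reach one step further, and edges adjacent to these start at most two steps
  away.\<close>

definition clash_in :: "(int ^ 'd) set \<Rightarrow> real \<Rightarrow> nat \<Rightarrow> 'w \<Rightarrow> bool" where
  "clash_in F t m \<omega> = (let E = edges_from ((nbhd ^^ (m + 2)) F) in
     finite_graph.clashes E fst edge_end (map (\<lambda>k. increments (t / m) E k \<omega>) (rev [0..<m])) F)"

lemma process_follows_run:
  assumes t: "0 < t" and m: "0 < m" and F: "finite F" and E: "E = edges_from ((nbhd ^^ (m + 2)) F)"
  shows "AE \<omega> in M. \<not> clash_in F t m \<omega> \<longrightarrow>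
    (\<forall>x\<in>F. \<eta> t \<omega> x = finite_graph.run E fst edge_end
        (map (\<lambda>k e. 0 < increments (t / m) E k \<omega> e) (rev [0..<m])) (pmf \<mu>) x \<and> 0 \<le> \<eta> t \<omega> x)
    \<and> (\<Sum>x\<in>F. \<eta> t \<omega> x) \<le> 1"
  using AE_averaging_path initial
proof eventually_elim
  case (elim \<omega>)
  define h where "h = t / real m"
  let ?W = "(nbhd ^^ (m + 2)) F"
  interpret path: averaging_path "\<lambda>e s. N e s \<omega>" "\<lambda>t. \<eta> t \<omega>" by (rule elim(1))
  have finW: "finite ?W" by (rule finite_nbhd_funpow[OF F])
  interpret G: finite_graph "nbhd ?W" E fst edge_end "2 * CARD('d)"
    unfolding E by (rule lattice_finite_graph[OF finW])
  \<comment> \<open>The region of influence: one layer for each of the remaining time steps.\<close>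
  define A where "A k = (nbhd ^^ (m - k)) F" for k
  have h: "0 < h" using t m by (simp add: h_def)
  have A_Suc: "A k = nbhd (A (Suc k))" if "k < m" for k
  proof -
    have "m - k = Suc (m - Suc k)" using that by simp
    then show ?thesis unfolding A_def by simp
  qed
  have W_eq: "?W = nbhd (nbhd ((nbhd ^^ m) F))" by (simp add: numeral_2_eq_2)
  have A_W: "nbhd (A k) \<subseteq> ?W" for k
    unfolding W_eq A_def
    by (rule nbhd_mono, rule order_trans[OF nbhd_funpow_mono[of "m - k" m] subset_nbhd]) simp
  have A_W': "A k \<subseteq> ?W" for k using A_W[of k] subset_nbhd by blast
  have start_E: "p \<in> E" if "fst p \<in> ?W" for p using that unfolding E by (cases p) simp
  have touching_E: "p \<in> E" if "fst p \<in> A k \<or> edge_end p \<in> A k" for p k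
    using that A_W[of k] A_W'[of k] edge_start_nbhd[of p "A k"] by (intro start_E) blast
  have inc_eq: "increments h E k \<omega> p = N (lattice_edge p) (real (Suc k) * h) \<omega> - N (lattice_edge p) (real k * h) \<omega>"
    if "p \<in> E" for k p using that by (simp add: increments_def)
  have le: "N (lattice_edge p) (real k * h) \<omega> \<le> N (lattice_edge p) (real (Suc k) * h) \<omega>" for k p
    using h by (intro mono_onD[OF path.mono[OF lattice_edge_mem]]) (auto intro!: mult_right_mono)
  have inc0: "N (lattice_edge p) (real (Suc k) * h) \<omega> = N (lattice_edge p) (real k * h) \<omega>"
    if "p \<in> E" "increments h E k \<omega> p = 0" for k p
    using that(2) le[of p k] unfolding inc_eq[OF that(1)] by simp
  have times: "0 \<le> real k * h" "real k * h < real (Suc k) * h" for k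
    using h by (auto intro!: mult_strict_right_mono)
  show ?case
    unfolding h_def[symmetric]
  proof
    assume nc: "\<not> clash_in F t m \<omega>"
    have mh: "real m * h = t" using m by (simp add: h_def)
    have res: "(\<forall>x\<in>F. \<eta> (real m * h) \<omega> x = G.run (map (\<lambda>k e. 0 < increments h E k \<omega> e) (rev [0..<m])) (pmf \<mu>) x
      \<and> 0 \<le> \<eta> (real m * h) \<omega> x) \<and> (\<Sum>x\<in>F. \<eta> (real m * h) \<omega> x) \<le> 1"
    proof (rule G.run_follows_dynamics[where A=A and m=m and k=m and D="\<lambda>k. increments h E k \<omega>"
          and \<zeta>="\<lambda>k x. \<eta> (real k * h) \<omega> x"])
      show "A k \<subseteq> nbhd ?W" for k using A_W' subset_nbhd by blast
      show "fst e \<in> A k \<and> edge_end e \<in> A k"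
        if k: "k < m" and e: "e \<in> E" "x \<in> A (Suc k)" "fst e = x \<or> edge_end e = x" for k e x
        using e subset_nbhd edge_end_nbhd[of e "A (Suc k)"] edge_start_nbhd[of e "A (Suc k)"]
        unfolding A_Suc[OF k] by blast
      show "A (Suc k) \<subseteq> A k" if "k < m" for k unfolding A_Suc[OF that] by (rule subset_nbhd)
      show "\<eta> (real (Suc k) * h) \<omega> x = \<eta> (real k * h) \<omega> x"
        if k: "k < m" and x: "x \<in> A (Suc k)"
          and z: "\<And>e. e \<in> E \<Longrightarrow> fst e = x \<or> edge_end e = x \<Longrightarrow> increments h E k \<omega> e = 0" for k x
      proof (rule path.stay[OF times])
        fix e :: "(int ^ 'd) set" assume "e \<in> lattice_edges" "x \<in> e"
        then obtain p where p: "e = lattice_edge p" "fst p = x \<or> edge_end p = x"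
          unfolding lattice_edges_eq lattice_edge_def by auto
        then have "p \<in> E" using x by (intro touching_E[of p "Suc k"]) auto
        then show "N e (real (Suc k) * h) \<omega> = N e (real k * h) \<omega>"
          unfolding p(1) using z p(2) by (intro inc0) auto
      qed
      show "\<eta> (real (Suc k) * h) \<omega> x = (\<eta> (real k * h) \<omega> (fst e) + \<eta> (real k * h) \<omega> (edge_end e)) / 2"
        if k: "k < m" and x: "x \<in> A (Suc k)" and e: "e \<in> E" "fst e = x \<or> edge_end e = x"
          and one: "increments h E k \<omega> e = 1"
          and others: "\<And>f. f \<in> E \<Longrightarrow> f \<noteq> e \<Longrightarrow> {fst e, edge_end e} \<inter> {fst f, edge_end f} \<noteq> {} \<Longrightarrow>
             increments h E k \<omega> f = 0" for k x e
      proof -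
        have ends: "fst e \<in> A k" "edge_end e \<in> A k"
          using e x subset_nbhd edge_end_nbhd[of e "A (Suc k)"] edge_start_nbhd[of e "A (Suc k)"]
          unfolding A_Suc[OF k] by blast+
        have inc: "N (lattice_edge e) (real (Suc k) * h) \<omega> = N (lattice_edge e) (real k * h) \<omega> + 1"
          using one le[of e k] unfolding inc_eq[OF e(1)] by simp
        have quiet: "N f (real (Suc k) * h) \<omega> = N f (real k * h) \<omega>"
          if f: "f \<in> lattice_edges" "f \<noteq> lattice_edge e" "f \<inter> lattice_edge e \<noteq> {}" for f
        proof -
          obtain p where p: "f = lattice_edge p" using f(1) unfolding lattice_edges_eq by blast
          have int: "{fst e, edge_end e} \<inter> {fst p, edge_end p} \<noteq> {}"
            using f(3) unfolding p lattice_edge_def by blast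
          then have "fst p \<in> A k \<or> edge_end p \<in> A k" using ends by auto
          then have "p \<in> E" by (rule touching_E)
          moreover have "p \<noteq> e" using f(2) p by auto
          ultimately show ?thesis unfolding p using others int by (intro inc0) auto
        qed
        obtain y where y: "lattice_edge e = {x, y}" "{fst e, edge_end e} = {x, y}" "y = fst e \<or> y = edge_end e"
          "x = fst e \<and> y = edge_end e \<or> y = fst e \<and> x = edge_end e"
          using e(2) unfolding lattice_edge_def by (auto simp: insert_commute)
        have "\<eta> (real (Suc k) * h) \<omega> x = (\<eta> (real k * h) \<omega> x + \<eta> (real k * h) \<omega> y) / 2"
        proof (rule path.average_once[OF times])
          show "{x, y} \<in> lattice_edges" unfolding y(1)[symmetric] by (rule lattice_edge_mem)
          show "N {x, y} (real (Suc k) * h) \<omega> = N {x, y} (real k * h) \<omega> + 1"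
            unfolding y(1)[symmetric] by (rule inc)
          show "N f (real (Suc k) * h) \<omega> = N f (real k * h) \<omega>"
            if "f \<in> lattice_edges" "f \<noteq> {x, y}" "f \<inter> {x, y} \<noteq> {}" for f
            using that unfolding y(1)[symmetric] by (rule quiet)
        qed
        then show ?thesis using y(4) by auto
      qed
      show "\<eta> (real 0 * h) \<omega> x = pmf \<mu> x" for x using elim(2) by simp
      show "0 \<le> pmf \<mu> x" for x by simp
      show "(\<Sum>x\<in>B. pmf \<mu> x) \<le> 1" if "finite B" for B
        using measure_measure_pmf_finite[OF that, of \<mu>] measure_pmf.prob_le_1[of \<mu> B] by simp
      show "F \<subseteq> A m" unfolding A_def by simp
      show "\<not> G.clashes (map (\<lambda>k. increments h E k \<omega>) (rev [0..<m])) F"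
        using nc unfolding clash_in_def Let_def E[symmetric] h_def .
    qed simp_all
    show "(\<forall>x\<in>F. \<eta> t \<omega> x = finite_graph.run E fst edge_end
        (map (\<lambda>k e. 0 < increments h E k \<omega> e) (rev [0..<m])) (pmf \<mu>) x \<and> 0 \<le> \<eta> t \<omega> x)
      \<and> (\<Sum>x\<in>F. \<eta> t \<omega> x) \<le> 1"
      using res unfolding mh .
  qed
qed

end

context averaging_process
begin

text \<open>The factor of \<open>card F / m\<close> in \<open>prob_clashes\<close> for \<open>deg = 2 * d\<close> and the mean number
  \<open>r = t / (2 * d * m)\<close> of rings per edge and time step.\<close>

definition clash_bound :: "real \<Rightarrow> real" where
  "clash_bound t = (1 + 4 * real CARD('d)) * t\<^sup>2 * exp t / (2 * real CARD('d))"

lemma clash_in_measurable: "0 < t \<Longrightarrow> 0 < m \<Longrightarrow> finite F \<Longrightarrow> {\<omega>\<in>space M. clash_in F t m \<omega>} \<in> sets M"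
proof -
  assume a: "0 < t" "0 < m" "finite F"
  let ?E = "edges_from ((nbhd ^^ (m + 2)) F)"
  have "finite ?E" by (intro finite_cartesian_product finite_nbhd_funpow a(3)) simp
  then have "(\<lambda>\<omega>. map (\<lambda>k. increments (t / m) ?E k \<omega>) (rev [0..<m])) \<in> measurable M (count_space UNIV)"
    by (rule increments_law) (use a in simp)
  from measurable_sets[OF this, of "{Ds. finite_graph.clashes ?E fst edge_end Ds F}"]
  show ?thesis unfolding clash_in_def Let_def by (simp add: vimage_def Int_def conj_commute)
qed

lemma prob_clash_in:
  assumes "0 < t" "0 < m" "finite F"
  shows "prob {\<omega>\<in>space M. clash_in F t m \<omega>} \<le> card F * clash_bound t / m"
proof -
  let ?W = "(nbhd ^^ (m + 2)) F" and ?d = "real CARD('d)"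
  define E where "E = edges_from ?W"
  define r where "r = t / m / (2 * ?d)"
  have finW: "finite ?W" by (rule finite_nbhd_funpow[OF assms(3)])
  interpret G: finite_graph "nbhd ?W" E fst edge_end "2 * CARD('d)"
    unfolding E_def by (rule lattice_finite_graph[OF finW])
  let ?X = "\<lambda>\<omega>. map (\<lambda>k. increments (t / m) E k \<omega>) (rev [0..<m])"
  have h: "0 < t / m" using assms by simp
  have r: "0 < r" unfolding r_def by (rule divide_pos_pos[OF h]) simp
  note law = increments_law[OF G.finite_E h, of m]
  have "prob {\<omega>\<in>space M. clash_in F t m \<omega>} = prob (?X -` {Ds. G.clashes Ds F} \<inter> space M)"
    unfolding clash_in_def Let_def E_def[symmetric] by (intro arg_cong[where f=prob]) auto
  also have "\<dots> = measure (distr M (count_space UNIV) ?X) {Ds. G.clashes Ds F}"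
    by (subst measure_distr[OF law(1)]) auto
  also have "\<dots> = measure_pmf.prob (replicate_pmf m (poisson_field E r)) {Ds. G.clashes Ds F}"
    unfolding law(2) r_def ..
  also have "\<dots> \<le> card F * (real (2 * CARD('d)) * (1 + 2 * real (2 * CARD('d))) * r\<^sup>2 * m * exp (real (2 * CARD('d)) * r * m))"
    by (rule G.prob_clashes[OF assms(3) r])
  also have "\<dots> = card F * clash_bound t / m"
  proof -
    have "real (2 * CARD('d)) * r * m = t" using assms(2) by (simp add: r_def)
    moreover have "real (2 * CARD('d)) * (1 + 2 * real (2 * CARD('d))) * r\<^sup>2 * m
       = (1 + 4 * ?d) * t\<^sup>2 / (2 * ?d) / m"
      using assms(2) by (simp add: r_def field_simps power2_eq_square)
    ultimately show ?thesis by (simp add: clash_bound_def)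
  qed
  finally show ?thesis .
qed

text \<open>The failure event does not depend on \<open>m\<close> but implies a clash for each \<open>m\<close>.\<close>

lemma AE_finite_mass:
  assumes "0 < t" "finite F"
  shows "AE \<omega> in M. (\<forall>x\<in>F. 0 \<le> \<eta> t \<omega> x) \<and> (\<Sum>x\<in>F. \<eta> t \<omega> x) \<le> 1"
proof -
  let ?P = "\<lambda>\<omega>. (\<forall>x\<in>F. 0 \<le> \<eta> t \<omega> x) \<and> (\<Sum>x\<in>F. \<eta> t \<omega> x) \<le> 1"
  have [measurable]: "(\<lambda>\<omega>. \<eta> t \<omega> x) \<in> borel_measurable M" for x
    using random_variable_coordinate assms by simp
  have meas: "{\<omega>\<in>space M. \<not> ?P \<omega>} \<in> sets M" using assms(2) by measurable
  have "prob {\<omega>\<in>space M. \<not> ?P \<omega>} \<le> card F * clash_bound t / real (Suc m)" for m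
  proof -
    have "AE \<omega> in M. \<not> ?P \<omega> \<longrightarrow> clash_in F t (Suc m) \<omega>"
      using process_follows_run[OF assms(1) _ assms(2) refl, of "Suc m"] by (auto elim: AE_mp)
    then have "prob {\<omega>\<in>space M. \<not> ?P \<omega>} \<le> prob {\<omega>\<in>space M. clash_in F t (Suc m) \<omega>}"
      by (intro finite_measure_mono_AE clash_in_measurable) (use assms in auto)
    also have "\<dots> \<le> card F * clash_bound t / real (Suc m)"
      by (rule prob_clash_in) (use assms in auto)
    finally show ?thesis .
  qed
  moreover have "(\<lambda>m. card F * clash_bound t / real (Suc m)) \<longlonglongrightarrow> 0"
    by (rule LIMSEQ_Suc[OF lim_const_over_n])
  ultimately have "prob {\<omega>\<in>space M. \<not> ?P \<omega>} \<le> 0"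
    by (intro LIMSEQ_le_const) auto
  then have "prob {\<omega>\<in>space M. \<not> ?P \<omega>} = 0" by (simp add: measure_le_0_iff)
  then have "emeasure M {\<omega>\<in>space M. \<not> ?P \<omega>} = 0" by (simp add: emeasure_eq_measure)
  then show ?thesis by (subst AE_iff_measurable[OF meas refl])
qed

theorem AE_subprobability:
  assumes "0 < t"
  shows "AE \<omega> in M. (\<forall>x. 0 \<le> \<eta> t \<omega> x) \<and> (\<forall>F. finite F \<longrightarrow> (\<Sum>x\<in>F. \<eta> t \<omega> x) \<le> 1)"
proof -
  have "AE \<omega> in M. \<forall>F\<in>Collect finite. (\<forall>x\<in>F. 0 \<le> \<eta> t \<omega> x) \<and> (\<Sum>x\<in>F. \<eta> t \<omega> x) \<le> 1"
    by (rule AE_ball_countable'[OF _ countable_Collect_finite]) (use AE_finite_mass[OF assms] in simp)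
  then show ?thesis
  proof eventually_elim
    case (elim \<omega>)
    have "0 \<le> \<eta> t \<omega> x" for x using bspec[OF elim, of "{x}"] by simp
    with elim show ?case by simp
  qed
qed

text \<open>The process agrees on \<open>F\<close> with the linear evolution unless there is a clash, and for the latter
  the variance bound and the inequality of Chebyshev apply with \<open>\<Sum> \<mu>\<^sup>2 \<le> 1\<close>.\<close>

theorem concentration:
  fixes g :: "int ^ 'd \<Rightarrow> real"
  assumes t: "0 < t" and m: "0 < m" "2 * t \<le> m" and F: "finite F" and \<epsilon>: "0 < \<epsilon>"
    and g: "\<And>x. x \<notin> F \<Longrightarrow> g x = 0" and L: "\<And>x i. \<bar>g (x + axis i 1) - g x\<bar> \<le> L"
    and p: "p = 1 - exp (- (t / (2 * real CARD('d) * m)))"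
  shows "prob {\<omega>\<in>space M. \<epsilon> < \<bar>(\<Sum>x\<in>F. g x * \<eta> t \<omega> x) - measure_pmf.expectation \<mu> ((heat_step p ^^ m) g)\<bar>}
    \<le> L\<^sup>2 / \<epsilon>\<^sup>2 + card F * clash_bound t / m"
proof -
  let ?W = "(nbhd ^^ (m + 2)) F" and ?d = "real CARD('d)"
  define E where "E = edges_from ?W"
  define r where "r = t / m / (2 * ?d)"
  have finW: "finite ?W" by (rule finite_nbhd_funpow[OF F])
  interpret G: finite_graph "nbhd ?W" E fst edge_end "2 * CARD('d)"
    unfolding E_def by (rule lattice_finite_graph[OF finW])
  have d: "1 \<le> ?d" using zero_less_card_finite[where 'a='d] by linarith
  have h: "0 < t / m" using t m by simp
  have r: "0 < r" unfolding r_def by (rule divide_pos_pos[OF h]) simp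
  have p_eq: "p = 1 - exp (- r)" unfolding p r_def by (simp add: field_simps)
  have p01: "0 \<le> p" "p \<le> 1" using r unfolding p_eq by auto
  have pd: "p * real (2 * CARD('d)) \<le> 1 / 2"
  proof -
    have "p * real (2 * CARD('d)) \<le> r * real (2 * CARD('d))"
      unfolding p_eq by (rule mult_right_mono[OF one_minus_exp_le]) simp
    also have "\<dots> = t / m" unfolding r_def using m by simp
    also have "\<dots> \<le> 1 / 2" using m t by (simp add: field_simps)
    finally show ?thesis .
  qed
  have pd1: "p * ?d \<le> 1" using pd p01 by simp
  let ?X = "\<lambda>\<omega>. map (\<lambda>k. increments (t / m) E k \<omega>) (rev [0..<m])"
  let ?bits = "map (\<lambda>D e. 0 < D e) :: ((int ^ 'd) \<times> 'd \<Rightarrow> nat) list \<Rightarrow> _"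
  let ?g = "\<lambda>k. (heat_step p ^^ k) g"
  let ?c = "measure_pmf.expectation \<mu> (?g m)"
  let ?Z = "\<lambda>Rs. G.pairing g (G.run Rs (pmf \<mu>))"
  have supp: "?g k x = 0" if "k \<le> m" "x \<notin> (nbhd ^^ m) F" for k x
  proof (rule heat_step_funpow_eq_0)
    show "x \<notin> (nbhd ^^ k) F" using that nbhd_funpow_mono[of k m F] by blast
  qed (rule g)
  have F_V: "F \<subseteq> nbhd ?W"
    using nbhd_funpow_mono[of 0 "Suc (m + 2)" F] by simp
  have m_V: "(nbhd ^^ m) F \<subseteq> nbhd ?W"
    using nbhd_funpow_mono[of m "Suc (m + 2)" F] by simp
  have c: "G.pairing (?g m) (pmf \<mu>) = ?c"
    unfolding G.pairing_def
    by (rule integral_measure_pmf_real[symmetric, OF G.finite_V]) (use supp m_V in blast)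
  have norm_nonneg: "0 \<le> G.pairing f f" for f
    unfolding G.pairing_def by (intro sum_nonneg zero_le_square)
  have norm: "G.pairing (pmf \<mu>) (pmf \<mu>) \<le> 1"
  proof -
    have "G.pairing (pmf \<mu>) (pmf \<mu>) \<le> (\<Sum>x\<in>nbhd ?W. pmf \<mu> x)"
      unfolding G.pairing_def by (intro sum_mono) (simp add: mult_left_le pmf_le_1)
    also have "\<dots> \<le> 1"
      using measure_measure_pmf_finite[OF G.finite_V, of \<mu>] measure_pmf.prob_le_1[of \<mu> "nbhd ?W"] by simp
    finally show ?thesis .
  qed
  have fin: "finite (set_pmf (replicate_pmf m (bernoulli_field E p)))"
    by (intro finite_set_replicate_pmf finite_set_Pi_pmf G.finite_E finite_set_bernoulli)
  have "measure_pmf.expectation (replicate_pmf m (bernoulli_field E p))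
      (\<lambda>Rs. (G.pairing (?g 0) (G.run Rs (pmf \<mu>)) - G.pairing (?g m) (pmf \<mu>))\<^sup>2
        + L\<^sup>2 * G.pairing (G.run Rs (pmf \<mu>)) (G.run Rs (pmf \<mu>)))
    \<le> L\<^sup>2 * G.pairing (pmf \<mu>) (pmf \<mu>)"
  proof (rule G.averaging_variance_bound[OF p01 pd])
    fix k x assume k: "k < m"
    have "nbhd ((nbhd ^^ m) F) \<subseteq> ?W"
      using nbhd_funpow_mono[of "Suc m" "m + 2" F] by simp
    then show "?g (Suc k) x = G.exchange (\<lambda>_. p) (?g k) x"
      unfolding funpow.simps comp_apply E_def
      by (rule heat_step_eq_exchange[OF finW]) (use supp k in simp)
  next
    fix k and e :: "(int ^ 'd) \<times> 'd"
    show "\<bar>?g k (fst e) - ?g k (edge_end e)\<bar> \<le> L"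
      using heat_step_funpow_Lipschitz[OF p01(1) pd1 L, of k "fst e" "snd e"]
      by (simp add: edge_end_def abs_minus_commute)
  qed
  also have "\<dots> \<le> L\<^sup>2" using norm by (simp add: mult_left_le)
  finally have "measure_pmf.expectation (replicate_pmf m (bernoulli_field E p))
      (\<lambda>Rs. (?Z Rs - ?c)\<^sup>2 + L\<^sup>2 * G.pairing (G.run Rs (pmf \<mu>)) (G.run Rs (pmf \<mu>))) \<le> L\<^sup>2"
    unfolding c by simp
  moreover have "measure_pmf.expectation (replicate_pmf m (bernoulli_field E p)) (\<lambda>Rs. (?Z Rs - ?c)\<^sup>2)
    \<le> measure_pmf.expectation (replicate_pmf m (bernoulli_field E p))
      (\<lambda>Rs. (?Z Rs - ?c)\<^sup>2 + L\<^sup>2 * G.pairing (G.run Rs (pmf \<mu>)) (G.run Rs (pmf \<mu>)))"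
    by (rule expectation_mono_finite[OF fin], rule add_increasing2)
       (intro mult_nonneg_nonneg zero_le_power2 norm_nonneg, rule order_refl)
  ultimately have var: "measure_pmf.expectation (replicate_pmf m (bernoulli_field E p)) (\<lambda>Rs. (?Z Rs - ?c)\<^sup>2) \<le> L\<^sup>2"
    by linarith
  note law = increments_law[OF G.finite_E h, of m]
  have bits: "map_pmf ?bits (replicate_pmf m (poisson_field E r)) = replicate_pmf m (bernoulli_field E p)"
    unfolding replicate_pmf_map[symmetric] poisson_field_positive[OF G.finite_E r] p_eq ..
  let ?S = "{Ds. \<epsilon> < \<bar>?Z (?bits Ds) - ?c\<bar>}"
  have "prob {\<omega>\<in>space M. ?X \<omega> \<in> ?S} = measure (distr M (count_space UNIV) ?X) ?S"
    by (subst measure_distr[OF law(1)]) (auto intro!: arg_cong[where f=prob])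
  also have "\<dots> = measure_pmf.prob (replicate_pmf m (poisson_field E r)) ?S"
    unfolding law(2) r_def ..
  also have "\<dots> = measure_pmf.prob (map_pmf ?bits (replicate_pmf m (poisson_field E r))) {Rs. \<epsilon> < \<bar>?Z Rs - ?c\<bar>}"
    by (simp add: vimage_def)
  also have "\<dots> \<le> measure_pmf.expectation (replicate_pmf m (bernoulli_field E p)) (\<lambda>Rs. (?Z Rs - ?c)\<^sup>2) / \<epsilon>\<^sup>2"
    unfolding bits by (rule prob_Chebyshev_finite[OF fin \<epsilon>])
  also have "\<dots> \<le> L\<^sup>2 / \<epsilon>\<^sup>2" by (intro divide_right_mono var) simp
  finally have PS: "prob {\<omega>\<in>space M. ?X \<omega> \<in> ?S} \<le> L\<^sup>2 / \<epsilon>\<^sup>2" .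
  have meas_S: "{\<omega>\<in>space M. ?X \<omega> \<in> ?S} \<in> sets M"
  proof -
    have "{\<omega>\<in>space M. ?X \<omega> \<in> ?S} = ?X -` ?S \<inter> space M" by blast
    moreover have "?X -` ?S \<inter> space M \<in> sets M" by (rule measurable_sets[OF law(1)]) simp
    ultimately show ?thesis by (simp only:)
  qed
  have meas_C: "{\<omega>\<in>space M. clash_in F t m \<omega>} \<in> sets M"
    by (rule clash_in_measurable[OF t m(1) F])
  have "AE \<omega> in M. \<omega> \<in> {\<omega>\<in>space M. \<epsilon> < \<bar>(\<Sum>x\<in>F. g x * \<eta> t \<omega> x) - ?c\<bar>} \<longrightarrow>
    \<omega> \<in> {\<omega>\<in>space M. ?X \<omega> \<in> ?S} \<union> {\<omega>\<in>space M. clash_in F t m \<omega>}"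
    using process_follows_run[OF t m(1) F E_def]
  proof eventually_elim
    case (elim \<omega>)
    show ?case
    proof
      assume a: "\<omega> \<in> {\<omega>\<in>space M. \<epsilon> < \<bar>(\<Sum>x\<in>F. g x * \<eta> t \<omega> x) - ?c\<bar>}"
      show "\<omega> \<in> {\<omega>\<in>space M. ?X \<omega> \<in> ?S} \<union> {\<omega>\<in>space M. clash_in F t m \<omega>}"
      proof (cases "clash_in F t m \<omega>")
        case False
        have bX: "?bits (?X \<omega>) = map (\<lambda>k e. 0 < increments (t / m) E k \<omega> e) (rev [0..<m])" by simp
        have "?Z (?bits (?X \<omega>)) = (\<Sum>x\<in>F. g x * G.run (?bits (?X \<omega>)) (pmf \<mu>) x)"
          unfolding G.pairing_def
          by (rule sum.mono_neutral_right) (use G.finite_V F_V g in auto)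
        also have "\<dots> = (\<Sum>x\<in>F. g x * \<eta> t \<omega> x)"
          unfolding bX using elim False by (intro sum.cong) auto
        finally have "?Z (?bits (?X \<omega>)) = (\<Sum>x\<in>F. g x * \<eta> t \<omega> x)" .
        then have "?X \<omega> \<in> ?S" using a by (simp only: mem_Collect_eq)
        with a show ?thesis by blast
      qed (use a in blast)
    qed
  qed
  then have "prob {\<omega>\<in>space M. \<epsilon> < \<bar>(\<Sum>x\<in>F. g x * \<eta> t \<omega> x) - ?c\<bar>}
    \<le> prob ({\<omega>\<in>space M. ?X \<omega> \<in> ?S} \<union> {\<omega>\<in>space M. clash_in F t m \<omega>})"
    by (rule finite_measure_mono_AE) (use meas_S meas_C in blast)
  also have "\<dots> \<le> prob {\<omega>\<in>space M. ?X \<omega> \<in> ?S} + prob {\<omega>\<in>space M. clash_in F t m \<omega>}"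
    by (rule measure_Un_le[OF meas_S meas_C])
  also have "\<dots> \<le> L\<^sup>2 / \<epsilon>\<^sup>2 + card F * clash_bound t / m"
    by (rule add_mono[OF PS prob_clash_in[OF t m(1) F]])
  finally show ?thesis .
qed

end

section \<open>The central limit theorem for the lazy walk\<close>

definition heat_step1 :: "real \<Rightarrow> (int \<Rightarrow> real) \<Rightarrow> int \<Rightarrow> real" where
  "heat_step1 p u k = u k + p / 2 * ((u (k + 1) - u k) + (u (k - 1) - u k))"

definition lazy_step :: "real \<Rightarrow> int pmf" where
  "lazy_step p = bind_pmf (bernoulli_pmf p)
    (\<lambda>b. if b then map_pmf (\<lambda>c. if c then 1 else - 1) (bernoulli_pmf (1 / 2)) else return_pmf 0)"

primrec lazy_walk :: "real \<Rightarrow> nat \<Rightarrow> int pmf" where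
  "lazy_walk p 0 = return_pmf 0"
| "lazy_walk p (Suc m) = bind_pmf (lazy_walk p m) (\<lambda>s. map_pmf (\<lambda>\<xi>. s + \<xi>) (lazy_step p))"

lemma finite_lazy_step [simp]: "finite (set_pmf (lazy_step p))"
  unfolding lazy_step_def by (auto simp: set_bind_pmf intro!: finite_UN_I)

lemma finite_lazy_walk [simp]: "finite (set_pmf (lazy_walk p m))"
  by (induction m) auto

lemma expectation_lazy_step:
  assumes "0 \<le> p" "p \<le> 1"
  shows "measure_pmf.expectation (lazy_step p) (\<lambda>\<xi>. u (k + \<xi>)) = heat_step1 p u k"
proof -
  have "measure_pmf.expectation (lazy_step p) (\<lambda>\<xi>. u (k + \<xi>)) = p * (u (k + 1) / 2 + u (k - 1) / 2) + (1 - p) * u k"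
    unfolding lazy_step_def
    by (subst expectation_bind_pmf_finite) (use assms in auto)
  then show ?thesis by (simp add: heat_step1_def field_simps)
qed

lemma expectation_lazy_walk:
  assumes "0 \<le> p" "p \<le> 1"
  shows "measure_pmf.expectation (lazy_walk p m) (\<lambda>s. u (k + s)) = (heat_step1 p ^^ m) u k"
proof (induction m arbitrary: u)
  case (Suc m)
  have "measure_pmf.expectation (lazy_walk p (Suc m)) (\<lambda>s. u (k + s))
    = measure_pmf.expectation (lazy_walk p m) (\<lambda>s. measure_pmf.expectation (lazy_step p) (\<lambda>\<xi>. u ((k + s) + \<xi>)))"
    by (simp add: expectation_bind_pmf_finite add.assoc)
  also have "\<dots> = measure_pmf.expectation (lazy_walk p m) (\<lambda>s. heat_step1 p u (k + s))"
    unfolding expectation_lazy_step[OF assms] ..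
  also have "\<dots> = (heat_step1 p ^^ m) (heat_step1 p u) k" by (rule Suc.IH)
  finally show ?case by (simp add: funpow_swap1)
qed simp

lemma heat_step1_scale: "heat_step1 p (\<lambda>k. c * u k) = (\<lambda>k. c * heat_step1 p u k)"
  by (rule ext) (simp add: heat_step1_def algebra_simps)

lemma heat_step1_eigen:
  assumes "heat_step1 p u = (\<lambda>k. c * u k)"
  shows "(heat_step1 p ^^ m) u = (\<lambda>k. c ^ m * u k)"
proof (induction m)
  case (Suc m)
  have "(heat_step1 p ^^ Suc m) u = heat_step1 p (\<lambda>k. c ^ m * u k)" using Suc by simp
  also have "\<dots> = (\<lambda>k. c ^ m * (c * u k))" unfolding heat_step1_scale assms ..
  finally show ?case by (simp add: mult_ac)
qed simp

lemma heat_step1_cos: "heat_step1 p (\<lambda>k. cos (a * of_int k)) = (\<lambda>k. (1 - p * (1 - cos a)) * cos (a * of_int k))"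
  by (rule ext) (simp add: heat_step1_def distrib_left right_diff_distrib cos_add cos_diff field_simps)

lemma heat_step1_sin: "heat_step1 p (\<lambda>k. sin (a * of_int k)) = (\<lambda>k. (1 - p * (1 - cos a)) * sin (a * of_int k))"
  by (rule ext) (simp add: heat_step1_def distrib_left right_diff_distrib sin_add sin_diff field_simps)

definition scaled_walk :: "real \<Rightarrow> nat \<Rightarrow> real \<Rightarrow> real measure" where
  "scaled_walk p m s = distr (measure_pmf (lazy_walk p m)) borel (\<lambda>k. of_int k / s)"

lemma real_distribution_scaled_walk: "real_distribution (scaled_walk p m s)"
proof -
  interpret D: prob_space "scaled_walk p m s"
    unfolding scaled_walk_def by (rule measure_pmf.prob_space_distr) simp
  show ?thesis by standard (simp add: scaled_walk_def)
qed

lemma char_scaled_walk: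
  assumes "0 \<le> p" "p \<le> 1"
  shows "char (scaled_walk p m s) u = complex_of_real ((1 - p * (1 - cos (u / s))) ^ m)"
proof -
  have int: "integrable (measure_pmf (lazy_walk p m)) f" for f :: "int \<Rightarrow> complex"
    by (rule integrable_measure_pmf_finite) simp
  have arg: "u * (of_int k / s) = u / s * of_int k" for k by simp
  have "char (scaled_walk p m s) u = measure_pmf.expectation (lazy_walk p m) (\<lambda>k. iexp (u / s * of_int k))"
    unfolding char_def scaled_walk_def by (subst integral_distr) (auto simp: arg)
  also have "\<dots> = complex_of_real ((1 - p * (1 - cos (u / s))) ^ m)"
  proof (rule complex_eqI)
    have "Re (measure_pmf.expectation (lazy_walk p m) (\<lambda>k. iexp (u / s * of_int k)))
      = measure_pmf.expectation (lazy_walk p m) (\<lambda>k. cos (u / s * of_int (0 + k)))"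
      by (subst integral_Re[OF int, symmetric]) (simp add: Re_exp)
    also have "\<dots> = (1 - p * (1 - cos (u / s))) ^ m"
      unfolding expectation_lazy_walk[OF assms, of m "\<lambda>k. cos (u / s * of_int k)"]
        heat_step1_eigen[OF heat_step1_cos] by simp
    finally show "Re (measure_pmf.expectation (lazy_walk p m) (\<lambda>k. iexp (u / s * of_int k)))
      = Re (complex_of_real ((1 - p * (1 - cos (u / s))) ^ m))" by simp
    have "Im (measure_pmf.expectation (lazy_walk p m) (\<lambda>k. iexp (u / s * of_int k)))
      = measure_pmf.expectation (lazy_walk p m) (\<lambda>k. sin (u / s * of_int (0 + k)))"
      by (subst integral_Im[OF int, symmetric]) (simp add: Im_exp)
    also have "\<dots> = 0"
      unfolding expectation_lazy_walk[OF assms, of m "\<lambda>k. sin (u / s * of_int k)"]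
        heat_step1_eigen[OF heat_step1_sin] by simp
    finally show "Im (measure_pmf.expectation (lazy_walk p m) (\<lambda>k. iexp (u / s * of_int k)))
      = Im (complex_of_real ((1 - p * (1 - cos (u / s))) ^ m))" by simp
  qed
  finally show ?thesis .
qed

text \<open>Since \<open>- x - 2 x\<^sup>2 \<le> ln (1 - x) \<le> - x\<close> for small \<open>x \<ge> 0\<close>.\<close>

lemma tendsto_one_minus_power:
  fixes x :: "nat \<Rightarrow> real" and m :: "nat \<Rightarrow> nat"
  assumes x: "x \<longlonglongrightarrow> 0" "\<And>n. 0 \<le> x n" and mx: "(\<lambda>n. m n * x n) \<longlonglongrightarrow> c"
  shows "(\<lambda>n. (1 - x n) ^ m n) \<longlonglongrightarrow> exp (- c)"
proof -
  have small: "\<forall>\<^sub>F n in sequentially. x n < 1 / 2"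
    using order_tendstoD(2)[OF x(1), of "1 / 2"] by simp
  have eq: "\<forall>\<^sub>F n in sequentially. exp (m n * ln (1 - x n)) = (1 - x n) ^ m n"
    using small by eventually_elim (simp add: exp_of_nat_mult)
  have "(\<lambda>n. m n * ln (1 - x n)) \<longlonglongrightarrow> - c"
  proof (rule tendsto_sandwich)
    show "\<forall>\<^sub>F n in sequentially. - (m n * x n) - 2 * (m n * x n) * x n \<le> m n * ln (1 - x n)"
      using small
    proof eventually_elim
      case (elim n)
      have "- x n - 2 * (x n)\<^sup>2 \<le> ln (1 - x n)"
        by (rule ln_one_minus_pos_lower_bound) (use x(2)[of n] elim in auto)
      then have "m n * (- x n - 2 * (x n)\<^sup>2) \<le> m n * ln (1 - x n)" by (rule mult_left_mono) simp
      then show ?case by (simp add: algebra_simps power2_eq_square)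
    qed
    show "\<forall>\<^sub>F n in sequentially. m n * ln (1 - x n) \<le> - (m n * x n)"
      using small
    proof eventually_elim
      case (elim n)
      have "ln (1 - x n) \<le> - x n" using ln_le_minus_one[of "1 - x n"] elim by simp
      then have "m n * ln (1 - x n) \<le> m n * (- x n)" by (rule mult_left_mono) simp
      then show ?case by simp
    qed
    have "(\<lambda>n. - (m n * x n) - 2 * (m n * x n) * x n) \<longlonglongrightarrow> - c - 2 * c * 0"
      by (intro tendsto_intros mx x)
    then show "(\<lambda>n. - (m n * x n) - 2 * (m n * x n) * x n) \<longlonglongrightarrow> - c" by simp
    show "(\<lambda>n. - (m n * x n)) \<longlonglongrightarrow> - c" by (intro tendsto_intros mx)
  qed
  then have "(\<lambda>n. exp (m n * ln (1 - x n))) \<longlonglongrightarrow> exp (- c)" by (rule tendsto_exp)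
  then show ?thesis by (rule Lim_transform_eventually[OF _ eq])
qed

lemma one_minus_cos_limit:
  fixes s :: "nat \<Rightarrow> real"
  assumes "filterlim s at_top sequentially"
  shows "(\<lambda>n. (1 - cos (u / s n)) * (s n)\<^sup>2) \<longlonglongrightarrow> u\<^sup>2 / 2"
proof -
  have "((\<lambda>y::real. (1 - cos (u / y)) * y\<^sup>2) \<longlongrightarrow> u\<^sup>2 / 2) at_top"
    by (real_asymp simp: power2_eq_square)
  then show ?thesis using assms by (rule filterlim_compose)
qed

theorem lazy_walk_central_limit:
  fixes p s :: "nat \<Rightarrow> real" and m :: "nat \<Rightarrow> nat"
  assumes p: "\<And>n. 0 \<le> p n" "\<And>n. p n \<le> 1" and s: "filterlim s at_top sequentially"
    and var: "(\<lambda>n. m n * p n / (s n)\<^sup>2) \<longlonglongrightarrow> 1"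
  shows "weak_conv_m (\<lambda>n. scaled_walk (p n) (m n) (s n)) std_normal_distribution"
proof (rule levy_continuity)
  fix u :: real
  let ?x = "\<lambda>n. p n * (1 - cos (u / s n))"
  have cos0: "(\<lambda>n. 1 - cos (u / s n)) \<longlonglongrightarrow> 0"
  proof -
    have "(\<lambda>n. u / s n) \<longlonglongrightarrow> 0" using s by (intro tendsto_divide_0[OF tendsto_const] filterlim_at_top_imp_at_infinity)
    then have "(\<lambda>n. 1 - cos (u / s n)) \<longlonglongrightarrow> 1 - cos 0" by (intro tendsto_intros)
    then show ?thesis by simp
  qed
  have x0: "?x \<longlonglongrightarrow> 0"
  proof (rule tendsto_sandwich[OF _ _ tendsto_const cos0])
    show "\<forall>\<^sub>F n in sequentially. 0 \<le> ?x n" using p by (intro always_eventually) simp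
    show "\<forall>\<^sub>F n in sequentially. ?x n \<le> 1 - cos (u / s n)"
      using p by (intro always_eventually allI mult_left_le_one_le) auto
  qed
  have "(\<lambda>n. (m n * p n / (s n)\<^sup>2) * ((1 - cos (u / s n)) * (s n)\<^sup>2)) \<longlonglongrightarrow> 1 * (u\<^sup>2 / 2)"
    by (intro tendsto_mult var one_minus_cos_limit s)
  moreover have "\<forall>\<^sub>F n in sequentially. (m n * p n / (s n)\<^sup>2) * ((1 - cos (u / s n)) * (s n)\<^sup>2) = m n * ?x n"
    using eventually_compose_filterlim[OF eventually_gt_at_top[of 0] s] by eventually_elim simp
  ultimately have "(\<lambda>n. m n * ?x n) \<longlonglongrightarrow> u\<^sup>2 / 2" by (simp add: Lim_transform_eventually)
  from tendsto_one_minus_power[OF x0 _ this] p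
  have "(\<lambda>n. (1 - ?x n) ^ m n) \<longlonglongrightarrow> exp (- (u\<^sup>2 / 2))" by simp
  then have "(\<lambda>n. complex_of_real ((1 - ?x n) ^ m n)) \<longlonglongrightarrow> complex_of_real (exp (- (u\<^sup>2 / 2)))"
    by (rule tendsto_of_real)
  then show "(\<lambda>n. char (scaled_walk (p n) (m n) (s n)) u) \<longlonglongrightarrow> char std_normal_distribution u"
    unfolding char_scaled_walk[OF p] char_std_normal_distribution by simp
next
  show "real_distribution std_normal_distribution" by (rule real_dist_normal_dist)
qed (rule real_distribution_scaled_walk)

text \<open>The starting point \<open>k\<close> is moved to \<open>0\<close> by uniform continuity, since \<open>k / s n\<close> tends to
  \<open>0\<close>.\<close>

corollary heat_step1_central_limit:
  fixes p s :: "nat \<Rightarrow> real" and m :: "nat \<Rightarrow> nat" and \<phi> :: "real \<Rightarrow> real"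
  assumes p: "\<And>n. 0 \<le> p n" "\<And>n. p n \<le> 1" and s: "filterlim s at_top sequentially"
    and var: "(\<lambda>n. m n * p n / (s n)\<^sup>2) \<longlonglongrightarrow> 1"
    and \<phi>: "uniformly_continuous_on UNIV \<phi>" "\<And>x. \<bar>\<phi> x\<bar> \<le> B"
  shows "(\<lambda>n. (heat_step1 (p n) ^^ m n) (\<lambda>k. \<phi> (of_int k / s n)) k)
    \<longlonglongrightarrow> (\<integral>x. \<phi> x \<partial>std_normal_distribution)"
proof -
  have cont: "isCont \<phi> x" for x
    using uniformly_continuous_imp_continuous[OF \<phi>(1)] continuous_on_eq_continuous_at[of UNIV \<phi>] by simp
  have meas: "\<phi> \<in> borel_measurable borel"
    by (rule borel_measurable_continuous_onI[OF uniformly_continuous_imp_continuous[OF \<phi>(1)]])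
  have conv: "(\<lambda>n. \<integral>x. \<phi> x \<partial>scaled_walk (p n) (m n) (s n)) \<longlonglongrightarrow> (\<integral>x. \<phi> x \<partial>std_normal_distribution)"
    by (rule weak_conv_imp_integral_bdd_continuous_conv[OF real_distribution_scaled_walk
          real_dist_normal_dist lazy_walk_central_limit[OF p s var]])
       (use cont \<phi>(2) in auto)
  have int: "(\<integral>x. \<phi> x \<partial>scaled_walk (p n) (m n) (s n)) = measure_pmf.expectation (lazy_walk (p n) (m n)) (\<lambda>j. \<phi> (of_int j / s n))" for n
    unfolding scaled_walk_def by (rule integral_distr) (use meas in auto)
  have "(\<lambda>n. (heat_step1 (p n) ^^ m n) (\<lambda>k. \<phi> (of_int k / s n)) k - (\<integral>x. \<phi> x \<partial>scaled_walk (p n) (m n) (s n))) \<longlonglongrightarrow> 0"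
  proof (rule LIMSEQ_I)
    fix e :: real assume e: "0 < e"
    then have "\<exists>d>0. \<forall>x\<in>UNIV. \<forall>x'\<in>UNIV. dist x' x < d \<longrightarrow> dist (\<phi> x') (\<phi> x) < e / 2"
      using \<phi>(1)[unfolded uniformly_continuous_on_def, rule_format, of "e / 2"] by simp
    then obtain \<delta> where \<delta>: "0 < \<delta>" "\<And>x y. dist y x < \<delta> \<Longrightarrow> dist (\<phi> y) (\<phi> x) < e / 2"
      by blast
    have "(\<lambda>n. of_int k / s n) \<longlonglongrightarrow> 0"
      using s by (intro tendsto_divide_0[OF tendsto_const] filterlim_at_top_imp_at_infinity)
    from LIMSEQ_D[OF this \<delta>(1)] obtain n0 where n0: "\<And>n. n0 \<le> n \<Longrightarrow> \<bar>of_int k / s n\<bar> < \<delta>" by auto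
    show "\<exists>no. \<forall>n\<ge>no. norm ((heat_step1 (p n) ^^ m n) (\<lambda>k. \<phi> (of_int k / s n)) k - (\<integral>x. \<phi> x \<partial>scaled_walk (p n) (m n) (s n)) - 0) < e"
    proof (intro exI allI impI)
      fix n assume n: "n0 \<le> n"
      let ?E = "measure_pmf.expectation (lazy_walk (p n) (m n))"
      have fin: "integrable (measure_pmf (lazy_walk (p n) (m n))) f" for f :: "int \<Rightarrow> real"
        by (rule integrable_measure_pmf_finite) simp
      have "(heat_step1 (p n) ^^ m n) (\<lambda>k. \<phi> (of_int k / s n)) k - (\<integral>x. \<phi> x \<partial>scaled_walk (p n) (m n) (s n))
        = ?E (\<lambda>j. \<phi> (of_int (k + j) / s n)) - ?E (\<lambda>j. \<phi> (of_int j / s n))"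
        unfolding int expectation_lazy_walk[OF p, symmetric] ..
      also have "\<dots> = ?E (\<lambda>j. \<phi> (of_int (k + j) / s n) - \<phi> (of_int j / s n))"
        by (rule Bochner_Integration.integral_diff[OF fin fin, symmetric])
      also have "\<bar>\<dots>\<bar> \<le> ?E (\<lambda>j. \<bar>\<phi> (of_int (k + j) / s n) - \<phi> (of_int j / s n)\<bar>)"
        by (rule integral_abs_bound)
      also have "\<dots> \<le> ?E (\<lambda>j. e / 2)"
      proof (rule expectation_mono_finite)
        fix j
        have "dist (of_int (k + j) / s n) (of_int j / s n) < \<delta>"
          using n0[OF n] by (simp add: dist_real_def add_divide_distrib)
        from \<delta>(2)[OF this] show "\<bar>\<phi> (of_int (k + j) / s n) - \<phi> (of_int j / s n)\<bar> \<le> e / 2"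
          by (simp add: dist_real_def)
      qed simp
      also have "\<dots> < e" using e by simp
      finally show "norm ((heat_step1 (p n) ^^ m n) (\<lambda>k. \<phi> (of_int k / s n)) k - (\<integral>x. \<phi> x \<partial>scaled_walk (p n) (m n) (s n)) - 0) < e"
        by simp
    qed
  qed
  from tendsto_add[OF this conv] show ?thesis by simp
qed

lemma abs_prod_le_1:
  fixes a :: "'i \<Rightarrow> real"
  assumes "\<And>i. i \<in> A \<Longrightarrow> \<bar>a i\<bar> \<le> 1"
  shows "\<bar>\<Prod>i\<in>A. a i\<bar> \<le> 1"
  unfolding abs_prod by (rule prod_le_1) (use assms in auto)

text \<open>The constant only has to satisfy the recursion \<open>K (n + 1) \<ge> 4 n + 3 K n\<close> that comes from
  multiplying the expansion by one more factor.\<close>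

lemma prod_first_order:
  fixes a b :: "'i \<Rightarrow> real"
  assumes "finite A" and q: "0 \<le> q" "q \<le> 1" and a: "\<And>i. \<bar>a i\<bar> \<le> 1" and b: "\<And>i. \<bar>b i\<bar> \<le> 2"
  shows "\<bar>(\<Prod>i\<in>A. a i + q * b i) - ((\<Prod>i\<in>A. a i) + q * (\<Sum>j\<in>A. b j * (\<Prod>i\<in>A - {j}. a i)))\<bar> \<le> q\<^sup>2 * 5 ^ card A"
  using assms(1)
proof induction
  case empty
  then show ?case by simp
next
  case (insert i A)
  define P0 where "P0 = (\<Prod>i\<in>A. a i)"
  define P1 where "P1 = (\<Sum>j\<in>A. b j * (\<Prod>i\<in>A - {j}. a i))"
  define R where "R = (\<Prod>i\<in>A. a i + q * b i) - (P0 + q * P1)"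
  have R: "\<bar>R\<bar> \<le> q\<^sup>2 * 5 ^ card A" using insert.IH unfolding R_def P0_def P1_def .
  have P1: "\<bar>P1\<bar> \<le> 2 * real (card A)"
  proof -
    have "\<bar>P1\<bar> \<le> (\<Sum>j\<in>A. \<bar>b j * (\<Prod>i\<in>A - {j}. a i)\<bar>)" unfolding P1_def by (rule sum_abs)
    also have "\<dots> \<le> (\<Sum>j\<in>A. 2 * 1)"
      unfolding abs_mult by (intro sum_mono mult_mono b abs_prod_le_1 a) auto
    finally show ?thesis by (simp add: mult.commute)
  qed
  have sum: "(\<Sum>j\<in>insert i A. b j * (\<Prod>i\<in>insert i A - {j}. a i)) = b i * P0 + a i * P1"
  proof -
    have "(\<Prod>k\<in>insert i A - {j}. a k) = a i * (\<Prod>k\<in>A - {j}. a k)" if "j \<in> A" for j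
    proof -
      have "insert i A - {j} = insert i (A - {j})" using that insert.hyps by auto
      then show ?thesis using insert.hyps by simp
    qed
    then have "(\<Sum>j\<in>A. b j * (\<Prod>k\<in>insert i A - {j}. a k)) = a i * P1"
      unfolding P1_def sum_distrib_left by (intro sum.cong) auto
    moreover have "insert i A - {i} = A" using insert.hyps by auto
    ultimately show ?thesis using insert.hyps by (simp add: P0_def)
  qed
  have "(\<Prod>k\<in>insert i A. a k + q * b k) - ((\<Prod>k\<in>insert i A. a k)
      + q * (\<Sum>j\<in>insert i A. b j * (\<Prod>k\<in>insert i A - {j}. a k)))
    = (a i + q * b i) * (P0 + q * P1 + R) - (a i * P0 + q * (b i * P0 + a i * P1))"
    unfolding sum using insert.hyps by (simp add: R_def P0_def)
  also have "\<dots> = q\<^sup>2 * (b i * P1) + (a i + q * b i) * R"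
    by (simp add: algebra_simps power2_eq_square)
  also have "\<bar>\<dots>\<bar> \<le> q\<^sup>2 * (2 * (2 * real (card A))) + 3 * (q\<^sup>2 * 5 ^ card A)"
  proof (rule order_trans[OF abs_triangle_ineq add_mono])
    show "\<bar>q\<^sup>2 * (b i * P1)\<bar> \<le> q\<^sup>2 * (2 * (2 * real (card A)))"
    proof -
      have "\<bar>b i\<bar> * \<bar>P1\<bar> \<le> 2 * (2 * real (card A))" by (rule mult_mono[OF b P1]) auto
      then show ?thesis unfolding abs_mult by (intro mult_mono[of "\<bar>q\<^sup>2\<bar>"]) simp_all
    qed
    have "\<bar>q * b i\<bar> \<le> 1 * 2" unfolding abs_mult using q b[of i] by (intro mult_mono) auto
    then have "\<bar>a i + q * b i\<bar> \<le> 3" using a[of i] by linarith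
    then show "\<bar>(a i + q * b i) * R\<bar> \<le> 3 * (q\<^sup>2 * 5 ^ card A)"
      unfolding abs_mult by (rule mult_mono[OF _ R]) auto
  qed
  also have "\<dots> \<le> q\<^sup>2 * (5 * 5 ^ card A)"
  proof -
    have two: "2 * real n \<le> 5 ^ n" for n
    proof (induction n)
      case (Suc n)
      have "(1::real) \<le> 5 ^ n" by simp
      with Suc have "2 + 2 * real n \<le> 5 * 5 ^ n" by linarith
      then show ?case by simp
    qed simp
    have "2 * (2 * real (card A)) + 3 * 5 ^ card A \<le> 5 * 5 ^ card A"
      using two[of "card A"] by linarith
    then have "q\<^sup>2 * (2 * (2 * real (card A)) + 3 * 5 ^ card A) \<le> q\<^sup>2 * (5 * 5 ^ card A)"
      by (rule mult_left_mono) simp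
    then show ?thesis by (simp add: algebra_simps)
  qed
  finally show ?case using insert.hyps by simp
qed

lemma heat_step1_bounded:
  assumes "0 \<le> p" "p \<le> 1" "\<And>k. \<bar>u k\<bar> \<le> 1"
  shows "\<bar>heat_step1 p u k\<bar> \<le> 1"
proof -
  have "heat_step1 p u k = (1 - p) * u k + p * ((u (k + 1) + u (k - 1)) / 2)"
    by (simp add: heat_step1_def field_simps)
  also have "\<bar>\<dots>\<bar> \<le> (1 - p) * 1 + p * 1"
  proof (rule order_trans[OF abs_triangle_ineq add_mono])
    show "\<bar>(1 - p) * u k\<bar> \<le> (1 - p) * 1" unfolding abs_mult using assms by (intro mult_mono) auto
    have "\<bar>(u (k + 1) + u (k - 1)) / 2\<bar> \<le> 1" using assms(3)[of "k + 1"] assms(3)[of "k - 1"] by (auto simp: abs_le_iff)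
    then show "\<bar>p * ((u (k + 1) + u (k - 1)) / 2)\<bar> \<le> p * 1" unfolding abs_mult using assms by (intro mult_mono) auto
  qed
  finally show ?thesis by simp
qed

lemma heat_step1_funpow_bounded:
  assumes "0 \<le> p" "p \<le> 1" "\<And>k. \<bar>u k\<bar> \<le> 1"
  shows "\<bar>(heat_step1 p ^^ m) u k\<bar> \<le> 1"
  using assms(3)
proof (induction m arbitrary: k)
  case (Suc m)
  show ?case unfolding funpow.simps comp_apply by (rule heat_step1_bounded[OF assms(1,2)]) (rule Suc.IH[OF Suc.prems])
qed simp

lemma heat_step_prod:
  fixes w :: "'d::finite \<Rightarrow> int \<Rightarrow> real"
  shows "heat_step p (\<lambda>x. \<Prod>j\<in>UNIV. w j (x $ j)) x = (\<Prod>j\<in>UNIV. w j (x $ j))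
    + p * (\<Sum>j\<in>UNIV. ((w j (x $ j + 1) - w j (x $ j)) + (w j (x $ j - 1) - w j (x $ j))) / 2
        * (\<Prod>i\<in>UNIV - {j}. w i (x $ i)))"
proof -
  have off: "(\<Prod>i\<in>UNIV. w i ((x + axis j c) $ i)) = w j (x $ j + c) * (\<Prod>i\<in>UNIV - {j}. w i (x $ i))" for j c
    by (subst prod.remove[of _ j]) (auto simp: axis_def intro!: prod.cong)
  have on: "(\<Prod>i\<in>UNIV. w i (x $ i)) = w j (x $ j) * (\<Prod>i\<in>UNIV - {j}. w i (x $ i))" for j
    by (rule prod.remove) auto
  have minus: "x - axis j 1 = x + axis j (- 1)" for j
    by (auto simp: vec_eq_iff axis_def)
  have "(\<Sum>j\<in>UNIV. ((\<Prod>i\<in>UNIV. w i ((x + axis j 1) $ i)) - (\<Prod>i\<in>UNIV. w i (x $ i)))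
      + ((\<Prod>i\<in>UNIV. w i ((x - axis j 1) $ i)) - (\<Prod>i\<in>UNIV. w i (x $ i))))
    = (\<Sum>j\<in>UNIV. 2 * (((w j (x $ j + 1) - w j (x $ j)) + (w j (x $ j - 1) - w j (x $ j))) / 2
        * (\<Prod>i\<in>UNIV - {j}. w i (x $ i))))"
  proof (rule sum.cong[OF refl])
    fix j
    show "((\<Prod>i\<in>UNIV. w i ((x + axis j 1) $ i)) - (\<Prod>i\<in>UNIV. w i (x $ i)))
      + ((\<Prod>i\<in>UNIV. w i ((x - axis j 1) $ i)) - (\<Prod>i\<in>UNIV. w i (x $ i)))
      = 2 * (((w j (x $ j + 1) - w j (x $ j)) + (w j (x $ j - 1) - w j (x $ j))) / 2
        * (\<Prod>i\<in>UNIV - {j}. w i (x $ i)))"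
      unfolding minus off on[of j] by (simp add: algebra_simps)
  qed
  then show ?thesis unfolding heat_step_def by (simp add: sum_distrib_left[symmetric] sum_divide_distrib[symmetric])
qed

text \<open>One step of the lattice operator is the first order part of the product of the one-dimensional
  steps: the walk moves in one coordinate at a time, while the product also allows simultaneous moves. The
  errors of the single steps add up because the lattice operator is a contraction for the supremum norm.\<close>

theorem heat_step_product_approx:
  fixes v :: "'d::finite \<Rightarrow> int \<Rightarrow> real" and p :: real
  assumes p: "0 \<le> p" "p * CARD('d) \<le> 1" and v: "\<And>j k. \<bar>v j k\<bar> \<le> 1"
  shows "\<bar>(heat_step p ^^ m) (\<lambda>x. \<Prod>j\<in>UNIV. v j (x $ j)) x - (\<Prod>j\<in>UNIV. (heat_step1 p ^^ m) (v j) (x $ j))\<bar>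
    \<le> m * (p\<^sup>2 * 5 ^ CARD('d))"
proof (induction m arbitrary: x)
  case 0
  then show ?case by simp
next
  case (Suc m)
  have "1 \<le> real CARD('d)" using zero_less_card_finite[where 'a='d] by linarith
  then have "p * 1 \<le> p * CARD('d)" using p by (intro mult_left_mono)
  then have p1: "p \<le> 1" using p by simp
  let ?w = "\<lambda>j. (heat_step1 p ^^ m) (v j)"
  let ?G = "\<lambda>x. \<Prod>j\<in>UNIV. ?w j (x $ j)" and ?T = "(heat_step p ^^ m) (\<lambda>x. \<Prod>j\<in>UNIV. v j (x $ j))"
  let ?b = "\<lambda>j. ((?w j (x $ j + 1) - ?w j (x $ j)) + (?w j (x $ j - 1) - ?w j (x $ j))) / 2"
  have w: "\<bar>?w j k\<bar> \<le> 1" for j k by (rule heat_step1_funpow_bounded[OF p(1) p1 v])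
  have "\<bar>heat_step p (\<lambda>x. ?T x - ?G x) x\<bar> \<le> m * (p\<^sup>2 * 5 ^ CARD('d))"
    by (rule heat_step_bounded[OF p Suc.IH])
  moreover have "\<bar>(\<Prod>j\<in>UNIV. ?w j (x $ j) + p * ?b j) - heat_step p ?G x\<bar> \<le> p\<^sup>2 * 5 ^ CARD('d)"
    unfolding heat_step_prod[of p ?w x]
  proof (rule prod_first_order[OF finite p(1) p1 w])
    fix j
    show "\<bar>?b j\<bar> \<le> 2" using w[of j "x $ j + 1"] w[of j "x $ j"] w[of j "x $ j - 1"] by (auto simp: abs_le_iff)
  qed
  moreover have "(\<Prod>j\<in>UNIV. ?w j (x $ j) + p * ?b j) = (\<Prod>j\<in>UNIV. (heat_step1 p ^^ Suc m) (v j) (x $ j))"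
    by (intro prod.cong) (simp_all add: heat_step1_def)
  ultimately have "\<bar>heat_step p ?T x - (\<Prod>j\<in>UNIV. (heat_step1 p ^^ Suc m) (v j) (x $ j))\<bar>
    \<le> m * (p\<^sup>2 * 5 ^ CARD('d)) + p\<^sup>2 * 5 ^ CARD('d)"
    unfolding heat_step_diff by linarith
  then show ?case by (simp add: algebra_simps)
qed

text \<open>The coordinates separate by \<open>heat_step_product_approx\<close>, each converges for every starting
  point, and dominated convergence averages over the initial distribution.\<close>

theorem heat_step_product_limit:
  fixes p s :: "nat \<Rightarrow> real" and m :: "nat \<Rightarrow> nat" and u :: "'d::finite \<Rightarrow> real \<Rightarrow> real"
    and \<mu> :: "(int ^ 'd) pmf"
  assumes p: "\<And>n. 0 \<le> p n" "\<And>n. p n * CARD('d) \<le> 1" and s: "filterlim s at_top sequentially"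
    and var: "(\<lambda>n. m n * p n / (s n)\<^sup>2) \<longlonglongrightarrow> 1" and err: "(\<lambda>n. m n * (p n)\<^sup>2) \<longlonglongrightarrow> 0"
    and u: "\<And>j. uniformly_continuous_on UNIV (u j)" "\<And>j y. \<bar>u j y\<bar> \<le> 1"
  shows "(\<lambda>n. measure_pmf.expectation \<mu> ((heat_step (p n) ^^ m n) (\<lambda>x. \<Prod>j\<in>UNIV. u j (of_int (x $ j) / s n))))
    \<longlonglongrightarrow> (\<Prod>j\<in>UNIV. \<integral>y. u j y \<partial>std_normal_distribution)"
proof -
  have "1 \<le> real CARD('d)" using zero_less_card_finite[where 'a='d] by linarith
  then have "p n * 1 \<le> p n * CARD('d)" for n using p(1) by (intro mult_left_mono)
  then have p1: "p n \<le> 1" for n using p(2)[of n] by (metis mult.right_neutral order_trans)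
  let ?T = "\<lambda>n. (heat_step (p n) ^^ m n) (\<lambda>x. \<Prod>j\<in>UNIV. u j (of_int (x $ j) / s n))"
  let ?G = "\<lambda>n x. \<Prod>j\<in>UNIV. (heat_step1 (p n) ^^ m n) (\<lambda>k. u j (of_int k / s n)) (x $ j)"
  let ?l = "\<Prod>j\<in>UNIV. \<integral>y. u j y \<partial>std_normal_distribution"
  let ?e = "\<lambda>n. m n * ((p n)\<^sup>2 * 5 ^ CARD('d))"
  have e0: "?e \<longlonglongrightarrow> 0"
  proof -
    have "(\<lambda>n. (m n * (p n)\<^sup>2) * 5 ^ CARD('d)) \<longlonglongrightarrow> 0 * 5 ^ CARD('d)" by (intro tendsto_intros err)
    then show ?thesis by (simp add: mult_ac)
  qed
  have G1: "\<bar>?G n x\<bar> \<le> 1" for n x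
    by (intro abs_prod_le_1 heat_step1_funpow_bounded p p1 u)
  have TG: "\<bar>?T n x - ?G n x\<bar> \<le> ?e n" for n x
    by (rule heat_step_product_approx[OF p]) (rule u)
  have intG: "integrable (measure_pmf \<mu>) (?G n)" for n
    by (rule measure_pmf.integrable_const_bound[where B=1]) (use G1 in auto)
  have intT: "integrable (measure_pmf \<mu>) (?T n)" for n
  proof (rule measure_pmf.integrable_const_bound[where B="1 + ?e n"])
    have "\<bar>?T n x\<bar> \<le> 1 + ?e n" for x using TG[of n x] G1[of n x] by linarith
    then show "AE x in measure_pmf \<mu>. norm (?T n x) \<le> 1 + ?e n" by simp
  qed simp
  have lim: "(\<lambda>n. measure_pmf.expectation \<mu> (?G n)) \<longlonglongrightarrow> measure_pmf.expectation \<mu> (\<lambda>_. ?l)"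
  proof (rule integral_dominated_convergence[where w="\<lambda>_. 1"])
    show "AE x in measure_pmf \<mu>. (\<lambda>n. ?G n x) \<longlonglongrightarrow> ?l"
      by (intro always_eventually allI tendsto_prod heat_step1_central_limit[OF p(1) p1 s var u])
  qed (use G1 in auto)
  have "(\<lambda>n. measure_pmf.expectation \<mu> (?T n) - measure_pmf.expectation \<mu> (?G n)) \<longlonglongrightarrow> 0"
  proof (rule Lim_null_comparison[OF always_eventually e0], rule allI)
    fix n
    have "norm (measure_pmf.expectation \<mu> (?T n) - measure_pmf.expectation \<mu> (?G n))
      = \<bar>measure_pmf.expectation \<mu> (\<lambda>x. ?T n x - ?G n x)\<bar>"
      by (simp add: Bochner_Integration.integral_diff[OF intT intG])
    also have "\<dots> \<le> measure_pmf.expectation \<mu> (\<lambda>x. \<bar>?T n x - ?G n x\<bar>)" by (rule integral_abs_bound)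
    also have "\<dots> \<le> ?e n"
      by (rule measure_pmf.integral_le_const)
         (use TG intT intG in \<open>auto intro!: integrable_abs Bochner_Integration.integrable_diff\<close>)
    finally show "norm (measure_pmf.expectation \<mu> (?T n) - measure_pmf.expectation \<mu> (?G n)) \<le> ?e n" .
  qed
  from tendsto_add[OF this lim] show ?thesis by simp
qed

section \<open>The standard Gaussian measure\<close>

lemma Basis_cart: "(Basis :: (real ^ 'd::finite) set) = range (\<lambda>i. axis i 1)"
  by (auto simp: Basis_vec_def)

lemma prod_cart_Basis:
  fixes F :: "'d::finite \<Rightarrow> 'b::comm_monoid_mult"
  shows "(\<Prod>b\<in>(Basis :: (real ^ 'd) set). F (the_inv (\<lambda>i. axis i 1) b)) = (\<Prod>i\<in>UNIV. F i)"
proof -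
  have inj: "inj (\<lambda>i::'d. axis i (1::real))" by (auto intro!: injI simp: axis_eq_axis)
  show ?thesis unfolding Basis_cart
    by (subst prod.reindex[OF inj]) (simp add: the_inv_f_f[OF inj])
qed

lemma prod_component_Basis:
  fixes F :: "'d::finite \<Rightarrow> real \<Rightarrow> 'b::comm_monoid_mult" and x :: "real ^ 'd"
  shows "(\<Prod>i\<in>UNIV. F i (x $ i)) = (\<Prod>b\<in>Basis. F (the_inv (\<lambda>i. axis i 1) b) (x \<bullet> b))"
proof -
  have inj: "inj (\<lambda>i::'d. axis i (1::real))" by (auto intro!: injI simp: axis_eq_axis)
  show ?thesis unfolding Basis_cart
    by (subst prod.reindex[OF inj]) (simp add: the_inv_f_f[OF inj] cart_eq_inner_axis)
qed

lemma prob_space_std_gaussian: "prob_space (std_gaussian :: (real ^ 'd::finite) measure)"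
proof
  have "emeasure (std_gaussian :: (real ^ 'd) measure) (space std_gaussian)
    = (\<integral>\<^sup>+x. ennreal (\<Prod>i\<in>UNIV. std_normal_density (x $ i)) \<partial>(lborel :: (real ^ 'd) measure))"
    unfolding std_gaussian_def by (subst emeasure_density) (auto simp: space_lborel)
  also have "\<dots> = (\<integral>\<^sup>+x. (\<Prod>b\<in>Basis. ennreal (std_normal_density (x \<bullet> b))) \<partial>(lborel :: (real ^ 'd) measure))"
    unfolding prod_component_Basis[of "\<lambda>_. std_normal_density"] by (simp add: prod_ennreal)
  also have "\<dots> = (\<Prod>b\<in>(Basis :: (real ^ 'd) set). \<integral>\<^sup>+x. ennreal (std_normal_density x) \<partial>lborel)"
    by (rule nn_integral_lborel_prod) auto
  also have "(\<integral>\<^sup>+x. ennreal (std_normal_density x) \<partial>lborel) = 1"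
    using prob_space.emeasure_space_1[OF prob_space_normal_density[of 1 0]]
    by (simp add: emeasure_density space_lborel)
  finally show "emeasure (std_gaussian :: (real ^ 'd) measure) (space std_gaussian) = 1" by simp
qed

lemma integral_std_gaussian_prod:
  fixes u :: "'d::finite \<Rightarrow> real \<Rightarrow> real"
  assumes u: "\<And>j. u j \<in> borel_measurable borel" "\<And>j y. \<bar>u j y\<bar> \<le> B"
  shows "(\<integral>x. (\<Prod>j\<in>UNIV. u j (x $ j)) \<partial>std_gaussian) = (\<Prod>j\<in>UNIV. \<integral>y. u j y \<partial>std_normal_distribution)"
proof -
  let ?v = "\<lambda>j y. std_normal_density y * u j y"
  let ?i = "the_inv (\<lambda>i. axis i 1) :: real ^ 'd \<Rightarrow> 'd"
  have [measurable]: "(\<lambda>x::real ^ 'd. x $ i) \<in> borel_measurable borel" for i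
    by (intro borel_measurable_continuous_onI continuous_intros)
  note [measurable] = u(1)
  have int: "integrable lborel (?v j)" for j
  proof -
    interpret N: prob_space std_normal_distribution by (rule prob_space_normal_density) simp
    have "integrable std_normal_distribution (u j)"
      by (rule N.integrable_const_bound[where B=B]) (use u in auto)
    then show ?thesis by (subst (asm) integrable_density) auto
  qed
  interpret product_sigma_finite "\<lambda>_ :: real ^ 'd. lborel :: real measure" by standard
  have inner: "(\<Sum>b\<in>Basis. f b *\<^sub>R b) \<bullet> b = f b" if "b \<in> Basis" for f and b :: "real ^ 'd"
    using that by simp
  have "(\<integral>x. (\<Prod>j\<in>UNIV. u j (x $ j)) \<partial>std_gaussian)
    = (\<integral>x. (\<Prod>j\<in>UNIV. std_normal_density (x $ j)) * (\<Prod>j\<in>UNIV. u j (x $ j)) \<partial>(lborel :: (real ^ 'd) measure))"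
    unfolding std_gaussian_def
    by (subst integral_density) (auto intro!: prod_nonneg)
  also have "\<dots> = (\<integral>x. (\<Prod>b\<in>Basis. ?v (?i b) (x \<bullet> b)) \<partial>(lborel :: (real ^ 'd) measure))"
    unfolding prod.distrib[symmetric] prod_component_Basis[of ?v] ..
  also have "\<dots> = (\<integral>f. (\<Prod>b\<in>Basis. ?v (?i b) ((\<Sum>b\<in>Basis. f b *\<^sub>R b) \<bullet> b)) \<partial>(\<Pi>\<^sub>M b\<in>(Basis :: (real ^ 'd) set). lborel))"
    by (subst lborel_eq, rule integral_distr) measurable
  also have "\<dots> = (\<integral>f. (\<Prod>b\<in>Basis. ?v (?i b) (f b)) \<partial>(\<Pi>\<^sub>M b\<in>(Basis :: (real ^ 'd) set). lborel))"
    by (intro Bochner_Integration.integral_cong refl prod.cong) (simp only: inner)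
  also have "\<dots> = (\<Prod>b\<in>(Basis :: (real ^ 'd) set). integral\<^sup>L lborel (?v (?i b)))"
    by (rule product_integral_prod) (auto intro: int)
  also have "\<dots> = (\<Prod>j\<in>UNIV. integral\<^sup>L lborel (?v j))"
    by (rule prod_cart_Basis)
  also have "\<dots> = (\<Prod>j\<in>UNIV. \<integral>y. u j y \<partial>std_normal_distribution)"
    by (intro prod.cong refl) (subst integral_density, auto)
  finally show ?thesis .
qed

lemma sets_std_gaussian [simp, measurable_cong]: "sets std_gaussian = sets borel"
  by (simp add: std_gaussian_def)

lemma measurable_std_gaussian [simp]: "measurable std_gaussian N = measurable borel N"
  by (rule measurable_cong_sets) simp_all

lemma integrable_std_gaussian_bounded:
  fixes f :: "real ^ 'd::finite \<Rightarrow> real"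
  assumes "f \<in> borel_measurable borel" "\<And>x. \<bar>f x\<bar> \<le> B"
  shows "integrable std_gaussian f"
  by (rule finite_measure.integrable_const_bound[OF prob_space.finite_measure[OF prob_space_std_gaussian], where B=B]) (use assms in auto)

lemma integrable_std_gaussian_const [simp]: "integrable std_gaussian (\<lambda>_. c :: real)"
  by (rule integrable_std_gaussian_bounded[where B="\<bar>c\<bar>"]) auto

section \<open>Averages under random weights\<close>

text \<open>The infinite sum is \<open>0\<close> by convention where it does not converge absolutely, so this set
  has to be measurable too.\<close>

lemma borel_measurable_infsum_countable:
  fixes a :: "'i::countable \<Rightarrow> 'w \<Rightarrow> real"
  assumes a: "\<And>x. a x \<in> borel_measurable M"
  shows "(\<lambda>\<omega>. \<Sum>\<^sub>\<infinity>x\<in>UNIV. a x \<omega>) \<in> borel_measurable M"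
proof -
  let ?b = "\<lambda>n \<omega>. if n \<in> range (to_nat :: 'i \<Rightarrow> nat) then a (from_nat n) \<omega> else 0"
  have b [measurable]: "?b n \<in> borel_measurable M" for n using a by (cases "n \<in> range (to_nat :: 'i \<Rightarrow> nat)") simp_all
  have eq: "(\<Sum>\<^sub>\<infinity>x\<in>UNIV. a x \<omega>) = (if (\<Sum>n. ennreal \<bar>?b n \<omega>\<bar>) \<noteq> top then \<Sum>n. ?b n \<omega> else 0)" for \<omega>
  proof -
    have "(\<Sum>\<^sub>\<infinity>x\<in>UNIV. a x \<omega>) = (\<Sum>\<^sub>\<infinity>x\<in>(UNIV :: 'i set). a (from_nat (to_nat x)) \<omega>)" by simp
    also have "\<dots> = (\<Sum>\<^sub>\<infinity>n\<in>range (to_nat :: 'i \<Rightarrow> nat). a (from_nat n) \<omega>)"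
      by (rule infsum_reindex_bij_betw) (simp add: bij_betw_def)
    also have "\<dots> = (\<Sum>\<^sub>\<infinity>n\<in>UNIV. ?b n \<omega>)"
      by (rule infsum_cong_neutral) auto
    also have "\<dots> = (if (\<Sum>n. ennreal \<bar>?b n \<omega>\<bar>) \<noteq> top then \<Sum>n. ?b n \<omega> else 0)"
    proof (cases "(\<lambda>n. ?b n \<omega>) summable_on UNIV")
      case True
      then have "(\<lambda>n. \<bar>?b n \<omega>\<bar>) summable_on UNIV"
        unfolding summable_on_iff_abs_summable_on_real[of "\<lambda>n. ?b n \<omega>"] by (simp only: real_norm_def)
      then have "summable (\<lambda>n. \<bar>?b n \<omega>\<bar>)" by (rule summable_on_imp_summable)
      then have "(\<Sum>n. ennreal \<bar>?b n \<omega>\<bar>) \<noteq> top" by (rule ennreal_suminf_neq_top) (rule abs_ge_zero)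
      moreover have "(\<Sum>\<^sub>\<infinity>n\<in>UNIV. ?b n \<omega>) = (\<Sum>n. ?b n \<omega>)"
        by (rule sums_unique[OF has_sum_imp_sums[OF has_sum_infsum[OF True]]])
      ultimately show ?thesis by (simp only: if_True simp_thms)
    next
      case False
      have "(\<Sum>n. ennreal \<bar>?b n \<omega>\<bar>) = top"
      proof (rule ccontr)
        assume "(\<Sum>n. ennreal \<bar>?b n \<omega>\<bar>) \<noteq> top"
        then have "summable (\<lambda>n. norm (?b n \<omega>))"
          unfolding real_norm_def by (rule summable_suminf_not_top[rotated]) (rule abs_ge_zero)
        then have "(\<lambda>n. ?b n \<omega>) summable_on UNIV" by (rule norm_summable_imp_summable_on)
        with False show False ..
      qed
      then show ?thesis by (simp only: infsum_not_exists[OF False] if_False simp_thms)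
    qed
    finally show ?thesis .
  qed
  show ?thesis
    unfolding eq
  proof (rule measurable_If)
    show "(\<lambda>\<omega>. \<Sum>n. ?b n \<omega>) \<in> borel_measurable M" by (rule borel_measurable_suminf) (rule b)
    have [measurable]: "(\<lambda>\<omega>. \<Sum>n. ennreal \<bar>?b n \<omega>\<bar>) \<in> borel_measurable M"
      by (intro borel_measurable_suminf_order measurable_compose[OF _ measurable_ennreal] borel_measurable_abs b)
    show "{\<omega>\<in>space M. (\<Sum>n. ennreal \<bar>?b n \<omega>\<bar>) \<noteq> top} \<in> sets M" by measurable
  qed simp
qed

locale subprobability_weights =
  fixes w :: "'i \<Rightarrow> real"
  assumes nonneg: "0 \<le> w x" and mass: "finite F \<Longrightarrow> (\<Sum>x\<in>F. w x) \<le> 1"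
begin

definition average :: "('i \<Rightarrow> real) \<Rightarrow> real" where
  "average f = (\<Sum>\<^sub>\<infinity>x\<in>UNIV. f x * w x)"

lemma summable_w: "w summable_on UNIV"
proof (rule nonneg_bdd_above_summable_on)
  show "bdd_above (sum w ` {F. F \<subseteq> UNIV \<and> finite F})"
    by (rule bdd_aboveI[of _ 1]) (use mass in auto)
qed (rule nonneg)

lemma summable:
  assumes "\<And>x. \<bar>f x\<bar> \<le> B"
  shows "(\<lambda>x. f x * w x) summable_on UNIV"
proof -
  have "(\<lambda>x. norm (f x * w x)) summable_on UNIV"
  proof (rule Infinite_Sum.abs_summable_on_comparison_test'[where g="\<lambda>x. B * w x"])
    show "(\<lambda>x. B * w x) summable_on UNIV" by (rule summable_on_cmult_right[OF summable_w])
    show "norm (f x * w x) \<le> B * w x" for x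
      using assms nonneg by (simp add: abs_mult mult_right_mono)
  qed
  then show ?thesis by (rule Infinite_Sum.abs_summable_summable)
qed

lemma average_add:
  assumes "\<And>x. \<bar>f x\<bar> \<le> B" "\<And>x. \<bar>g x\<bar> \<le> C"
  shows "average (\<lambda>x. f x + g x) = average f + average g"
  unfolding average_def distrib_right by (rule infsum_add[OF summable[of f B] summable[of g C]]) (rule assms)+

lemma average_scale: "average (\<lambda>x. c * f x) = c * average f"
  unfolding average_def by (simp add: mult.assoc infsum_cmult_right')

lemma average_mono:
  assumes "\<And>x. \<bar>f x\<bar> \<le> B" "\<And>x. \<bar>g x\<bar> \<le> C" "\<And>x. f x \<le> g x"
  shows "average f \<le> average g"
  unfolding average_def
  by (rule infsum_mono[OF summable[of f B] summable[of g C]]) (use assms nonneg in \<open>auto intro: mult_right_mono\<close>)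

lemma average_1: "average (\<lambda>_. 1) \<le> 1"
  unfolding average_def using infsum_le_finite_sums[OF summable_w, of 1] mass by simp

text \<open>The mass where \<open>\<psi>\<close> is small is controlled by the total mass: the average of \<open>1 - \<psi>\<close> is at most
  \<open>1 - average \<psi>\<close>.\<close>

lemma average_cutoff:
  assumes f: "\<And>x. \<bar>f x\<bar> \<le> B" and h: "\<And>x. \<bar>h x\<bar> \<le> C" and \<psi>: "\<And>x. \<bar>\<psi> x\<bar> \<le> 1"
    and fh: "\<And>x. \<bar>f x - h x\<bar> \<le> \<epsilon> + K * (1 - \<psi> x)" and "0 \<le> \<epsilon>" "0 \<le> K"
  shows "\<bar>average f - average h\<bar> \<le> \<epsilon> + K * (1 - average \<psi>)"
proof -
  let ?g = "\<lambda>x. \<epsilon> + K * (1 - \<psi> x)"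
  have K\<psi>: "\<bar>K * \<psi> x\<bar> \<le> K" for x
    using mult_left_mono[OF \<psi>[of x] assms(6)] assms(6) by (simp add: abs_mult)
  have g: "\<bar>?g x\<bar> \<le> \<epsilon> + K * 2" for x
  proof -
    have "K * \<bar>1 - \<psi> x\<bar> \<le> K * 2" using \<psi>[of x] by (intro mult_left_mono assms) linarith
    moreover have "\<bar>?g x\<bar> \<le> \<bar>\<epsilon>\<bar> + \<bar>K\<bar> * \<bar>1 - \<psi> x\<bar>"
      unfolding abs_mult[symmetric] by (rule abs_triangle_ineq)
    ultimately show ?thesis using assms(5,6) by simp
  qed
  have "?g = (\<lambda>x. (\<epsilon> + K) * 1 + (-K) * \<psi> x)" by (rule ext) (simp add: algebra_simps)
  then have "average ?g = average (\<lambda>x. (\<epsilon> + K) * 1 + (-K) * \<psi> x)" by (rule arg_cong)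
  also have "\<dots> = average (\<lambda>x. (\<epsilon> + K) * 1) + average (\<lambda>x. (-K) * \<psi> x)"
    by (rule average_add[of _ "\<bar>\<epsilon> + K\<bar>" _ K]) (use K\<psi> in simp_all)
  also have "\<dots> \<le> (\<epsilon> + K) * 1 + (- K) * average \<psi>"
    unfolding average_scale[of "\<epsilon> + K" "\<lambda>_. 1"] average_scale
    by (rule add_mono[OF mult_left_mono[OF average_1] order_refl]) (use assms(5,6) in simp)
  finally have G: "average ?g \<le> \<epsilon> + K * (1 - average \<psi>)" by (simp add: algebra_simps)
  have one: "average a - average b \<le> average ?g"
    if a: "\<And>x. \<bar>a x\<bar> \<le> A" and b: "\<And>x. \<bar>b x\<bar> \<le> B'" and ab: "\<And>x. a x \<le> b x + ?g x" for a b A B'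
  proof -
    have "average a \<le> average (\<lambda>x. b x + ?g x)"
      by (rule average_mono[OF a, of _ "B' + (\<epsilon> + K * 2)"]) (use b g ab in \<open>auto intro: order_trans[OF abs_triangle_ineq add_mono]\<close>)
    also have "\<dots> = average b + average ?g" by (rule average_add[OF b g])
    finally show ?thesis by simp
  qed
  have ptw: "f x \<le> h x + ?g x" "h x \<le> f x + ?g x" for x
    using fh[of x] unfolding abs_le_iff by linarith+
  have "average f - average h \<le> average ?g" by (rule one[OF f h ptw(1)])
  moreover have "average h - average f \<le> average ?g" by (rule one[OF h f ptw(2)])
  ultimately show ?thesis using G by linarith
qed

end

section \<open>Convergence for products of functions of one coordinate\<close>

lemma compact_support_uniformly_continuous:
  fixes u :: "real \<Rightarrow> real"
  assumes cont: "continuous_on UNIV u" and supp: "\<And>y. a < \<bar>y\<bar> \<Longrightarrow> u y = 0"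
  shows "uniformly_continuous_on UNIV u"
  unfolding uniformly_continuous_on_def
proof (intro allI impI)
  fix e :: real assume e: "0 < e"
  let ?I = "{- a - 1..a + 1}"
  have "uniformly_continuous_on ?I u"
    by (intro compact_uniformly_continuous continuous_on_subset[OF cont]) auto
  then have "\<exists>d>0. \<forall>x\<in>?I. \<forall>y\<in>?I. dist y x < d \<longrightarrow> dist (u y) (u x) < e"
    using e unfolding uniformly_continuous_on_def by simp
  then obtain d where d: "0 < d" "\<And>x y. x \<in> ?I \<Longrightarrow> y \<in> ?I \<Longrightarrow> dist y x < d \<Longrightarrow> dist (u y) (u x) < e"
    by blast
  have "dist (u y) (u x) < e" if xy: "dist y x < min d 1" for x y
  proof (cases "x \<in> ?I \<and> y \<in> ?I")
    case True
    then show ?thesis using d(2) xy by simp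
  next
    case False
    then have "a < \<bar>x\<bar>" "a < \<bar>y\<bar>" using xy by (auto simp: dist_real_def)
    then show ?thesis using supp e by simp
  qed
  with d(1) show "\<exists>d>0. \<forall>x\<in>UNIV. \<forall>x'\<in>UNIV. dist x' x < d \<longrightarrow> dist (u x') (u x) < e"
    by (intro exI[of _ "min d 1"]) simp
qed

lemma finite_vec_components:
  assumes "finite A"
  shows "finite {x :: int ^ 'd::finite. \<forall>j. x $ j \<in> A}"
proof -
  have "{x :: int ^ 'd. \<forall>j. x $ j \<in> A} \<subseteq> vec_lambda ` (PiE UNIV (\<lambda>_. A))"
  proof
    fix x :: "int ^ 'd" assume "x \<in> {x. \<forall>j. x $ j \<in> A}"
    then have "vec_nth x \<in> PiE UNIV (\<lambda>_. A)" by auto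
    then show "x \<in> vec_lambda ` (PiE UNIV (\<lambda>_. A))" by (metis image_eqI vec_nth_inverse)
  qed
  then show ?thesis by (rule finite_subset) (intro finite_imageI finite_PiE assms, simp)
qed

lemma finite_rescaled_box:
  fixes s a :: real
  assumes "0 < s"
  shows "finite {x :: int ^ 'd::finite. \<forall>j. \<bar>of_int (x $ j) / s\<bar> \<le> a}"
proof (rule finite_subset)
  show "{x :: int ^ 'd. \<forall>j. \<bar>of_int (x $ j) / s\<bar> \<le> a} \<subseteq> {x. \<forall>j. x $ j \<in> {- \<lceil>a * s\<rceil>..\<lceil>a * s\<rceil>}}"
  proof safe
    fix x :: "int ^ 'd" and j
    assume "\<forall>j. \<bar>of_int (x $ j) / s\<bar> \<le> a"
    then have "\<bar>of_int (x $ j)\<bar> \<le> a * s" using assms by (simp add: field_simps)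
    then show "x $ j \<in> {- \<lceil>a * s\<rceil>..\<lceil>a * s\<rceil>}" by (auto simp: abs_le_iff) linarith+
  qed
qed (rule finite_vec_components, simp)

lemma prod_unit_step:
  fixes w :: "'d::finite \<Rightarrow> int \<Rightarrow> real"
  assumes "\<And>j k. \<bar>w j k\<bar> \<le> 1"
  shows "\<bar>(\<Prod>j\<in>UNIV. w j ((x + axis i 1) $ j)) - (\<Prod>j\<in>UNIV. w j (x $ j))\<bar> \<le> \<bar>w i (x $ i + 1) - w i (x $ i)\<bar>"
proof -
  let ?r = "\<Prod>j\<in>UNIV - {i}. w j (x $ j)"
  have "(\<Prod>j\<in>UNIV. w j ((x + axis i 1) $ j)) = w i (x $ i + 1) * ?r"
    by (subst prod.remove[of _ i]) (auto simp: axis_def intro!: prod.cong)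
  moreover have "(\<Prod>j\<in>UNIV. w j (x $ j)) = w i (x $ i) * ?r" by (rule prod.remove) auto
  moreover have "\<bar>?r\<bar> \<le> 1" by (rule abs_prod_le_1) (rule assms)
  ultimately show ?thesis by (simp add: left_diff_distrib[symmetric] abs_mult mult_left_le)
qed

text \<open>The three bounds serve the degree condition of the variance bound, the product approximation
  of the heat operator and the clash probability.\<close>

lemma exists_fine_step_number:
  fixes T C :: real
  assumes "1 \<le> T" "0 \<le> C"
  shows "\<exists>m. (0::nat) < m \<and> 2 * T \<le> m \<and> T ^ 3 \<le> m \<and> C / m \<le> 1 / T"
proof -
  let ?m = "nat \<lceil>2 * T + T ^ 3 + C * T\<rceil>"
  have pos: "0 \<le> T ^ 3" "0 \<le> C * T" using assms by auto
  have m: "2 * T + T ^ 3 + C * T \<le> real ?m" by linarith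
  have le: "2 * T \<le> real ?m" "T ^ 3 \<le> real ?m" using m pos assms by linarith+
  have "0 < real ?m" using m pos assms by linarith
  have "C * T \<le> real ?m" using m pos assms by linarith
  then have "C / real ?m \<le> 1 / T" using \<open>0 < real ?m\<close> assms by (simp add: field_simps)
  with le \<open>0 < real ?m\<close> show ?thesis by (intro exI[of _ ?m] conjI) (simp_all only: of_nat_0_less_iff)
qed

text \<open>Here \<open>r\<close> is the mean number of rings per edge and step, and \<open>p\<close> the probability of a ring. The
  walk makes \<open>m\<close> steps of coordinate variance \<open>p\<close>; the last two facts say that \<open>m * p\<close> is asymptotically the
  variance \<open>T / (2 * d)\<close>, and that the product approximation becomes exact.\<close>

lemma small_step_parameters:
  fixes T d r p :: real and m :: nat
  assumes T: "1 \<le> T" and d: "1 \<le> d" and m: "0 < m" "2 * T \<le> m" "T ^ 3 \<le> m"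
    and r: "r = T / (2 * d * m)" and p: "p = 1 - exp (- r)"
  shows "0 < r" "r \<le> 1 / T" "0 \<le> p" "p * d \<le> 1" "m * p / (T / (2 * d)) = p / r" "m * p\<^sup>2 \<le> 1 / T"
proof -
  have m0: "0 < real m" using m(1) by simp
  show r0: "0 < r" unfolding r using T d m0 by (intro divide_pos_pos mult_pos_pos) auto
  show p0: "0 \<le> p" using r0 unfolding p by simp
  have pr: "p \<le> r" unfolding p by (rule one_minus_exp_le)
  have mr: "m * r = T / (2 * d)" using m0 d unfolding r by simp
  have "p * d \<le> r * d" using pr d by (intro mult_right_mono) auto
  also have "\<dots> = T / (2 * m)" using d by (simp add: r)
  also have "\<dots> \<le> 1" using m0 m(2) T by (simp add: field_simps)
  finally show "p * d \<le> 1" .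
  show "m * p / (T / (2 * d)) = p / r" using m0 r0 unfolding mr[symmetric] by simp
  have r_le: "r \<le> 1 / T\<^sup>2"
  proof -
    have "T * T\<^sup>2 \<le> m" using m(3) by (simp add: power2_eq_square power3_eq_cube mult.assoc)
    also have "\<dots> \<le> 2 * d * m" using mult_right_mono[of 1 "2 * d" "real m"] d by simp
    finally have "T * T\<^sup>2 \<le> 2 * d * m" .
    then show ?thesis unfolding r using T d m0 by (simp add: divide_simps mult_ac)
  qed
  also have "\<dots> \<le> 1 / T" using T by (intro divide_left_mono) (auto simp: power2_eq_square)
  finally show "r \<le> 1 / T" .
  have "m * p\<^sup>2 \<le> m * r\<^sup>2" using pr p0 by (intro mult_left_mono power_mono) auto
  also have "\<dots> = (m * r) * r" by (simp add: power2_eq_square)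
  also have "\<dots> \<le> T * (1 / T\<^sup>2)"
  proof (rule mult_mono[OF _ r_le])
    have "T * 1 \<le> T * (2 * d)" using T d by (intro mult_left_mono) linarith+
    then show "m * r \<le> T" unfolding mr using d by (simp add: field_simps)
  qed (use T r0 in auto)
  also have "\<dots> = 1 / T" using T by (simp add: power2_eq_square)
  finally show "m * p\<^sup>2 \<le> 1 / T" .
qed

context averaging_process
begin

definition mean :: "real \<Rightarrow> (real ^ 'd \<Rightarrow> real) \<Rightarrow> 'w \<Rightarrow> real" where
  "mean t f \<omega> = (\<Sum>\<^sub>\<infinity>x\<in>UNIV. f (rescale t x) * \<eta> t \<omega> x)"

lemma borel_measurable_mean: "0 \<le> t \<Longrightarrow> mean t f \<in> borel_measurable M"
  unfolding mean_def
  by (intro borel_measurable_infsum_countable borel_measurable_times borel_measurable_const random_variable_coordinate)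

lemma sets_mean [measurable]: "0 \<le> t \<Longrightarrow> {\<omega>\<in>space M. \<epsilon> < \<bar>mean t f \<omega> - c\<bar>} \<in> sets M"
  using borel_measurable_mean[of t f] by measurable

lemma AE_weights:
  assumes "0 < t"
  shows "AE \<omega> in M. subprobability_weights (\<eta> t \<omega>)"
  using AE_subprobability[OF assms] by eventually_elim (auto intro: subprobability_weights.intro)

definition mean_converges :: "(real ^ 'd \<Rightarrow> real) \<Rightarrow> bool" where
  "mean_converges f \<longleftrightarrow> (\<forall>\<epsilon>>0. ((\<lambda>t. prob {\<omega>\<in>space M. \<epsilon> < \<bar>mean t f \<omega> - integral\<^sup>L std_gaussian f\<bar>}) \<longlongrightarrow> 0) at_top)"

text \<open>Compact support makes the sum over the lattice finite, so that \<open>concentration\<close> applies. Uniform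
  continuity makes the increments along edges tend to \<open>0\<close> on the scale \<open>s t\<close>.\<close>

lemma product_mean_converges:
  fixes u :: "'d \<Rightarrow> real \<Rightarrow> real"
  assumes cont: "\<And>j. continuous_on UNIV (u j)" and supp: "\<And>j y. a < \<bar>y\<bar> \<Longrightarrow> u j y = 0"
    and bound: "\<And>j y. \<bar>u j y\<bar> \<le> 1"
  shows "mean_converges (\<lambda>x. \<Prod>j\<in>UNIV. u j (x $ j))"
proof -
  let ?f = "\<lambda>x :: real ^ 'd. \<Prod>j\<in>UNIV. u j (x $ j)" and ?d = "real CARD('d)"
  let ?I = "integral\<^sup>L std_gaussian ?f"
  have d: "1 \<le> ?d" using zero_less_card_finite[where 'a='d] by linarith
  \<comment> \<open>Times below \<open>1\<close> are moved up to \<open>1\<close>, so that the parameters are admissible at all times and not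
    only eventually.\<close>
  define T where "T t = max 1 t" for t :: real
  define s where "s t = sqrt (T t / (2 * ?d))" for t
  define F where "F t = {x :: int ^ 'd. \<forall>j. \<bar>of_int (x $ j) / s t\<bar> \<le> a}" for t
  define g where "g t x = (\<Prod>j\<in>UNIV. u j (of_int (x $ j) / s t))" for t and x :: "int ^ 'd"
  have T1: "1 \<le> T t" for t by (simp add: T_def)
  have T_lim: "filterlim T at_top at_top"
    by (rule filterlim_at_top_mono[OF filterlim_ident]) (simp add: T_def)
  have s0: "0 < s t" for t using T1[of t] d by (simp add: s_def)
  have s2: "(s t)\<^sup>2 = T t / (2 * ?d)" for t using T1[of t] d by (simp add: s_def)
  have s_lim: "filterlim s at_top at_top"
  proof -
    have "filterlim (\<lambda>t. 1 / (2 * ?d) * T t) at_top at_top"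
      by (rule filterlim_tendsto_pos_mult_at_top[OF tendsto_const _ T_lim]) (use d in simp)
    from filterlim_compose[OF sqrt_at_top this] show ?thesis unfolding s_def by simp
  qed
  have unif: "uniformly_continuous_on UNIV (u j)" for j
    by (rule compact_support_uniformly_continuous[OF cont supp])
  have F: "finite (F t)" for t unfolding F_def by (rule finite_rescaled_box[OF s0])
  have g0: "g t x = 0" if "x \<notin> F t" for t x
  proof -
    obtain j where "a < \<bar>of_int (x $ j) / s t\<bar>" using \<open>x \<notin> F t\<close> unfolding F_def by (auto simp: not_le)
    then have "u j (of_int (x $ j) / s t) = 0" by (rule supp)
    then show ?thesis unfolding g_def by (intro prod_zero) auto
  qed
  have "\<exists>m::nat. 0 < m \<and> 2 * T t \<le> m \<and> T t ^ 3 \<le> m \<and> card (F t) * clash_bound (T t) / m \<le> 1 / T t" for t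
  proof -
    have "0 \<le> card (F t) * clash_bound (T t)"
      unfolding clash_bound_def by (intro mult_nonneg_nonneg divide_nonneg_nonneg) auto
    from exists_fine_step_number[OF T1[of t] this] show ?thesis .
  qed
  then obtain m :: "real \<Rightarrow> nat" where m: "\<And>t. 0 < m t" "\<And>t. 2 * T t \<le> m t" "\<And>t. T t ^ 3 \<le> m t"
    "\<And>t. card (F t) * clash_bound (T t) / m t \<le> 1 / T t" by metis
  define r where "r t = T t / (2 * ?d * m t)" for t
  define p where "p t = 1 - exp (- r t)" for t
  define c where "c t = measure_pmf.expectation \<mu> ((heat_step (p t) ^^ m t) (g t))" for t
  note par = small_step_parameters[OF T1 d m(1-3) r_def p_def]
  have inv_T: "((\<lambda>t. 1 / T t) \<longlongrightarrow> 0) at_top"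
    by (intro tendsto_divide_0[OF tendsto_const] filterlim_at_top_imp_at_infinity T_lim)
  have r_lim: "(r \<longlongrightarrow> 0) at_top"
    by (rule tendsto_sandwich[OF _ _ tendsto_const inv_T])
       (use par(1,2) in \<open>auto intro!: always_eventually less_imp_le\<close>)
  have "((\<lambda>r::real. (1 - exp (- r)) / r) \<longlongrightarrow> 1) (at_right 0)" by real_asymp
  then have pr_lim: "((\<lambda>t. p t / r t) \<longlongrightarrow> 1) at_top"
    unfolding p_def
  proof (rule filterlim_compose)
    show "filterlim r (at_right 0) at_top"
      unfolding filterlim_at using r_lim par(1) by (simp add: less_imp_neq[symmetric] always_eventually)
  qed
  have err: "((\<lambda>t. m t * (p t)\<^sup>2) \<longlongrightarrow> 0) at_top"
    by (rule tendsto_sandwich[OF _ _ tendsto_const inv_T])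
       (use par(6) in \<open>auto intro!: always_eventually\<close>)
  have I_eq: "?I = (\<Prod>j\<in>UNIV. \<integral>y. u j y \<partial>std_normal_distribution)"
    by (rule integral_std_gaussian_prod[where B=1])
       (use cont bound in \<open>auto intro: borel_measurable_continuous_onI\<close>)
  have c_lim: "(c \<longlongrightarrow> ?I) at_top"
  proof (rule tendsto_at_topI_sequentially)
    fix X :: "nat \<Rightarrow> real" assume X: "filterlim X at_top sequentially"
    show "(\<lambda>n. c (X n)) \<longlonglongrightarrow> ?I"
      unfolding I_eq c_def g_def
    proof (rule heat_step_product_limit)
      show "0 \<le> p (X n)" "p (X n) * ?d \<le> 1" for n by (rule par(3), rule par(4))
      show "filterlim (\<lambda>n. s (X n)) at_top sequentially" by (rule filterlim_compose[OF s_lim X])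
      show "(\<lambda>n. m (X n) * p (X n) / (s (X n))\<^sup>2) \<longlonglongrightarrow> 1"
        unfolding s2 par(5) by (rule filterlim_compose[OF pr_lim X])
      show "(\<lambda>n. m (X n) * (p (X n))\<^sup>2) \<longlonglongrightarrow> 0" by (rule filterlim_compose[OF err X])
    qed (rule unif, rule bound)
  qed
  have mean_eq: "mean t ?f \<omega> = (\<Sum>x\<in>F t. g t x * \<eta> t \<omega> x)" if "1 \<le> t" for t \<omega>
  proof -
    have "?f (rescale t x) = g t x" for x :: "int ^ 'd"
      using that by (simp add: g_def s_def T_def rescale_def)
    then have "mean t ?f \<omega> = (\<Sum>\<^sub>\<infinity>x\<in>UNIV. g t x * \<eta> t \<omega> x)" by (simp add: mean_def)
    also have "\<dots> = (\<Sum>\<^sub>\<infinity>x\<in>F t. g t x * \<eta> t \<omega> x)"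
      by (rule infsum_cong_neutral) (use g0 in auto)
    also have "\<dots> = (\<Sum>x\<in>F t. g t x * \<eta> t \<omega> x)" by (rule infsum_finite[OF F])
    finally show ?thesis .
  qed
  show ?thesis
    unfolding mean_converges_def
  proof (intro allI impI)
    fix \<epsilon> :: real assume \<epsilon>: "0 < \<epsilon>"
    let ?P = "\<lambda>t. prob {\<omega>\<in>space M. \<epsilon> < \<bar>mean t ?f \<omega> - ?I\<bar>}"
    show "(?P \<longlongrightarrow> 0) at_top"
    proof (rule tendstoI)
      fix e :: real assume e: "0 < e"
      \<comment> \<open>Chosen so that the Chebyshev term of \<open>concentration\<close> for deviations by \<open>\<epsilon> / 2\<close> is \<open>e / 4\<close>.\<close>
      define L where "L = \<epsilon> * sqrt e / 4"
      have L: "0 < L" using \<epsilon> e by (simp add: L_def)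
      have L2: "L\<^sup>2 / (\<epsilon> / 2)\<^sup>2 = e / 4" using \<epsilon> e by (simp add: L_def field_simps power_mult_distrib)
      have ev1: "\<forall>\<^sub>F t in at_top. \<forall>i. \<forall>k. \<bar>u i (of_int (k + 1) / s t) - u i (of_int k / s t)\<bar> \<le> L"
      proof (rule eventually_all_finite)
        fix i
        have "\<exists>d>0. \<forall>x\<in>UNIV. \<forall>y\<in>UNIV. dist y x < d \<longrightarrow> dist (u i y) (u i x) < L"
          using unif[of i] L unfolding uniformly_continuous_on_def by simp
        then obtain \<delta> where \<delta>: "0 < \<delta>" "\<And>x y. dist y x < \<delta> \<Longrightarrow> dist (u i y) (u i x) < L" by blast
        have "\<forall>\<^sub>F t in at_top. 1 / \<delta> < s t"
          using s_lim by (simp add: filterlim_at_top_dense)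
        then show "\<forall>\<^sub>F t in at_top. \<forall>k. \<bar>u i (of_int (k + 1) / s t) - u i (of_int k / s t)\<bar> \<le> L"
        proof eventually_elim
          case (elim t)
          have "1 / s t < \<delta>" using elim s0[of t] \<delta>(1) by (simp add: field_simps)
          moreover have "of_int (k + 1) / s t - of_int k / s t = 1 / s t" for k
            by (simp add: add_divide_distrib)
          ultimately have "dist (of_int (k + 1) / s t) (of_int k / s t) < \<delta>" for k
            using s0[of t] by (simp only: dist_real_def) simp
          from \<delta>(2)[OF this] show ?case by (auto simp: dist_real_def intro: less_imp_le)
        qed
      qed
      have ev2: "\<forall>\<^sub>F t in at_top. dist (c t) ?I < \<epsilon> / 2"
        by (rule tendstoD[OF c_lim]) (use \<epsilon> in simp)
      have ev3: "\<forall>\<^sub>F t in at_top. 1 / T t < e / 2"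
        using order_tendstoD(2)[OF inv_T, of "e / 2"] e by simp
      show "\<forall>\<^sub>F t in at_top. dist (?P t) 0 < e"
        using ev1 ev2 ev3 eventually_ge_at_top[of 1]
      proof eventually_elim
        case (elim t)
        have Tt: "T t = t" using elim(4) by (simp add: T_def)
        have gL: "\<bar>g t (x + axis i 1) - g t x\<bar> \<le> L" for x i
        proof -
          have "\<bar>g t (x + axis i 1) - g t x\<bar> \<le> \<bar>u i (of_int (x $ i + 1) / s t) - u i (of_int (x $ i) / s t)\<bar>"
            unfolding g_def by (rule prod_unit_step[of "\<lambda>j k. u j (of_int k / s t)"]) (rule bound)
          also have "\<dots> \<le> L" using elim(1) by blast
          finally show ?thesis .
        qed
        have conc: "prob {\<omega>\<in>space M. \<epsilon> / 2 < \<bar>(\<Sum>x\<in>F t. g t x * \<eta> t \<omega> x) - c t\<bar>}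
          \<le> L\<^sup>2 / (\<epsilon> / 2)\<^sup>2 + card (F t) * clash_bound t / m t"
          unfolding c_def
        proof (rule concentration[OF _ m(1) _ F _ g0 gL])
          show "p t = 1 - exp (- (t / (2 * ?d * m t)))" by (simp add: p_def r_def Tt)
        qed (use elim(4) m(2)[of t] \<epsilon> Tt in auto)
        have t0: "0 \<le> t" using elim(4) by simp
        have "?P t \<le> prob {\<omega>\<in>space M. \<epsilon> / 2 < \<bar>mean t ?f \<omega> - c t\<bar>}"
        proof (rule finite_measure_mono[OF _ sets_mean[OF t0]], safe)
          fix \<omega> assume "\<epsilon> < \<bar>mean t ?f \<omega> - ?I\<bar>"
          then show "\<epsilon> / 2 < \<bar>mean t ?f \<omega> - c t\<bar>"
            using elim(2) unfolding dist_real_def by linarith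
        qed
        also have "\<dots> \<le> L\<^sup>2 / (\<epsilon> / 2)\<^sup>2 + card (F t) * clash_bound t / m t"
          using conc unfolding mean_eq[OF elim(4)] .
        also have "\<dots> \<le> e / 4 + 1 / T t" using m(4)[of t] unfolding L2 Tt by simp
        also have "\<dots> < e" using elim(3) e by linarith
        finally show ?case by (simp add: dist_real_def)
      qed
    qed
  qed
qed

end

section \<open>From products to bounded continuous functions\<close>

inductive_set product_span :: "(real ^ 'd::finite \<Rightarrow> real) set" where
  product: "(\<And>j. continuous_on UNIV (u j)) \<Longrightarrow> (\<lambda>x. \<Prod>j\<in>UNIV. u j (x $ j)) \<in> product_span"
| add: "f \<in> product_span \<Longrightarrow> g \<in> product_span \<Longrightarrow> (\<lambda>x. f x + g x) \<in> product_span"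

lemma product_span_continuous: "f \<in> product_span \<Longrightarrow> continuous_on S f"
proof (induction rule: product_span.induct)
  case (product u)
  have "continuous_on S (\<lambda>x. u j (x $ j))" for j
    by (rule continuous_on_compose2[OF product]) (auto intro: continuous_intros)
  then show ?case by (rule continuous_on_prod)
qed (rule continuous_on_add)

lemma product_span_mult:
  assumes "f \<in> product_span" "g \<in> product_span"
  shows "(\<lambda>x. f x * g x) \<in> product_span"
  using assms(1)
proof (induction rule: product_span.induct)
  case (product u)
  show ?case using assms(2)
  proof (induction rule: product_span.induct)
    case (product v)
    have "(\<lambda>x. \<Prod>j\<in>UNIV. (\<lambda>y. u j y * v j y) (x $ j)) \<in> product_span"
      by (rule product_span.product) (intro continuous_on_mult product \<open>\<And>j. continuous_on UNIV (u j)\<close>)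
    then show ?case by (simp add: prod.distrib)
  next
    case (add f g)
    from product_span.add[OF add.IH] show ?case by (simp add: distrib_left)
  qed
next
  case (add f g)
  from product_span.add[OF add.IH] show ?case by (simp add: distrib_right)
qed

lemma product_span_const: "(\<lambda>_. c) \<in> product_span"
proof -
  obtain i :: 'a where True by blast
  have "(\<lambda>x :: real ^ 'a. \<Prod>j\<in>UNIV. (\<lambda>_. if j = i then c else 1) (x $ j)) \<in> product_span"
    by (rule product_span.product) auto
  then show ?thesis by simp
qed

lemma product_span_component: "(\<lambda>x. x $ i) \<in> product_span"
proof -
  have "(\<lambda>x. \<Prod>j\<in>UNIV. (\<lambda>y. if j = i then y else 1) (x $ j)) \<in> product_span"
  proof (rule product_span.product)
    show "continuous_on UNIV (\<lambda>y::real. if j = i then y else 1)" for j by (cases "j = i") simp_all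
  qed
  then show ?thesis by simp
qed

lemma product_span_dense:
  fixes f :: "real ^ 'd::finite \<Rightarrow> real"
  assumes "compact S" "continuous_on S f" "0 < \<epsilon>"
  obtains g where "g \<in> product_span" "\<And>x. x \<in> S \<Longrightarrow> \<bar>f x - g x\<bar> < \<epsilon>"
proof -
  have "\<exists>g. g \<in> product_span \<and> (\<forall>x\<in>S. \<bar>f x - g x\<bar> < \<epsilon>)"
  proof (rule Stone_Weierstrass_HOL[where P="\<lambda>g. g \<in> product_span"])
    fix x y :: "real ^ 'd" assume "x \<in> S \<and> y \<in> S \<and> x \<noteq> y"
    then obtain i where "x $ i \<noteq> y $ i" by (auto simp: vec_eq_iff)
    then show "\<exists>f. f \<in> product_span \<and> f x \<noteq> f y" using product_span_component by blast
  qed (use assms in \<open>auto intro: product_span_const product_span_continuous product_span.add product_span_mult\<close>)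
  then show ?thesis using that by blast
qed

definition tent :: "real \<Rightarrow> real \<Rightarrow> real" where
  "tent R y = max 0 (min 1 (2 - \<bar>y\<bar> / R))"

lemma tent_range: "0 \<le> tent R y" "tent R y \<le> 1"
  by (auto simp: tent_def)

lemma tent_outside: "0 < R \<Longrightarrow> 2 * R < \<bar>y\<bar> \<Longrightarrow> tent R y = 0"
  by (simp add: tent_def field_simps)

lemma tent_inside: "0 < R \<Longrightarrow> \<bar>y\<bar> \<le> R \<Longrightarrow> tent R y = 1"
  by (simp add: tent_def field_simps)

lemma continuous_tent: "continuous_on S (tent R)"
  unfolding tent_def divide_inverse by (intro continuous_intros)

definition cutoff :: "real \<Rightarrow> real ^ 'd::finite \<Rightarrow> real" where
  "cutoff R x = (\<Prod>j\<in>UNIV. tent R (x $ j))"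

lemma cutoff_range: "0 \<le> cutoff R x" "cutoff R x \<le> 1"
  unfolding cutoff_def using tent_range by (auto intro: prod_nonneg prod_le_1)

lemma abs_cutoff_le_1: "\<bar>cutoff R x\<bar> \<le> 1"
  using cutoff_range[of R x] by (simp only: abs_of_nonneg)

lemma cutoff_product_span: "cutoff R \<in> product_span"
  unfolding cutoff_def[abs_def] by (rule product_span.product) (rule continuous_tent)

lemma cutoff_outside: "0 < R \<Longrightarrow> 2 * R < \<bar>x $ j\<bar> \<Longrightarrow> cutoff R x = 0"
  unfolding cutoff_def using tent_outside by (intro prod_zero) auto

lemma integral_cutoff_tendsto_1:
  "(\<lambda>n. \<integral>x. cutoff (real (Suc n)) x \<partial>(std_gaussian :: (real ^ 'd::finite) measure)) \<longlonglongrightarrow> 1"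
proof -
  have "(\<lambda>n. \<integral>x. cutoff (real (Suc n)) x \<partial>(std_gaussian :: (real ^ 'd) measure)) \<longlonglongrightarrow> (\<integral>x. 1 \<partial>(std_gaussian :: (real ^ 'd) measure))"
  proof (rule integral_dominated_convergence[where w="\<lambda>_. 1"])
    show "(\<lambda>x. cutoff (real (Suc n)) x) \<in> borel_measurable std_gaussian" for n
      using borel_measurable_continuous_onI[OF product_span_continuous[OF cutoff_product_span]] by simp
    show "AE x in (std_gaussian :: (real ^ 'd) measure). (\<lambda>n. cutoff (real (Suc n)) x) \<longlonglongrightarrow> 1"
    proof (intro always_eventually allI)
      fix x :: "real ^ 'd"
      have "\<forall>\<^sub>F n in sequentially. \<forall>j. tent (real (Suc n)) (x $ j) = 1"
      proof (rule eventually_all_finite)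
        fix j
        show "\<forall>\<^sub>F n in sequentially. tent (real (Suc n)) (x $ j) = 1"
          using eventually_ge_at_top[of "nat \<lceil>\<bar>x $ j\<bar>\<rceil>"]
        proof eventually_elim
          case (elim n)
          then have "\<bar>x $ j\<bar> \<le> real (Suc n)" by linarith
          then show ?case by (intro tent_inside) auto
        qed
      qed
      then have "\<forall>\<^sub>F n in sequentially. cutoff (real (Suc n)) x = 1"
        by eventually_elim (simp add: cutoff_def)
      then show "(\<lambda>n. cutoff (real (Suc n)) x) \<longlonglongrightarrow> 1" by (rule tendsto_eventually)
    qed
    show "AE x in (std_gaussian :: (real ^ 'd) measure). norm (cutoff (real (Suc n)) x) \<le> 1" for n
      by (intro always_eventually allI) (simp only: real_norm_def abs_cutoff_le_1)
  qed auto
  then show ?thesis by (simp add: prob_space.prob_space[OF prob_space_std_gaussian])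
qed

context averaging_process
begin

text \<open>The union bound in the form in which it is used: a large deviation for \<open>f\<close> forces one for
  \<open>g\<close> or one for \<open>h\<close>.\<close>

lemma mean_converges_dominated:
  assumes g: "mean_converges g" and h: "mean_converges h" and "0 < a"
    and dom: "\<And>t. 0 < t \<Longrightarrow> AE \<omega> in M. \<epsilon> < \<bar>mean t f \<omega> - c\<bar> \<longrightarrow>
      a < \<bar>mean t g \<omega> - integral\<^sup>L std_gaussian g\<bar> \<or> a < \<bar>mean t h \<omega> - integral\<^sup>L std_gaussian h\<bar>"
  shows "((\<lambda>t. prob {\<omega>\<in>space M. \<epsilon> < \<bar>mean t f \<omega> - c\<bar>}) \<longlongrightarrow> 0) at_top"
proof (rule tendsto_sandwich[OF _ _ tendsto_const])
  let ?G = "\<lambda>t. {\<omega>\<in>space M. a < \<bar>mean t g \<omega> - integral\<^sup>L std_gaussian g\<bar>}"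
  let ?H = "\<lambda>t. {\<omega>\<in>space M. a < \<bar>mean t h \<omega> - integral\<^sup>L std_gaussian h\<bar>}"
  have "((\<lambda>t. prob (?G t) + prob (?H t)) \<longlongrightarrow> 0 + 0) at_top"
    using g h \<open>0 < a\<close> unfolding mean_converges_def by (intro tendsto_add) auto
  then show "((\<lambda>t. prob (?G t) + prob (?H t)) \<longlongrightarrow> 0) at_top" by simp
  show "\<forall>\<^sub>F t in at_top. prob {\<omega>\<in>space M. \<epsilon> < \<bar>mean t f \<omega> - c\<bar>} \<le> prob (?G t) + prob (?H t)"
    using eventually_gt_at_top[of 0]
  proof eventually_elim
    case (elim t)
    have sets: "?G t \<in> sets M" "?H t \<in> sets M" using elim by (auto intro: sets_mean)
    have "prob {\<omega>\<in>space M. \<epsilon> < \<bar>mean t f \<omega> - c\<bar>} \<le> prob (?G t \<union> ?H t)"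
    proof (rule finite_measure_mono_AE)
      show "AE \<omega> in M. \<omega> \<in> {\<omega>\<in>space M. \<epsilon> < \<bar>mean t f \<omega> - c\<bar>} \<longrightarrow> \<omega> \<in> ?G t \<union> ?H t"
        using dom[OF elim] by eventually_elim blast
    qed (use sets in blast)
    also have "\<dots> \<le> prob (?G t) + prob (?H t)" by (rule measure_Un_le[OF sets])
    finally show ?case .
  qed
qed simp

lemma mean_eq_average:
  assumes "subprobability_weights (\<eta> t \<omega>)"
  shows "mean t f \<omega> = subprobability_weights.average (\<eta> t \<omega>) (\<lambda>x. f (rescale t x))"
  unfolding mean_def subprobability_weights.average_def[OF assms] ..

lemma mean_converges_add:
  assumes f: "mean_converges f" "f \<in> borel_measurable borel" "\<And>x. \<bar>f x\<bar> \<le> B"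
    and g: "mean_converges g" "g \<in> borel_measurable borel" "\<And>x. \<bar>g x\<bar> \<le> C"
  shows "mean_converges (\<lambda>x. f x + g x)"
  unfolding mean_converges_def
proof (intro allI impI)
  fix \<epsilon> :: real assume \<epsilon>: "0 < \<epsilon>"
  have int: "integral\<^sup>L std_gaussian (\<lambda>x. f x + g x) = integral\<^sup>L std_gaussian f + integral\<^sup>L std_gaussian g"
    by (rule Bochner_Integration.integral_add) (rule integrable_std_gaussian_bounded[OF f(2,3)] integrable_std_gaussian_bounded[OF g(2,3)])+
  show "((\<lambda>t. prob {\<omega>\<in>space M. \<epsilon> < \<bar>mean t (\<lambda>x. f x + g x) \<omega> - integral\<^sup>L std_gaussian (\<lambda>x. f x + g x)\<bar>}) \<longlongrightarrow> 0) at_top"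
  proof (rule mean_converges_dominated[OF f(1) g(1)])
    show "0 < \<epsilon> / 2" using \<epsilon> by simp
    fix t :: real assume "0 < t"
    show "AE \<omega> in M. \<epsilon> < \<bar>mean t (\<lambda>x. f x + g x) \<omega> - integral\<^sup>L std_gaussian (\<lambda>x. f x + g x)\<bar> \<longrightarrow>
      \<epsilon> / 2 < \<bar>mean t f \<omega> - integral\<^sup>L std_gaussian f\<bar> \<or> \<epsilon> / 2 < \<bar>mean t g \<omega> - integral\<^sup>L std_gaussian g\<bar>"
      using AE_weights[OF \<open>0 < t\<close>]
    proof eventually_elim
      case (elim \<omega>)
      interpret subprobability_weights "\<eta> t \<omega>" by (rule elim)
      have "mean t (\<lambda>x. f x + g x) \<omega> = mean t f \<omega> + mean t g \<omega>"
        unfolding mean_eq_average[OF elim] by (rule average_add) (rule f(3), rule g(3))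
      then show ?case unfolding int by linarith
    qed
  qed
qed

lemma mean_converges_scale:
  assumes f: "mean_converges f"
  shows "mean_converges (\<lambda>x. c * f x)"
  unfolding mean_converges_def
proof (intro allI impI)
  fix \<epsilon> :: real assume \<epsilon>: "0 < \<epsilon>"
  let ?a = "\<epsilon> / (\<bar>c\<bar> + 1)"
  show "((\<lambda>t. prob {\<omega>\<in>space M. \<epsilon> < \<bar>mean t (\<lambda>x. c * f x) \<omega> - integral\<^sup>L std_gaussian (\<lambda>x. c * f x)\<bar>}) \<longlongrightarrow> 0) at_top"
  proof (rule mean_converges_dominated[OF f f])
    show "0 < ?a" using \<epsilon> by (intro divide_pos_pos) auto
    fix t :: real
    have "?a < \<bar>mean t f \<omega> - integral\<^sup>L std_gaussian f\<bar>"
      if "\<epsilon> < \<bar>mean t (\<lambda>x. c * f x) \<omega> - integral\<^sup>L std_gaussian (\<lambda>x. c * f x)\<bar>" for \<omega>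
    proof -
      let ?D = "\<bar>mean t f \<omega> - integral\<^sup>L std_gaussian f\<bar>"
      have "mean t (\<lambda>x. c * f x) \<omega> = c * mean t f \<omega>"
        unfolding mean_def by (simp add: mult.assoc infsum_cmult_right')
      then have "\<epsilon> < \<bar>c\<bar> * ?D" using that by (simp add: abs_mult[symmetric] right_diff_distrib)
      also have "\<dots> \<le> (\<bar>c\<bar> + 1) * ?D" by (rule mult_right_mono) auto
      finally show ?thesis by (subst pos_divide_less_eq) (auto simp: mult.commute)
    qed
    then show "AE \<omega> in M. \<epsilon> < \<bar>mean t (\<lambda>x. c * f x) \<omega> - integral\<^sup>L std_gaussian (\<lambda>x. c * f x)\<bar> \<longrightarrow>
      ?a < \<bar>mean t f \<omega> - integral\<^sup>L std_gaussian f\<bar> \<or> ?a < \<bar>mean t f \<omega> - integral\<^sup>L std_gaussian f\<bar>"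
      by (intro always_eventually) blast
  qed
qed

text \<open>Multiplied by the cutoff, each factor has compact support and is bounded; dividing by a common
  bound brings it below \<open>1\<close>.\<close>

lemma product_span_cutoff:
  assumes R: "0 < R" and h: "h \<in> product_span"
  shows "mean_converges (\<lambda>x. h x * cutoff R x) \<and> (\<lambda>x. h x * cutoff R x) \<in> borel_measurable borel
    \<and> (\<exists>B. \<forall>x. \<bar>h x * cutoff R x\<bar> \<le> B)"
  using h
proof (induction rule: product_span.induct)
  case (product u)
  let ?v = "\<lambda>j y. u j y * tent R y"
  have cont: "continuous_on UNIV (?v j)" for j by (intro continuous_on_mult product continuous_tent)
  have supp: "?v j y = 0" if "2 * R < \<bar>y\<bar>" for j y using tent_outside[OF R that] by simp
  have "\<exists>b. \<forall>y. \<bar>?v j y\<bar> \<le> b" for j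
  proof -
    have "compact (?v j ` {- (2 * R)..2 * R})"
      by (intro compact_continuous_image continuous_on_subset[OF cont]) auto
    then obtain b where b: "\<And>y. y \<in> {- (2 * R)..2 * R} \<Longrightarrow> \<bar>?v j y\<bar> \<le> b"
      by (force dest: compact_imp_bounded simp: bounded_iff)
    have "\<bar>?v j y\<bar> \<le> \<bar>b\<bar>" for y
    proof (cases "2 * R < \<bar>y\<bar>")
      case True
      then show ?thesis unfolding supp[OF True] by simp
    next
      case False
      then have "\<bar>?v j y\<bar> \<le> b" by (intro b) auto
      then show ?thesis by linarith
    qed
    then show ?thesis by blast
  qed
  then obtain b where b: "\<And>j y. \<bar>?v j y\<bar> \<le> b j" by metis
  define B where "B = 1 + (\<Sum>j\<in>UNIV. b j)"
  have b0: "0 \<le> b j" for j using b[of j 0] by (rule order_trans[OF abs_ge_zero])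
  have B: "0 < B" unfolding B_def using sum_nonneg[of UNIV b] b0 by (simp add: add_pos_nonneg)
  have vB: "\<bar>?v j y\<bar> \<le> B" for j y
  proof -
    have "b j \<le> (\<Sum>j\<in>UNIV. b j)" by (rule member_le_sum) (use b0 in auto)
    then show ?thesis using b[of j y] unfolding B_def by linarith
  qed
  have prod: "(\<Prod>j\<in>UNIV. u j (x $ j)) * cutoff R x = B ^ CARD('d) * (\<Prod>j\<in>UNIV. ?v j (x $ j) / B)" for x :: "real ^ 'd"
    using B by (simp add: cutoff_def prod.distrib prod_dividef)
  have "mean_converges (\<lambda>x. \<Prod>j\<in>UNIV. ?v j (x $ j) / B)"
  proof (rule product_mean_converges[where u="\<lambda>j y. ?v j y / B" and a="2 * R"])
    show "continuous_on UNIV (\<lambda>y. ?v j y / B)" for j using B by (intro continuous_on_divide cont) auto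
    show "?v j y / B = 0" if "2 * R < \<bar>y\<bar>" for j y using supp[OF that, of j] by simp
    show "\<bar>?v j y / B\<bar> \<le> 1" for j y using vB[of j y] B by simp
  qed
  from mean_converges_scale[OF this] have conv: "mean_converges (\<lambda>x. (\<Prod>j\<in>UNIV. u j (x $ j)) * cutoff R x)"
    unfolding prod .
  moreover have "(\<lambda>x. (\<Prod>j\<in>UNIV. u j (x $ j)) * cutoff R x) \<in> borel_measurable borel"
    by (intro borel_measurable_continuous_onI product_span_continuous product_span_mult
        product_span.product product cutoff_product_span)
  moreover have "\<bar>(\<Prod>j\<in>UNIV. u j (x $ j)) * cutoff R x\<bar> \<le> B ^ CARD('d)" for x
  proof -
    have "\<bar>\<Prod>j\<in>UNIV. ?v j (x $ j) / B\<bar> \<le> 1"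
      by (rule abs_prod_le_1) (use vB B in simp)
    then show ?thesis unfolding prod using B by (simp add: abs_mult mult_left_le)
  qed
  ultimately show ?case by blast
next
  case (add f g)
  from add.IH obtain B C where B: "\<And>x. \<bar>f x * cutoff R x\<bar> \<le> B" and C: "\<And>x. \<bar>g x * cutoff R x\<bar> \<le> C" by blast
  have "\<bar>f x * cutoff R x + g x * cutoff R x\<bar> \<le> B + C" for x
    by (rule order_trans[OF abs_triangle_ineq add_mono[OF B C]])
  moreover have "mean_converges (\<lambda>x. f x * cutoff R x + g x * cutoff R x)"
    by (rule mean_converges_add[OF _ _ B _ _ C]) (use add.IH in blast)+
  moreover have "(\<lambda>x. f x * cutoff R x + g x * cutoff R x) \<in> borel_measurable borel"
    using add.IH by (intro borel_measurable_add) blast+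
  ultimately show ?case unfolding distrib_right by blast
qed

text \<open>Approximate \<open>f\<close> on a large box by a sum of products \<open>g\<close> and take \<open>h = g * cutoff R\<close>. Outside
  the box \<open>f\<close> is only bounded, but there \<open>1 - cutoff R\<close> equals \<open>1\<close>, and its average is close to its small
  Gaussian integral because the cutoff is a product itself.\<close>

theorem bounded_continuous_mean_converges:
  fixes f :: "real ^ 'd \<Rightarrow> real"
  assumes cont: "continuous_on UNIV f" and bound: "\<And>x. \<bar>f x\<bar> \<le> K" and K: "0 < K"
  shows "mean_converges f"
  unfolding mean_converges_def
proof (intro allI impI)
  fix \<epsilon> :: real assume \<epsilon>: "0 < \<epsilon>"
  have "\<forall>\<^sub>F n in sequentially. 1 - \<epsilon> / (8 * K) < (\<integral>x. cutoff (real (Suc n)) x \<partial>(std_gaussian :: (real ^ 'd) measure))"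
    by (rule order_tendstoD(1)[OF integral_cutoff_tendsto_1]) (use \<epsilon> K in simp)
  then obtain n where n: "1 - \<epsilon> / (8 * K) < (\<integral>x. cutoff (real (Suc n)) x \<partial>(std_gaussian :: (real ^ 'd) measure))"
    by (auto simp: eventually_sequentially)
  define R where "R = real (Suc n)"
  have R: "0 < R" by (simp add: R_def)
  let ?\<psi> = "cutoff R :: real ^ 'd \<Rightarrow> real"
  let ?I = "\<lambda>h. integral\<^sup>L (std_gaussian :: (real ^ 'd) measure) h"
  have tail: "K * (1 - ?I ?\<psi>) \<le> \<epsilon> / 8"
  proof -
    have "1 - ?I ?\<psi> \<le> \<epsilon> / (8 * K)" using n by (simp add: R_def)
    then have "K * (1 - ?I ?\<psi>) \<le> K * (\<epsilon> / (8 * K))" using K by (intro mult_left_mono) auto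
    then show ?thesis using K by simp
  qed
  let ?S = "cbox (vec (- 2 * R)) (vec (2 * R)) :: (real ^ 'd) set"
  obtain g where g: "g \<in> product_span" "\<And>x. x \<in> ?S \<Longrightarrow> \<bar>f x - g x\<bar> < \<epsilon> / 8"
    by (rule product_span_dense[of ?S f "\<epsilon> / 8"]) (use \<epsilon> continuous_on_subset[OF cont] in auto)
  define h where "h x = g x * ?\<psi> x" for x
  obtain B where h: "mean_converges h" "h \<in> borel_measurable borel" "\<And>x. \<bar>h x\<bar> \<le> B"
    using product_span_cutoff[OF R g(1)] unfolding h_def by blast
  have \<psi>: "mean_converges ?\<psi>" using product_span_cutoff[OF R product_span_const[of 1]] by simp
  have \<psi>1: "\<bar>?\<psi> x\<bar> \<le> 1" for x by (rule abs_cutoff_le_1)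
  have fh: "\<bar>f x - h x\<bar> \<le> \<epsilon> / 8 + K * (1 - ?\<psi> x)" for x
  proof (cases "x \<in> ?S")
    case True
    have "f x - h x = f x * (1 - ?\<psi> x) + (f x - g x) * ?\<psi> x" by (simp add: h_def algebra_simps)
    also have "\<bar>\<dots>\<bar> \<le> K * (1 - ?\<psi> x) + \<epsilon> / 8 * 1"
    proof (rule order_trans[OF abs_triangle_ineq add_mono])
      show "\<bar>f x * (1 - ?\<psi> x)\<bar> \<le> K * (1 - ?\<psi> x)"
        unfolding abs_mult using cutoff_range[of R x] bound[of x] by (intro mult_mono) auto
      show "\<bar>(f x - g x) * ?\<psi> x\<bar> \<le> \<epsilon> / 8 * 1"
        unfolding abs_mult using \<psi>1[of x] g(2)[OF True] \<epsilon> by (intro mult_mono) auto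
    qed
    finally show ?thesis by simp
  next
    case False
    then obtain j where "x $ j < - (2 * R) \<or> 2 * R < x $ j" by (auto simp: mem_box_cart not_le)
    then have "2 * R < \<bar>x $ j\<bar>" by linarith
    then have "?\<psi> x = 0" by (rule cutoff_outside[OF R])
    then show ?thesis using bound[of x] \<epsilon> by (simp add: h_def)
  qed
  have meas: "f \<in> borel_measurable borel" "?\<psi> \<in> borel_measurable borel"
    by (rule borel_measurable_continuous_onI[OF cont],
        rule borel_measurable_continuous_onI[OF product_span_continuous[OF cutoff_product_span]])
  have int: "integrable (std_gaussian :: (real ^ 'd) measure) f" "integrable std_gaussian h"
    "integrable (std_gaussian :: (real ^ 'd) measure) ?\<psi>"
    using integrable_std_gaussian_bounded[OF meas(1) bound] integrable_std_gaussian_bounded[OF h(2,3)]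
      integrable_std_gaussian_bounded[OF meas(2) \<psi>1] by auto
  have I_fh: "\<bar>?I f - ?I h\<bar> \<le> \<epsilon> / 8 + K * (1 - ?I ?\<psi>)"
  proof -
    have "\<bar>?I f - ?I h\<bar> = \<bar>?I (\<lambda>x. f x - h x)\<bar>"
      by (simp add: Bochner_Integration.integral_diff[OF int(1,2)])
    also have "\<dots> \<le> ?I (\<lambda>x. \<bar>f x - h x\<bar>)" by (rule integral_abs_bound)
    also have "\<dots> \<le> ?I (\<lambda>x. \<epsilon> / 8 + K * (1 - ?\<psi> x))"
      by (rule integral_mono)
         (use int fh in \<open>auto intro!: integrable_abs Bochner_Integration.integrable_diff Bochner_Integration.integrable_add integrable_mult_right\<close>)
    also have "\<dots> = \<epsilon> / 8 + K * (1 - ?I ?\<psi>)"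
      using int(3) by (simp add: prob_space.prob_space[OF prob_space_std_gaussian])
    finally show ?thesis .
  qed
  \<comment> \<open>The distance of \<open>mean t f \<omega>\<close> from its limit is at most the deviation for \<open>h\<close>, twice \<open>\<epsilon> / 8\<close> for the
    approximation, twice the Gaussian tail, and \<open>K\<close> times the deviation for the cutoff: at most \<open>6 / 8\<close> of
    \<open>\<epsilon>\<close> if both deviations are at most \<open>?a\<close>.\<close>
  let ?a = "min (\<epsilon> / 8) (\<epsilon> / (8 * K))"
  show "((\<lambda>t. prob {\<omega>\<in>space M. \<epsilon> < \<bar>mean t f \<omega> - ?I f\<bar>}) \<longlongrightarrow> 0) at_top"
  proof (rule mean_converges_dominated[OF h(1) \<psi>])
    show "0 < ?a" using \<epsilon> K by simp
    fix t :: real assume "0 < t"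
    show "AE \<omega> in M. \<epsilon> < \<bar>mean t f \<omega> - ?I f\<bar> \<longrightarrow> ?a < \<bar>mean t h \<omega> - ?I h\<bar> \<or> ?a < \<bar>mean t ?\<psi> \<omega> - ?I ?\<psi>\<bar>"
      using AE_weights[OF \<open>0 < t\<close>]
    proof eventually_elim
      case (elim \<omega>)
      interpret subprobability_weights "\<eta> t \<omega>" by (rule elim)
      have m_fh: "\<bar>mean t f \<omega> - mean t h \<omega>\<bar> \<le> \<epsilon> / 8 + K * (1 - mean t ?\<psi> \<omega>)"
        unfolding mean_eq_average[OF elim]
        by (rule average_cutoff[of _ K _ B]) (use bound h(3) \<psi>1 fh \<epsilon> K in auto)
      show ?case
      proof (rule ccontr)
        assume "\<not> ?thesis"
        then have big: "\<epsilon> < \<bar>mean t f \<omega> - ?I f\<bar>" and small: "\<bar>mean t h \<omega> - ?I h\<bar> \<le> \<epsilon> / 8"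
          "\<bar>mean t ?\<psi> \<omega> - ?I ?\<psi>\<bar> \<le> \<epsilon> / (8 * K)"
          by (simp_all only: not_imp de_Morgan_disj not_less min.bounded_iff)
        have "K * \<bar>mean t ?\<psi> \<omega> - ?I ?\<psi>\<bar> \<le> K * (\<epsilon> / (8 * K))"
          using small(2) K by (intro mult_left_mono) auto
        also have "\<dots> = \<epsilon> / 8" using K by simp
        finally have "\<bar>K * mean t ?\<psi> \<omega> - K * ?I ?\<psi>\<bar> \<le> \<epsilon> / 8"
          using K by (simp add: right_diff_distrib[symmetric] abs_mult)
        then show False
          using big small(1) m_fh I_fh tail \<epsilon> unfolding right_diff_distrib by linarith
      qed
    qed
  qed
qed

end

theorem theorem1p1:
  fixes M :: "'w measure"
    and N :: "(int ^ 'd::finite) set \<Rightarrow> real \<Rightarrow> 'w \<Rightarrow> nat"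
    and \<mu> :: "(int ^ 'd) pmf"
    and \<eta> :: "real \<Rightarrow> 'w \<Rightarrow> int ^ 'd \<Rightarrow> real"
    and f :: "real ^ 'd \<Rightarrow> real"
  assumes "averaging_process M N \<mu> \<eta>"
    and "continuous_on UNIV f"
    and "bounded (range f)"
  shows "tendsto_in_probability M
    (\<lambda>t \<omega>. \<Sum>\<^sub>\<infinity>x\<in>UNIV. f (rescale t x) * \<eta> t \<omega> x)
    (integral\<^sup>L std_gaussian f) at_top"
proof -
  interpret averaging_process M N \<mu> \<eta> by (rule assms(1))
  obtain K where K: "0 < K" "\<And>x. \<bar>f x\<bar> \<le> K"
    using assms(3) unfolding bounded_pos by auto
  have "mean_converges f" by (rule bounded_continuous_mean_converges[OF assms(2) K(2,1)])
  moreover have "\<forall>\<^sub>F t in at_top. mean t f \<in> borel_measurable M"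
    using eventually_ge_at_top[of 0] by eventually_elim (rule borel_measurable_mean)
  ultimately show ?thesis
    unfolding tendsto_in_probability_def mean_converges_def mean_def[abs_def] by blast
qed

end
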